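(* Let $n,s,d,\Delta\ge1$. There exists a set $H_{n,s,d,\Delta}\subseteq(\mathbb{A}_d)^n$ of size $(nsd)^{O(\Delta)}$ such that for every nonassociative, noncommutative arithmetic circuit $\Psi$ of size $\le s$ and product depth $\le\Delta$ computing a non-zero polynomial $f\in\mathbb{F}_{\bar{A},\bar{C}}[x_1,\ldots,x_n]$ of degree $\le d$, there is a point of $H_{n,s,d,\Delta}$ at which $f$ evaluates to a non-zero element. Furthermore, $H_{n,s,d,\Delta}$ can be computed in time $(nsd)^{O(\Delta)}$.
   Context: Throughout, the field $\mathbb{F}$ is assumed to be sufficiently large. $\mathbb{F}_{\bar{A},\bar{C}}[X]$ ($X=\{x_1,\ldots,x_n\}$) is the noncommutative, nonassociative polynomial algebra: the $\mathbb{F}$-vector space with basis the monomial $1$ and rooted full binary trees (each internal node having a designated left and right child) whose leaves are labeled by variables; the product of monomials $m_1,m_2$ is the tree with left subtree $m_1$ and right subtree $m_2$, extended bilinearly; degree = number of leaves. An arithmetic circuit over $\mathbb{F}_{\bar{A},\bar{C}}[X]$ is a DAG whose leaves are labeled by variables or field elements and whose internal gates are sum gates or fan-in-$2$ product gates with designated left and right children (using the noncommutative nonassociative product); it computes the polynomial at a designated output gate. Size = number of gates; product depth = maximum number of product gates on a leaf-to-root path. Let $\mathbb{A}'_d=\mathbb{F}^{d(d+1)^2}$ with elements indexed $x[i,j,k]$, $1\le i,j\le d+1$, $1\le k\le d$, and product $z=x\circ y$ with $z[i,j,d]=0$, $z[i,j,k]=\sum_{l=1}^{d+1}x[i,l,k+1]y[l,j,k+1]$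 for $1\le k\le d-1$. Let $\mathbb{A}_d=\{(a,\alpha):a\in\mathbb{A}'_d,\alpha\in\mathbb{F}\}$ with product $(a_1,\alpha_1)\cdot(a_2,\alpha_2)=(a_1\circ a_2+\alpha_1a_2+\alpha_2a_1,\alpha_1\alpha_2)$. For $f=\sum_mc_mm$ and $b\in(\mathbb{A}_d)^n$, $f(b)=\sum_mc_mm(b)$, where $1\mapsto(\mathbf0,1)$, $x_i\mapsto b_i$, and a monomial with left subtree $m_1$ and right subtree $m_2$ maps to $m_1(b)\cdot m_2(b)$. *)

theory Defs
  imports "HOL-Algebra.Ring" "HOL-Library.FuncSet"
begin

text \<open>
  Fields are carrier-based HOL-Algebra structures, not a type class: the statement quantifies over
  all fields inside the scope of its existential constants, so that neither the algorithm nor the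
  hidden \<open>O\<close>-constants may depend on the field (for a finite field of fixed type, constants
  depending on the field would make a largeness hypothesis vacuous).
\<close>


section \<open>Nonassociative noncommutative polynomials\<close>

datatype mtree = Leaf nat | Node mtree mtree

text \<open>\<open>None\<close> is the monomial 1.\<close>

type_synonym mono = "mtree option"

fun leaves :: "mtree \<Rightarrow> nat" where
  "leaves (Leaf i) = 1"
| "leaves (Node l r) = leaves l + leaves r"

fun tree_vars :: "mtree \<Rightarrow> nat set" where
  "tree_vars (Leaf i) = {i}"
| "tree_vars (Node l r) = tree_vars l \<union> tree_vars r"

fun mono_degree :: "mono \<Rightarrow> nat" where
  "mono_degree None = 0"
| "mono_degree (Some t) = leaves t"

fun mono_vars :: "mono \<Rightarrow> nat set" where
  "mono_vars None = {}"
| "mono_vars (Some t) = tree_vars t"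

fun mono_mult :: "mono \<Rightarrow> mono \<Rightarrow> mono" where
  "mono_mult None m = m"
| "mono_mult (Some t) None = Some t"
| "mono_mult (Some t) (Some u) = Some (Node t u)"

definition supp :: "'a ring \<Rightarrow> (mono \<Rightarrow> 'a) \<Rightarrow> mono set" where
  "supp F f = {m. f m \<noteq> \<zero>\<^bsub>F\<^esub>}"

definition term_poly :: "'a ring \<Rightarrow> 'a \<Rightarrow> mono \<Rightarrow> (mono \<Rightarrow> 'a)" where
  "term_poly F c m = (\<lambda>m'. if m' = m then c else \<zero>\<^bsub>F\<^esub>)"

text \<open>
  Both algebras below are packed into the record type \<^typ>\<open>'a ring\<close> to reuse its notation;
  they are not associative, hence not rings in the sense of the locale. In the product, every
  monomial has only finitely many factorizations, so the sum is finite.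
\<close>

definition na_poly :: "'a ring \<Rightarrow> nat \<Rightarrow> (mono \<Rightarrow> 'a) ring" where
  "na_poly F n =
    \<lparr> carrier = {f. range f \<subseteq> carrier F \<and> finite (supp F f) \<and> (\<forall>m\<in>supp F f. mono_vars m \<subseteq> {1..n})},
      mult = (\<lambda>f g m. \<Oplus>\<^bsub>F\<^esub>p \<in> {(m1, m2). mono_mult m1 m2 = m}. f (fst p) \<otimes>\<^bsub>F\<^esub> g (snd p)),
      one = term_poly F \<one>\<^bsub>F\<^esub> None,
      zero = (\<lambda>m. \<zero>\<^bsub>F\<^esub>),
      add = (\<lambda>f g m. f m \<oplus>\<^bsub>F\<^esub> g m) \<rparr>"

definition na_degree :: "'a ring \<Rightarrow> (mono \<Rightarrow> 'a) \<Rightarrow> nat" where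
  "na_degree F f = Max (insert 0 (mono_degree ` supp F f))"


section \<open>Arithmetic circuits\<close>

text \<open>
  The DAG is given by a topologically ordered list of its gates: gate \<open>i\<close> refers to its children by
  indices below \<open>i\<close>. Sum gates have unbounded fan-in; parallel edges are allowed.
\<close>

datatype 'a gate = Var nat | Const 'a | Sum "nat list" | Prod nat nat

record 'a circuit =
  gates :: "'a gate list"
  out_gate :: nat

fun children :: "'a gate \<Rightarrow> nat set" where
  "children (Var v) = {}"
| "children (Const c) = {}"
| "children (Sum js) = set js"
| "children (Prod l r) = {l, r}"

fun is_prod :: "'a gate \<Rightarrow> bool" where
  "is_prod (Prod l r) = True"
| "is_prod _ = False"

fun wf_gate :: "'a ring \<Rightarrow> nat \<Rightarrow> 'a gate \<Rightarrow> bool" where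
  "wf_gate F n (Var v) = (v \<in> {1..n})"
| "wf_gate F n (Const c) = (c \<in> carrier F)"
| "wf_gate F n (Sum js) = (js \<noteq> [])"
| "wf_gate F n (Prod l r) = True"

definition wf_circuit :: "'a ring \<Rightarrow> nat \<Rightarrow> 'a circuit \<Rightarrow> bool" where
  "wf_circuit F n C \<longleftrightarrow>
    out_gate C < length (gates C) \<and>
    (\<forall>i < length (gates C). wf_gate F n (gates C ! i) \<and> children (gates C ! i) \<subseteq> {..<i})"

fun gate_poly :: "'a ring \<Rightarrow> nat \<Rightarrow> (mono \<Rightarrow> 'a) list \<Rightarrow> 'a gate \<Rightarrow> (mono \<Rightarrow> 'a)" where
  "gate_poly F n vs (Var v) = term_poly F \<one>\<^bsub>F\<^esub> (Some (Leaf v))"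
| "gate_poly F n vs (Const c) = term_poly F c None"
| "gate_poly F n vs (Sum js) = foldr (\<lambda>j f. (vs ! j) \<oplus>\<^bsub>na_poly F n\<^esub> f) js \<zero>\<^bsub>na_poly F n\<^esub>"
| "gate_poly F n vs (Prod l r) = (vs ! l) \<otimes>\<^bsub>na_poly F n\<^esub> (vs ! r)"

definition circuit_poly :: "'a ring \<Rightarrow> nat \<Rightarrow> 'a circuit \<Rightarrow> (mono \<Rightarrow> 'a)" where
  "circuit_poly F n C = foldl (\<lambda>vs g. vs @ [gate_poly F n vs g]) [] (gates C) ! out_gate C"

definition circuit_size :: "'a circuit \<Rightarrow> nat" where
  "circuit_size C = length (gates C)"

definition leaf_root_paths :: "'a circuit \<Rightarrow> nat list set" where
  "leaf_root_paths C =
    {p. p \<noteq> [] \<and> set p \<subseteq> {..<length (gates C)} \<and> children (gates C ! hd p) = {} \<and>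
        (\<forall>j. Suc j < length p \<longrightarrow> p ! j \<in> children (gates C ! (p ! Suc j))) \<and>
        last p = out_gate C}"

definition product_depth :: "'a circuit \<Rightarrow> nat" where
  "product_depth C =
    Max ((\<lambda>p. length (filter (\<lambda>i. is_prod (gates C ! i)) p)) ` leaf_root_paths C)"


section \<open>The algebras \<open>A'\<^sub>d\<close> and \<open>A\<^sub>d\<close>\<close>

type_synonym 'a cube = "nat \<times> nat \<times> nat \<Rightarrow> 'a"

definition cube_idx :: "nat \<Rightarrow> (nat \<times> nat \<times> nat) set" where
  "cube_idx d = {1..d+1} \<times> {1..d+1} \<times> {1..d}"

definition cubes :: "'a ring \<Rightarrow> nat \<Rightarrow> 'a cube set" where
  "cubes F d = cube_idx d \<rightarrow>\<^sub>E carrier F"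

definition cube_zero :: "'a ring \<Rightarrow> nat \<Rightarrow> 'a cube" where
  "cube_zero F d = (\<lambda>p \<in> cube_idx d. \<zero>\<^bsub>F\<^esub>)"

definition cube_add :: "'a ring \<Rightarrow> nat \<Rightarrow> 'a cube \<Rightarrow> 'a cube \<Rightarrow> 'a cube" where
  "cube_add F d x y = (\<lambda>p \<in> cube_idx d. x p \<oplus>\<^bsub>F\<^esub> y p)"

definition cube_scale :: "'a ring \<Rightarrow> nat \<Rightarrow> 'a \<Rightarrow> 'a cube \<Rightarrow> 'a cube" where
  "cube_scale F d c x = (\<lambda>p \<in> cube_idx d. c \<otimes>\<^bsub>F\<^esub> x p)"

definition cube_mult :: "'a ring \<Rightarrow> nat \<Rightarrow> 'a cube \<Rightarrow> 'a cube \<Rightarrow> 'a cube" where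
  "cube_mult F d x y =
    (\<lambda>(i, j, k) \<in> cube_idx d.
       if k = d then \<zero>\<^bsub>F\<^esub>
       else (\<Oplus>\<^bsub>F\<^esub>l \<in> {1..d+1}. x (i, l, k + 1) \<otimes>\<^bsub>F\<^esub> y (l, j, k + 1)))"

definition A_alg :: "'a ring \<Rightarrow> nat \<Rightarrow> ('a cube \<times> 'a) ring" where
  "A_alg F d =
    \<lparr> carrier = cubes F d \<times> carrier F,
      mult = (\<lambda>(a1, \<alpha>1) (a2, \<alpha>2).
        (cube_add F d (cube_mult F d a1 a2)
           (cube_add F d (cube_scale F d \<alpha>1 a2) (cube_scale F d \<alpha>2 a1)),
         \<alpha>1 \<otimes>\<^bsub>F\<^esub> \<alpha>2)),
      one = (cube_zero F d, \<one>\<^bsub>F\<^esub>),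
      zero = (cube_zero F d, \<zero>\<^bsub>F\<^esub>),
      add = (\<lambda>(a1, \<alpha>1) (a2, \<alpha>2). (cube_add F d a1 a2, \<alpha>1 \<oplus>\<^bsub>F\<^esub> \<alpha>2)) \<rparr>"

definition A_scale :: "'a ring \<Rightarrow> nat \<Rightarrow> 'a \<Rightarrow> 'a cube \<times> 'a \<Rightarrow> 'a cube \<times> 'a" where
  "A_scale F d c = (\<lambda>(a, \<alpha>). (cube_scale F d c a, c \<otimes>\<^bsub>F\<^esub> \<alpha>))"

type_synonym 'a point = "nat \<Rightarrow> 'a cube \<times> 'a"

definition points :: "'a ring \<Rightarrow> nat \<Rightarrow> nat \<Rightarrow> 'a point set" where
  "points F n d = {1..n} \<rightarrow>\<^sub>E carrier (A_alg F d)"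

fun eval_tree :: "'a ring \<Rightarrow> nat \<Rightarrow> 'a point \<Rightarrow> mtree \<Rightarrow> 'a cube \<times> 'a" where
  "eval_tree F d b (Leaf i) = b i"
| "eval_tree F d b (Node l r) = eval_tree F d b l \<otimes>\<^bsub>A_alg F d\<^esub> eval_tree F d b r"

fun eval_mono :: "'a ring \<Rightarrow> nat \<Rightarrow> 'a point \<Rightarrow> mono \<Rightarrow> 'a cube \<times> 'a" where
  "eval_mono F d b None = \<one>\<^bsub>A_alg F d\<^esub>"
| "eval_mono F d b (Some t) = eval_tree F d b t"

definition eval_poly :: "'a ring \<Rightarrow> nat \<Rightarrow> 'a point \<Rightarrow> (mono \<Rightarrow> 'a) \<Rightarrow> 'a cube \<times> 'a" where
  "eval_poly F d b f =
    (\<Oplus>\<^bsub>A_alg F d\<^esub>m \<in> supp F f. A_scale F d (f m) (eval_mono F d b m))"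

definition hits :: "'a ring \<Rightarrow> nat \<Rightarrow> nat \<Rightarrow> nat \<Rightarrow> nat \<Rightarrow> 'a point set \<Rightarrow> bool" where
  "hits F n s d \<Delta> H \<longleftrightarrow>
    (\<forall>\<Psi>. wf_circuit F n \<Psi> \<and> circuit_size \<Psi> \<le> s \<and> product_depth \<Psi> \<le> \<Delta> \<and>
          circuit_poly F n \<Psi> \<noteq> \<zero>\<^bsub>na_poly F n\<^esub> \<and> na_degree F (circuit_poly F n \<Psi>) \<le> d \<longrightarrow>
      (\<exists>h\<in>H. eval_poly F d h (circuit_poly F n \<Psi>) \<noteq> \<zero>\<^bsub>A_alg F d\<^esub>))"


section \<open>Sufficiently large fields\<close>

text \<open>
  An algorithm over an abstract field needs some way to name distinct field elements. It is given
  \<open>N\<close> of them, \<open>e 0, \<dots>, e (N - 1)\<close>, about which nothing is known but that they are distinct; the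
  lemma shows that this is the same as requiring the field to have at least \<open>N\<close> elements.
\<close>

definition field_supply :: "'a ring \<Rightarrow> nat \<Rightarrow> (nat \<Rightarrow> 'a) \<Rightarrow> bool" where
  "field_supply F N e \<longleftrightarrow> inj_on e {..<N} \<and> e ` {..<N} \<subseteq> carrier F"

lemma ex_field_supply_iff:
  "(\<exists>e. field_supply F N e) \<longleftrightarrow> infinite (carrier F) \<or> N \<le> card (carrier F)"
proof
  assume "\<exists>e. field_supply F N e"
  then obtain e where "inj_on e {..<N}" "e ` {..<N} \<subseteq> carrier F"
    by (auto simp: field_supply_def)
  then show "infinite (carrier F) \<or> N \<le> card (carrier F)"
    by (metis card_inj_on_le card_lessThan)
next
  assume "infinite (carrier F) \<or> N \<le> card (carrier F)"
  then obtain S where S: "S \<subseteq> carrier F" "finite S" "card S = N"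
    by (metis infinite_arbitrarily_large obtain_subset_with_card_n)
  then obtain e where "bij_betw e {..<N} S"
    by (metis bij_betw_iff_card card_lessThan finite_lessThan)
  then show "\<exists>e. field_supply F N e"
    using S by (auto simp: field_supply_def bij_betw_def)
qed


section \<open>Machine model\<close>

text \<open>
  Algebraic random access machine with a memory of natural numbers and a memory of field elements,
  both with indirect addressing, and a write-only output of field elements. Every instruction and
  every test costs one step. Integer arithmetic is restricted to addition and truncated
  subtraction, so that after \<open>t\<close> steps integers have \<open>O(t)\<close> more bits than the input and the
  constants of the program, and unit cost is polynomially equivalent to logarithmic cost on them.
  Programs contain no field constants and are therefore meaningful over every field.
\<close>

datatype instr =
    NConst nat nat
  | NAdd nat nat nat
  | NSub nat nat nat
  | NLoad nat nat
  | NStore nat nat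
  | FZero nat
  | FOne nat
  | FElem nat nat
  | FAdd nat nat nat
  | FNeg nat nat
  | FMul nat nat nat
  | FInv nat nat
  | FLoad nat nat
  | FStore nat nat
  | FTest nat nat
  | Out nat

datatype com = Instr instr | Seq com com | IfZero nat com com | WhileNonZero nat com

record 'a state =
  nmem :: "nat \<Rightarrow> nat"
  fmem :: "nat \<Rightarrow> 'a"
  out :: "'a list"

text \<open>\<open>e\<close> is the supply of field elements accessed by \<open>FElem\<close>.\<close>

fun step :: "'a ring \<Rightarrow> (nat \<Rightarrow> 'a) \<Rightarrow> instr \<Rightarrow> 'a state \<Rightarrow> 'a state" where
  "step F e (NConst i c) \<sigma> = \<sigma>\<lparr>nmem := (nmem \<sigma>)(i := c)\<rparr>"
| "step F e (NAdd i j k) \<sigma> = \<sigma>\<lparr>nmem := (nmem \<sigma>)(i := nmem \<sigma> j + nmem \<sigma> k)\<rparr>"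
| "step F e (NSub i j k) \<sigma> = \<sigma>\<lparr>nmem := (nmem \<sigma>)(i := nmem \<sigma> j - nmem \<sigma> k)\<rparr>"
| "step F e (NLoad i j) \<sigma> = \<sigma>\<lparr>nmem := (nmem \<sigma>)(i := nmem \<sigma> (nmem \<sigma> j))\<rparr>"
| "step F e (NStore i j) \<sigma> = \<sigma>\<lparr>nmem := (nmem \<sigma>)(nmem \<sigma> i := nmem \<sigma> j)\<rparr>"
| "step F e (FZero i) \<sigma> = \<sigma>\<lparr>fmem := (fmem \<sigma>)(i := \<zero>\<^bsub>F\<^esub>)\<rparr>"
| "step F e (FOne i) \<sigma> = \<sigma>\<lparr>fmem := (fmem \<sigma>)(i := \<one>\<^bsub>F\<^esub>)\<rparr>"
| "step F e (FElem i j) \<sigma> = \<sigma>\<lparr>fmem := (fmem \<sigma>)(i := e (nmem \<sigma> j))\<rparr>"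
| "step F e (FAdd i j k) \<sigma> = \<sigma>\<lparr>fmem := (fmem \<sigma>)(i := fmem \<sigma> j \<oplus>\<^bsub>F\<^esub> fmem \<sigma> k)\<rparr>"
| "step F e (FNeg i j) \<sigma> = \<sigma>\<lparr>fmem := (fmem \<sigma>)(i := \<ominus>\<^bsub>F\<^esub> fmem \<sigma> j)\<rparr>"
| "step F e (FMul i j k) \<sigma> = \<sigma>\<lparr>fmem := (fmem \<sigma>)(i := fmem \<sigma> j \<otimes>\<^bsub>F\<^esub> fmem \<sigma> k)\<rparr>"
| "step F e (FInv i j) \<sigma> =
    \<sigma>\<lparr>fmem := (fmem \<sigma>)(i := (if fmem \<sigma> j = \<zero>\<^bsub>F\<^esub> then \<zero>\<^bsub>F\<^esub> else inv\<^bsub>F\<^esub> fmem \<sigma> j))\<rparr>"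
| "step F e (FLoad i j) \<sigma> = \<sigma>\<lparr>fmem := (fmem \<sigma>)(i := fmem \<sigma> (nmem \<sigma> j))\<rparr>"
| "step F e (FStore i j) \<sigma> = \<sigma>\<lparr>fmem := (fmem \<sigma>)(nmem \<sigma> i := fmem \<sigma> j)\<rparr>"
| "step F e (FTest i j) \<sigma> =
    \<sigma>\<lparr>nmem := (nmem \<sigma>)(i := (if fmem \<sigma> j = \<zero>\<^bsub>F\<^esub> then 0 else 1))\<rparr>"
| "step F e (Out i) \<sigma> = \<sigma>\<lparr>out := out \<sigma> @ [fmem \<sigma> i]\<rparr>"

text \<open>\<open>exec F e c \<sigma> t \<tau>\<close>: started in \<open>\<sigma>\<close>, \<open>c\<close> halts in \<open>\<tau>\<close> after exactly \<open>t\<close> steps.\<close>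

inductive exec :: "'a ring \<Rightarrow> (nat \<Rightarrow> 'a) \<Rightarrow> com \<Rightarrow> 'a state \<Rightarrow> nat \<Rightarrow> 'a state \<Rightarrow> bool"
  for F :: "'a ring" and e :: "nat \<Rightarrow> 'a" where
  exec_Instr: "exec F e (Instr i) \<sigma> 1 (step F e i \<sigma>)"
| exec_Seq: "exec F e c1 \<sigma> t1 \<sigma>' \<Longrightarrow> exec F e c2 \<sigma>' t2 \<tau> \<Longrightarrow> exec F e (Seq c1 c2) \<sigma> (t1 + t2) \<tau>"
| exec_IfTrue: "nmem \<sigma> i = 0 \<Longrightarrow> exec F e c1 \<sigma> t \<tau> \<Longrightarrow> exec F e (IfZero i c1 c2) \<sigma> (t + 1) \<tau>"
| exec_IfFalse: "nmem \<sigma> i \<noteq> 0 \<Longrightarrow> exec F e c2 \<sigma> t \<tau> \<Longrightarrow> exec F e (IfZero i c1 c2) \<sigma> (t + 1) \<tau>"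
| exec_WhileEnd: "nmem \<sigma> i = 0 \<Longrightarrow> exec F e (WhileNonZero i c) \<sigma> 1 \<sigma>"
| exec_WhileStep: "nmem \<sigma> i \<noteq> 0 \<Longrightarrow> exec F e c \<sigma> t1 \<sigma>' \<Longrightarrow> exec F e (WhileNonZero i c) \<sigma>' t2 \<tau> \<Longrightarrow>
    exec F e (WhileNonZero i c) \<sigma> (t1 + t2 + 1) \<tau>"

definition init_state :: "'a ring \<Rightarrow> nat list \<Rightarrow> 'a state" where
  "init_state F xs =
    \<lparr> nmem = (\<lambda>i. if i < length xs then xs ! i else 0), fmem = (\<lambda>_. \<zero>\<^bsub>F\<^esub>), out = [] \<rparr>"

text \<open>A point is output as the list of its \<open>n (d (d+1)\<^sup>2 + 1)\<close> coordinates.\<close>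

definition encode_elem :: "nat \<Rightarrow> 'a cube \<times> 'a \<Rightarrow> 'a list" where
  "encode_elem d x =
    map (fst x) (List.product [1..<d+2] (List.product [1..<d+2] [1..<d+1])) @ [snd x]"

definition encode_point :: "nat \<Rightarrow> nat \<Rightarrow> 'a point \<Rightarrow> 'a list" where
  "encode_point n d h = concat (map (\<lambda>i. encode_elem d (h i)) [1..<n+1])"

text \<open>A set of points is output by listing the points in any order, repetitions permitted.\<close>

definition computes_within ::
  "'a ring \<Rightarrow> (nat \<Rightarrow> 'a) \<Rightarrow> com \<Rightarrow> nat list \<Rightarrow> nat \<Rightarrow> nat \<Rightarrow> 'a point set \<Rightarrow> nat \<Rightarrow> bool" where
  "computes_within F e P xs n d H T \<longleftrightarrow>
    (\<exists>t \<tau> hs. exec F e P (init_state F xs) t \<tau> \<and> t \<le> T \<and>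
       set hs = H \<and> out \<tau> = concat (map (encode_point n d) hs))"

end

theory Submission
  imports Defs "HOL-Library.Nat_Bijection" Complex_Main
begin

text \<open>
  Evaluate at matrices supported on the first superdiagonal: \<open>x\<^sub>i\<close> gets the entry
  \<open>y (i, k, p)\<close> at row \<open>p\<close> of level \<open>k\<close>. A tree then becomes the product of the values at its leaves,
  where \<open>p\<close> is the position of a leaf and \<open>k\<close> its depth, and the depths of the leaves determine the tree.
  A tree occurring in \<open>f\<close> has height at most \<open>D = min (\<Delta> + 1) d\<close>.

  Put \<open>y x = t\<^sub>1 ^ (2 ^ idx x mod q\<^sub>1) \<cdots> t\<^sub>D ^ (2 ^ idx x mod q\<^sub>D)\<close>. The span of the gate polynomials is closed
  under fixing the left or the right subtree and has dimension at most \<open>s\<close>. If, at level \<open>k + 1\<close>, at most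
  \<open>s\<close> trees of each position and degree span all others from below in the order of weights, then at level
  \<open>k\<close> the pairs of such trees do the same, and it remains to break ties among polynomially many pairs.
  The codes of these pairs, sums of distinct powers of 2, differ modulo some polynomially bounded \<open>q\<^sub>k\<close>, since
  \<open>lcm {1..2m} \<ge> 2^m\<close>. At the root some monomial of \<open>f\<close> is thus alone in its weight, and a grid of
  polynomial size for each \<open>t\<^sub>k\<close> detects it. Each level costs a polynomial factor, for \<open>q\<^sub>k\<close> and \<open>t\<^sub>k\<close>.
\<close>


text \<open>One variable raised to the lexicographic weight would also separate the trees, but its
  grid would need \<open>(n * s * d) ^ O(\<Delta>)\<close> field elements, and the supply granted
  does not grow with \<Delta>. So \<open>lex_wt\<close> is only an order used inside the argument;
  each of its digits is small and becomes the exponent of a variable of its own. Trees that agree in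
  all exponents agree in \<open>lex_wt\<close>, which is all that the root requires.

  The dimension bound stops the growth: pairing alone would square the number of candidates at every
  level, while a greedy choice among the pairs leaves at most \<open>s\<close> again.

  Good moduli exist for each circuit but depend on it. The hitting set therefore runs over all
  choices of moduli together with all grid points; both are digits of one number \<open>M\<close>,
  which accounts for the \<open>2 * D\<close> digits.\<close>

section \<open>Moduli separating numbers\<close>

text \<open>The numbers \<open>1 / (m * (n choose m))\<close> form Leibniz's harmonic triangle,
  where each entry is the sum of the two below it. A common denominator of an entry and of one of
  the two below it is thus a denominator of the other, so \<open>Lcm {1..n}\<close> clears row
  \<open>n\<close>, starting from its end \<open>m = n\<close>.\<close>

lemma binomial_dvd_Lcm:
  assumes "1 \<le> m" "m \<le> n"
  shows "m * (n choose m) dvd Lcm {1..n}"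
  using assms
proof (induction n arbitrary: m)
  case 0
  then show ?case by simp
next
  case (Suc n)
  define D where "D = Lcm {1..Suc n}"
  show ?case unfolding D_def[symmetric] using \<open>m \<le> Suc n\<close> \<open>1 \<le> m\<close>
  proof (induction m rule: inc_induct)
    case base
    show ?case by (simp add: D_def dvd_Lcm)
  next
    case (step m)
    then have m: "1 \<le> m" "m \<le> n" by auto
    have "Lcm {1..n} dvd D" unfolding D_def by (rule Lcm_subset) auto
    with Suc.IH[OF m] have "m * (n choose m) dvd D" by (rule dvd_trans)
    then obtain a where a: "D = m * (n choose m) * a" ..
    obtain b where b: "D = Suc m * (Suc n choose Suc m) * b" using step.IH by (auto elim: dvdE)
    have e1: "Suc m * (Suc n choose Suc m) = Suc n * (n choose m)"
      using Suc_times_binomial_eq[of n m] by (simp only: mult.commute)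
    have e2: "(Suc n - m) * (Suc n choose m) = Suc n * (n choose m)"
      using binomial_absorb_comp[of "Suc n" m] by simp
    define x y where "x = int (Suc n choose m)" and "y = int (n choose m)"
    have xy: "(int n + 1 - int m) * x = (int n + 1) * y"
    proof -
      have "int (Suc n - m) = int n + 1 - int m" using m by simp
      moreover have "int (Suc n - m) * x = int (Suc n) * y"
        unfolding x_def y_def using arg_cong[OF e2, of int] by (simp only: of_nat_mult)
      ultimately show ?thesis by (simp add: add.commute)
    qed
    have y0: "y \<noteq> 0" using m by (simp add: y_def)
    have Da: "int D = int m * y * int a" unfolding y_def using arg_cong[OF a, of int] by simp
    have "int D = int (Suc n) * y * int b"
      unfolding y_def using arg_cong[OF b, of int] unfolding e1 by (simp only: of_nat_mult)
    then have Db: "int D = (int n + 1) * y * int b" by (simp add: add.commute)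
    have ab: "int m * int a = (int n + 1) * int b"
    proof -
      have "y * (int m * int a) = y * ((int n + 1) * int b)" using Da Db by (metis mult.assoc mult.commute)
      then show ?thesis using y0 by simp
    qed
    \<comment> \<open>The rule of the triangle, \<open>D / (m * x) = a - b\<close>, cleared of
      denominators; the factor \<open>n + 1\<close> cancels afterwards.\<close>
    have "int m * x * (int a - int b) * (int n + 1) = int D * (int n + 1)"
    proof -
      have "int m * x * (int a - int b) * (int n + 1) = x * (int m * int a * (int n + 1) - int m * ((int n + 1) * int b))"
        by (simp add: algebra_simps)
      also have "\<dots> = x * (int m * int a * (int n + 1) - int m * (int m * int a))" by (simp only: ab)
      also have "\<dots> = ((int n + 1 - int m) * x) * (int m * int a)" by (simp add: algebra_simps)
      also have "\<dots> = int D * (int n + 1)" unfolding xy Da by (simp add: algebra_simps)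
      finally show ?thesis .
    qed
    then have "int D = int m * x * (int a - int b)"
      by (metis mult_cancel_right of_nat_Suc of_nat_eq_0_iff add.commute nat.distinct(1))
    then have "int (m * (Suc n choose m)) dvd int D" unfolding x_def by simp
    then show ?case by (simp only: of_nat_dvd_iff)
  qed
qed

text \<open>If every number up to \<open>2 * X\<close> divided \<open>a\<close>, so would their lcm,
  which is at least \<open>X * (2 * X choose X) \<ge> 2 ^ X\<close>.\<close>

lemma ex_non_divisor:
  fixes a :: nat
  assumes a: "0 < a" "a < 2 ^ X" and Q: "1 \<le> Q" "2 * X \<le> Q" and X: "0 < X"
  shows "\<exists>q\<in>{1..Q}. \<not> q dvd a"
proof (rule ccontr)
  assume "\<not> ?thesis"
  then have "\<forall>q\<in>{1..2*X}. q dvd a" using Q by auto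
  then have "Lcm {1..2*X} dvd a" by (auto intro: Lcm_least)
  moreover have "X * (2 * X choose X) dvd Lcm {1..2*X}" using X by (intro binomial_dvd_Lcm) auto
  ultimately have "X * (2 * X choose X) \<le> a" using a by (meson dvd_imp_le dvd_trans)
  moreover have "2 ^ X \<le> X * (2 * X choose X)"
  proof -
    have "4 ^ X / (2 * real X) \<le> real (2 * X choose X)" using X by (rule central_binomial_lower_bound)
    then have "4 ^ X / 2 \<le> real X * real (2 * X choose X)" using X by (simp add: field_simps)
    moreover have "(2::real) ^ X \<le> 4 ^ X / 2"
    proof -
      have "(2::real) * 2 ^ X \<le> 2 ^ X * 2 ^ X" using X by (intro mult_right_mono) (auto intro: self_le_power)
      then show ?thesis by (simp flip: power_mult_distrib)
    qed
    ultimately have "real (2 ^ X) \<le> real (X * (2 * X choose X))" by simp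
    then show ?thesis by (simp only: of_nat_le_iff)
  qed
  ultimately show False using a by linarith
qed

text \<open>Apply the bound to the product of all differences: it is below
  \<open>2 ^ (card P * L)\<close>, and a number dividing one difference divides the product. One
  modulus for all pairs thus costs only a factor \<open>card P\<close> in its range.\<close>

lemma ex_separating_modulus:
  fixes P :: "(nat \<times> nat) set"
  assumes fin: "finite P" and ne: "\<And>a b. (a, b) \<in> P \<Longrightarrow> a \<noteq> b \<and> a < 2 ^ L \<and> b < 2 ^ L"
    and Q: "1 \<le> Q" "2 * (card P * L) \<le> Q"
  shows "\<exists>q\<in>{1..Q}. \<forall>(a, b)\<in>P. a mod q \<noteq> b mod q"
proof (cases "P = {}")
  case True
  then show ?thesis using Q by auto
next
  case False
  define \<delta> where "\<delta> = (\<lambda>(a, b). nat \<bar>int a - int b\<bar>)"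
  have pos: "0 < \<delta> x" "\<delta> x < 2 ^ L" if "x \<in> P" for x
  proof -
    obtain a b where x: "x = (a, b)" by (cases x)
    have h: "a \<noteq> b" "a < 2 ^ L" "b < 2 ^ L" using ne that x by auto
    then show "0 < \<delta> x" by (simp add: x \<delta>_def)
    have "\<delta> x \<le> max a b" unfolding x \<delta>_def by simp
    then show "\<delta> x < 2 ^ L" using h by simp
  qed
  have L: "0 < L"
  proof (rule ccontr)
    assume "\<not> 0 < L"
    then show False using False pos by fastforce
  qed
  have "(\<Prod>x\<in>P. \<delta> x) < (\<Prod>x\<in>P. 2 ^ L)"
  proof -
    obtain x0 where "x0 \<in> P" using False by auto
    then show ?thesis using fin pos by (intro prod_mono_strict[of x0]) (auto intro: less_imp_le simp: less_imp_le)
  qed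
  then have "(\<Prod>x\<in>P. \<delta> x) < 2 ^ (card P * L)" by (simp flip: power_mult add: mult.commute)
  moreover have "0 < (\<Prod>x\<in>P. \<delta> x)" using pos by (auto intro: prod_pos)
  moreover have "0 < card P * L" using False fin L by (simp add: card_gt_0_iff)
  ultimately obtain q where q: "q \<in> {1..Q}" "\<not> q dvd (\<Prod>x\<in>P. \<delta> x)"
    using ex_non_divisor Q by blast
  have "a mod q \<noteq> b mod q" if ab: "(a, b) \<in> P" for a b
  proof
    assume "a mod q = b mod q"
    then have "int q dvd int a - int b"
      by (metis mod_eq_dvd_iff zmod_int)
    then have "q dvd \<delta> (a, b)" by (simp add: \<delta>_def flip: int_dvd_int_iff)
    moreover have "\<delta> (a, b) dvd (\<Prod>x\<in>P. \<delta> x)" using fin ab by (rule dvd_prodI)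
    ultimately show False using q dvd_trans by blast
  qed
  then show ?thesis using q(1) by blast
qed

text \<open>Every choice of digits is realised, so a loop over the numbers below
  \<open>g ^ M\<close> visits all choices.\<close>

lemma ex_digits:
  fixes a :: "nat \<Rightarrow> nat"
  assumes "\<And>j. j < M \<Longrightarrow> a j < g"
  shows "\<exists>N < g ^ M. \<forall>j<M. N div g ^ j mod g = a j"
  using assms
proof (induction M arbitrary: a)
  case 0
  then show ?case by simp
next
  case (Suc M)
  obtain N where N: "N < g ^ M" "\<forall>j<M. N div g ^ j mod g = a (Suc j)"
    using Suc.IH[of "\<lambda>j. a (Suc j)"] Suc.prems by auto
  have a0: "a 0 < g" using Suc.prems by simp
  have "N * g + a 0 < g ^ Suc M"
  proof -
    have "N * g + a 0 < Suc N * g" using a0 by simp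
    also have "\<dots> \<le> g ^ M * g" using N by (intro mult_right_mono) auto
    finally show ?thesis by (simp add: mult.commute)
  qed
  moreover have "(N * g + a 0) div g ^ j mod g = a j" if "j < Suc M" for j
  proof (cases j)
    case 0
    then show ?thesis using a0 by simp
  next
    case (Suc i)
    have "(N * g + a 0) div g = N" using a0 by simp
    then have "(N * g + a 0) div g ^ j = N div g ^ i" by (simp add: Suc div_mult2_eq)
    then show ?thesis using N Suc that by simp
  qed
  ultimately show ?case by blast
qed


section \<open>Trees and isolating weights\<close>

fun height :: "mtree \<Rightarrow> nat" where
  "height (Leaf i) = 1"
| "height (Node l r) = Suc (max (height l) (height r))"

lemma height_neq_0 [simp]: "height m \<noteq> 0" by (cases m) auto
lemma leaves_pos: "0 < leaves m" by (induction m) auto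

lemma height_le_leaves: "height m \<le> leaves m"
proof (induction m)
  case (Node l r)
  then show ?case using leaves_pos[of l] leaves_pos[of r] by auto
qed simp

text \<open>A leaf is identified by its variable \<open>i\<close>, its depth \<open>k\<close> and its position \<open>p\<close> from the left.\<close>

fun letters :: "nat \<Rightarrow> nat \<Rightarrow> mtree \<Rightarrow> (nat \<times> nat \<times> nat) set" where
  "letters k p (Leaf i) = {(i, k, p)}"
| "letters k p (Node l r) = letters (Suc k) p l \<union> letters (Suc k) (p + leaves l) r"

fun word :: "nat \<Rightarrow> mtree \<Rightarrow> (nat \<times> nat) list" where
  "word k (Leaf i) = [(i, k)]"
| "word k (Node l r) = word (Suc k) l @ word (Suc k) r"

lemma length_word [simp]: "length (word k m) = leaves m"
  by (induction m arbitrary: k) auto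

lemma word_depth: "x \<in> set (word k m) \<Longrightarrow> k \<le> snd x"
proof (induction m arbitrary: k)
  case (Node l r)
  then show ?case using Suc_leD by fastforce
qed simp

text \<open>Unique parsing from the left: the first letter of a \<open>Node\<close> word has depth
  above \<open>k\<close>, that of a \<open>Leaf\<close> word has depth \<open>k\<close>. The
  suffixes \<open>xs\<close> and \<open>ys\<close> let the induction pass from the left subtree to
  the right one.\<close>

lemma word_prefix_free: "word k m @ xs = word k m' @ ys \<Longrightarrow> m = m' \<and> xs = ys"
proof (induction m arbitrary: k m' xs ys)
  case (Leaf i)
  show ?case
  proof (cases m')
    case (Leaf j)
    then show ?thesis using Leaf.prems by simp
  next
    case (Node l r)
    obtain x w where "word (Suc k) l = x # w"
      using leaves_pos[of l] length_word[of "Suc k" l] by (metis length_greater_0_conv neq_Nil_conv)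
    then have "(i, k) \<in> set (word (Suc k) l)" using Leaf.prems Node by simp
    then show ?thesis using word_depth by fastforce
  qed
next
  case (Node l r)
  show ?case
  proof (cases m')
    case (Leaf i)
    obtain x w where "word (Suc k) l = x # w"
      using leaves_pos[of l] length_word[of "Suc k" l] by (metis length_greater_0_conv neq_Nil_conv)
    then have "(i, k) \<in> set (word (Suc k) l)" using Node.prems Leaf by simp
    then show ?thesis using word_depth by fastforce
  next
    case (Node l' r')
    then have "word (Suc k) l @ word (Suc k) r @ xs = word (Suc k) l' @ word (Suc k) r' @ ys"
      using Node.prems by simp
    then have "l = l'" and e: "word (Suc k) r @ xs = word (Suc k) r' @ ys"
      using Node.IH(1) by auto
    then show ?thesis using Node.IH(2)[OF e] \<open>m' = Node l' r'\<close> by simp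
  qed
qed

lemma letters_eq_word:
  "letters k p m = (\<lambda>x. (fst (word k m ! x), snd (word k m ! x), p + x)) ` {..<leaves m}"
proof (induction m arbitrary: k p)
  case (Leaf i)
  then show ?case by auto
next
  case (Node l r)
  let ?f = "\<lambda>x. (fst (word k (Node l r) ! x), snd (word k (Node l r) ! x), p + x)"
  have "{..<leaves (Node l r)} = {..<leaves l} \<union> (+) (leaves l) ` {..<leaves r}"
    using image_add_atLeastLessThan[of "leaves l" 0 "leaves r"]
    by (auto simp: lessThan_atLeast0 add.commute)
  then have "?f ` {..<leaves (Node l r)} = ?f ` {..<leaves l} \<union> (\<lambda>x. ?f (leaves l + x)) ` {..<leaves r}"
    by (simp only: image_Un image_image)
  also have "?f ` {..<leaves l} = letters (Suc k) p l"
    unfolding Node.IH by (intro image_cong) (auto simp: nth_append)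
  also have "(\<lambda>x. ?f (leaves l + x)) ` {..<leaves r} = letters (Suc k) (p + leaves l) r"
    unfolding Node.IH by (intro image_cong) (auto simp: nth_append)
  finally show ?case by simp
qed

lemma finite_letters [simp]: "finite (letters k p m)"
  by (induction m arbitrary: k p) auto

lemma letters_position: "(i, kk, pp) \<in> letters k p m \<Longrightarrow> p \<le> pp \<and> pp < p + leaves m"
  unfolding letters_eq_word by auto

lemma letters_depth: "(i, kk, pp) \<in> letters k p m \<Longrightarrow> k \<le> kk \<and> kk < k + height m \<and> i \<in> tree_vars m"
proof (induction m arbitrary: k p)
  case (Node l r)
  then have "(i, kk, pp) \<in> letters (Suc k) p l \<or> (i, kk, pp) \<in> letters (Suc k) (p + leaves l) r"
    by simp
  then show ?case using Node.IH(1)[of "Suc k" p] Node.IH(2)[of "Suc k" "p + leaves l"] by auto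
qed simp

text \<open>Positions recover the order of the letters, so the unordered set, and hence any
  injective code of it, still determines the tree.\<close>

lemma letters_inj:
  assumes "letters k p m = letters k p m'" "leaves m = leaves m'"
  shows "m = m'"
proof -
  have "word k m ! x = word k m' ! x" if x: "x < leaves m" for x
  proof -
    have "(fst (word k m ! x), snd (word k m ! x), p + x) \<in> letters k p m"
      using x unfolding letters_eq_word by auto
    then have "(fst (word k m ! x), snd (word k m ! x), p + x) \<in> letters k p m'"
      using assms by simp
    then show ?thesis unfolding letters_eq_word by (auto simp: prod_eq_iff)
  qed
  then have "word k m = word k m'" using assms(2) by (intro nth_equalityI) auto
  then show ?thesis using word_prefix_free[of k m "[]" m' "[]"] by simp
qed

section \<open>Weights as sums over the leaves\<close>

definition wt :: "(nat \<times> nat \<times> nat \<Rightarrow> nat) \<Rightarrow> nat \<Rightarrow> nat \<Rightarrow> mtree \<Rightarrow> nat" where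
  "wt \<phi> k p m = (\<Sum>x\<in>letters k p m. \<phi> x)"

lemma wt_Leaf [simp]: "wt \<phi> k p (Leaf i) = \<phi> (i, k, p)"
  by (simp add: wt_def)

text \<open>The two subtrees occupy disjoint intervals of positions, hence share no letter.\<close>

lemma wt_Node [simp]: "wt \<phi> k p (Node l r) = wt \<phi> (Suc k) p l + wt \<phi> (Suc k) (p + leaves l) r"
proof -
  have "letters (Suc k) p l \<inter> letters (Suc k) (p + leaves l) r = {}"
  proof (rule equals0I)
    fix x assume x: "x \<in> letters (Suc k) p l \<inter> letters (Suc k) (p + leaves l) r"
    obtain i kk pp where "x = (i, kk, pp)" by (cases x)
    then show False
      using x letters_position[of i kk pp "Suc k" p l] letters_position[of i kk pp "Suc k" "p + leaves l" r]
      by auto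
  qed
  then show ?thesis by (simp add: wt_def sum.union_disjoint)
qed

lemma wt_le:
  assumes "\<And>x. \<phi> x \<le> c"
  shows "wt \<phi> k p m \<le> leaves m * c"
proof (induction m arbitrary: k p)
  case (Node l r)
  then show ?case by (simp add: add_mult_distrib add_mono)
qed (simp add: assms)

text \<open>Links the two roles of a weight: exponents are reduced letter by letter to stay small,
  whereas the modulus is chosen to separate the unreduced codes.\<close>

lemma wt_mod: "wt (\<lambda>x. \<phi> x mod q) k p m mod q = wt \<phi> k p m mod q"
  unfolding wt_def by (rule mod_sum_eq)

lemma wt_pow2:
  assumes "inj_on idx (letters k p m)"
  shows "wt (\<lambda>x. 2 ^ idx x) k p m = set_encode (idx ` letters k p m)"
  unfolding wt_def set_encode_def using assms by (simp add: sum.reindex)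

lemma set_encode_less: "A \<subseteq> {..<L} \<Longrightarrow> set_encode A < 2 ^ L"
proof -
  assume A: "A \<subseteq> {..<L}"
  have "set_encode A \<le> (\<Sum>i<L. 2 ^ i)" unfolding set_encode_def using A by (intro sum_mono2) auto
  also have "(\<Sum>i<L. 2 ^ i) < (2::nat) ^ L" by (induction L) auto
  finally show ?thesis .
qed

section \<open>Isolating sets of trees\<close>

text \<open>
  \<open>B\<close> isolates \<open>S\<close> on \<open>I\<close> if, read as functionals on the monomials, every member of \<open>I - B\<close> is a
  linear combination of members of \<open>B\<close> of smaller weight. The functionals are the members of \<open>S\<close>, and
  the condition is stated dually, without linear combinations.
\<close>

definition isolates :: "'a \<Rightarrow> nat \<Rightarrow> (mtree \<Rightarrow> 'a) set \<Rightarrow> mtree set \<Rightarrow> (mtree \<Rightarrow> nat) \<Rightarrow> mtree set \<Rightarrow> bool" where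
  "isolates z s S I w B \<longleftrightarrow> B \<subseteq> I \<and> finite B \<and> card B \<le> s \<and> inj_on w B \<and>
     (\<forall>m\<in>I - B. \<forall>f\<in>S. (\<forall>b\<in>B. w b < w m \<longrightarrow> f b = z) \<longrightarrow> f m = z)"

text \<open>Expresses that \<open>S\<close> has dimension at most \<open>s\<close>: functions in
  triangular position are independent. Only zeros are mentioned, so that the combinatorial part
  stays free of field operations.\<close>

definition triangular_bound :: "'a \<Rightarrow> nat \<Rightarrow> (mtree \<Rightarrow> 'a) set \<Rightarrow> bool" where
  "triangular_bound z s S \<longleftrightarrow> (\<forall>B (w :: mtree \<Rightarrow> nat). finite B \<longrightarrow> inj_on w B \<longrightarrow>
     (\<forall>b\<in>B. \<exists>f\<in>S. f b \<noteq> z \<and> (\<forall>b'\<in>B. w b' < w b \<longrightarrow> f b' = z)) \<longrightarrow> card B \<le> s)"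

definition derivation_closed :: "(mtree \<Rightarrow> 'a) set \<Rightarrow> bool" where
  "derivation_closed S \<longleftrightarrow> (\<forall>f\<in>S. \<forall>t. (\<lambda>u. f (Node t u)) \<in> S \<and> (\<lambda>u. f (Node u t)) \<in> S)"

text \<open>Go through \<open>C\<close> by increasing weight and keep a tree exactly when the
  lighter trees of \<open>C\<close> do not determine it on \<open>S\<close>: the greedy choice of a
  basis of least weight. By \<open>dom\<close>, the set \<open>C\<close> dominates the rest of
  \<open>I\<close>, and \<open>B\<close> inherits this.\<close>

lemma isolates_greedy:
  assumes tb: "triangular_bound z s S" and C: "finite C" "C \<subseteq> I" "inj_on w C"
    and dom: "\<And>m f. m \<in> I \<Longrightarrow> m \<notin> C \<Longrightarrow> f \<in> S \<Longrightarrow> (\<And>c. c \<in> C \<Longrightarrow> w c < w m \<Longrightarrow> f c = z) \<Longrightarrow> f m = z"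
  shows "\<exists>B\<subseteq>C. isolates z s S I w B"
proof -
  define B where "B = {c\<in>C. \<exists>f\<in>S. f c \<noteq> z \<and> (\<forall>c'\<in>C. w c' < w c \<longrightarrow> f c' = z)}"
  \<comment> \<open>A discarded tree is determined by lighter trees of \<open>C\<close>, so zeros on
    \<open>B\<close> spread to all of \<open>C\<close> below the same weight.\<close>
  have kill: "f c = z" if "f \<in> S" "c \<in> C" "w c < N" "\<And>b. b \<in> B \<Longrightarrow> w b < N \<Longrightarrow> f b = z" for f c N
    using that(2,3)
  proof (induction "w c" arbitrary: c rule: less_induct)
    case less
    show ?case
    proof (cases "c \<in> B")
      case True
      then show ?thesis using less.prems that(4) by blast
    next
      case False
      have "\<forall>c'\<in>C. w c' < w c \<longrightarrow> f c' = z"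
      proof (intro ballI impI)
        fix c' assume "c' \<in> C" "w c' < w c"
        then show "f c' = z" using less.hyps[of c'] less.prems(2) by simp
      qed
      then show ?thesis using False less.prems(1) that(1) unfolding B_def by blast
    qed
  qed
  have fB: "finite B" "inj_on w B" "B \<subseteq> C" using C by (auto simp: B_def inj_on_def)
  have "card B \<le> s"
  proof -
    \<comment> \<open>The functions because of which the trees were kept are in triangular
      position.\<close>
    have "\<forall>b\<in>B. \<exists>f\<in>S. f b \<noteq> z \<and> (\<forall>b'\<in>B. w b' < w b \<longrightarrow> f b' = z)"
      unfolding B_def by blast
    with tb fB show ?thesis unfolding triangular_bound_def by blast
  qed
  moreover have "f m = z" if m: "m \<in> I - B" and f: "f \<in> S" and k: "\<forall>b\<in>B. w b < w m \<longrightarrow> f b = z" for m f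
  proof -
    have killC: "f c = z" if "c \<in> C" "w c < w m" for c using kill[OF f that] k by auto
    show ?thesis
    proof (cases "m \<in> C")
      case True
      then show ?thesis using m f killC unfolding B_def by blast
    next
      case False
      then show ?thesis using m dom[OF _ _ f] killC by auto
    qed
  qed
  ultimately have "isolates z s S I w B" using fB C unfolding isolates_def by blast
  then show ?thesis using fB by blast
qed

text \<open>With one subtree fixed, \<open>f\<close> is again in \<open>S\<close>. So expanding
  \<open>l\<close> over \<open>B1\<close> and then \<open>r\<close> over \<open>B2\<close> expresses
  \<open>Node l r\<close> through pairs from \<open>B1\<close> and \<open>B2\<close>, and all these
  pairs are lighter because at least one of the two expansions is strict.\<close>

lemma isolates_Node:
  assumes S: "derivation_closed S"
    and i1: "isolates z s S I1 w1 B1" and i2: "isolates z s S I2 w2 B2"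
    and l: "l \<in> I1" and r: "r \<in> I2" and nb: "\<not> (l \<in> B1 \<and> r \<in> B2)" and f: "f \<in> S"
    and k: "\<And>b b'. b \<in> B1 \<Longrightarrow> b' \<in> B2 \<Longrightarrow> w1 b + w2 b' < w1 l + w2 r \<Longrightarrow> f (Node b b') = z"
  shows "f (Node l r) = z"
proof -
  have fl: "(\<lambda>u. f (Node t u)) \<in> S" and fr: "(\<lambda>u. f (Node u t)) \<in> S" for t
    using S f by (auto simp: derivation_closed_def)
  have d1: "h m = z" if "m \<in> I1" "m \<notin> B1" "h \<in> S" "\<And>b. b \<in> B1 \<Longrightarrow> w1 b < w1 m \<Longrightarrow> h b = z" for h m
    using i1 that unfolding isolates_def by blast
  have d2: "h m = z" if "m \<in> I2" "m \<notin> B2" "h \<in> S" "\<And>b. b \<in> B2 \<Longrightarrow> w2 b < w2 m \<Longrightarrow> h b = z" for h m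
    using i2 that unfolding isolates_def by blast
  show ?thesis
  proof (cases "l \<in> B1")
    case True
    then have "r \<notin> B2" using nb by simp
    then show ?thesis using d2[OF r _ fl[of l]] k[OF True] by simp
  next
    case False
    \<comment> \<open>A weak inequality suffices for \<open>b'\<close>, as the strict decrease comes
      from \<open>l\<close>; the case \<open>r \<in> B2\<close> takes \<open>b' = r\<close>.\<close>
    have *: "f (Node l b') = z" if "b' \<in> B2" "w2 b' \<le> w2 r" for b'
      using d1[OF l False fr[of b']] k[OF _ that(1)] that(2) by simp
    show ?thesis
    proof (cases "r \<in> B2")
      case True
      then show ?thesis using * by simp
    next
      case False
      then show ?thesis using d2[OF r _ fl[of l]] * by simp
    qed
  qed
qed

definition hash_wt :: "(nat \<times> nat \<times> nat \<Rightarrow> nat) \<Rightarrow> nat \<Rightarrow> nat \<Rightarrow> nat \<Rightarrow> mtree \<Rightarrow> nat" where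
  "hash_wt idx q = wt (\<lambda>x. 2 ^ idx x mod q)"

text \<open>Deeper levels carry higher powers of \<open>Z\<close>: a level only breaks the ties left by those below it.\<close>

definition lex_wt ::
  "(nat \<times> nat \<times> nat \<Rightarrow> nat) \<Rightarrow> nat \<Rightarrow> nat \<Rightarrow> (nat \<Rightarrow> nat) \<Rightarrow> nat \<Rightarrow> nat \<Rightarrow> mtree \<Rightarrow> nat" where
  "lex_wt idx Z D qs k p m = (\<Sum>j\<in>{k..D}. Z ^ j * hash_wt idx (qs j) k p m)"

definition mtrees :: "nat \<Rightarrow> nat \<Rightarrow> nat \<Rightarrow> mtree set" where
  "mtrees n h e = {m. height m \<le> h \<and> leaves m = e \<and> tree_vars m \<subseteq> {1..n}}"

lemma hash_wt_less:
  assumes "1 \<le> q" "q \<le> Q" "leaves m \<le> d" "1 \<le> d"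
  shows "hash_wt idx q k p m < d * Q"
proof -
  have "hash_wt idx q k p m \<le> leaves m * (q - 1)"
    unfolding hash_wt_def using assms(1) by (intro wt_le) (simp add: Suc_pred[symmetric] less_Suc_eq_le[symmetric])
  also have "\<dots> \<le> d * (Q - 1)" using assms by (intro mult_mono) auto
  also have "\<dots> < d * Q" using assms by simp
  finally show ?thesis .
qed

text \<open>Induction from the deepest level upwards; a subtree rooted at depth
  \<open>D + 1 - h\<close> has height at most \<open>h\<close>. One modulus per level must serve all
  starting positions \<open>p\<close> and leaf counts \<open>e\<close>, since a subtree of a tree in
  \<open>f\<close> may have any of them. The number \<open>c\<close> bounds the candidates:
  \<open>n\<close> leaves, and \<open>s * s\<close> pairs for each of at most \<open>d - 1\<close>
  splits.\<close>

theorem ex_isolating_levels: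
  fixes z :: 'a
  assumes tb: "triangular_bound z s S" and dc: "derivation_closed S"
    and D: "D \<le> d" and d: "1 \<le> d"
    and idx: "inj_on idx ({1..n} \<times> {1..d} \<times> {1..d})" "idx ` ({1..n} \<times> {1..d} \<times> {1..d}) \<subseteq> {..<L}"
    and c: "c = n + (d - 1) * (s * s)"
    and Q: "1 \<le> Q" "2 * (d * d * (c * (c - 1)) * L) \<le> Q"
    and Z: "d * Q < Z"
    and h: "h \<le> D"
  shows "\<exists>qs B. (\<forall>j. qs j \<in> {1..Q}) \<and> (\<forall>p e. 1 \<le> p \<longrightarrow> p + e \<le> d + 1 \<longrightarrow>
           isolates z s S (mtrees n h e) (lex_wt idx Z D qs (D + 1 - h) p) (B p e))"
  using h
proof (induction h)
  case 0
  have "isolates z s S (mtrees n 0 e) w {}" for e w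
    by (auto simp: isolates_def mtrees_def)
  then show ?case using Q(1) by (intro exI[of _ "\<lambda>_. 1"] exI[of _ "\<lambda>_ _. {}"]) auto
next
  case (Suc h)
  define k where "k = D - h"
  have k: "1 \<le> k" "D + 1 - h = Suc k" "D + 1 - Suc h = k" "k + h = D" using Suc.prems by (auto simp: k_def)
  obtain qs B where qs: "\<And>j. qs j \<in> {1..Q}"
    and B: "\<And>p e. 1 \<le> p \<Longrightarrow> p + e \<le> d + 1 \<Longrightarrow>
           isolates z s S (mtrees n h e) (lex_wt idx Z D qs (Suc k) p) (B p e)"
    using Suc.IH[OF Suc_leD[OF Suc.prems]] unfolding k(2) by blast
  \<comment> \<open>The candidates at level \<open>k\<close>: by \<open>isolates_Node\<close>, every
    other \<open>Node\<close> is dominated by those built from isolated subtrees.\<close>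
  define C where "C p e = (if e = 1 then Leaf ` {1..n} else {}) \<union>
      (\<Union>e1\<in>{1..<e}. (\<lambda>(l, r). Node l r) ` (B p e1 \<times> B (p + e1) (e - e1)))" for p e
  have B': "B p e \<subseteq> mtrees n h e" "finite (B p e)" "card (B p e) \<le> s" if "1 \<le> p" "p + e \<le> d + 1" for p e
    using B[OF that] by (auto simp: isolates_def)
  have C: "finite (C p e)" "C p e \<subseteq> mtrees n (Suc h) e" "card (C p e) \<le> c" if pe: "1 \<le> p" "p + e \<le> d + 1" for p e
  proof -
    have fin: "finite (B p e1 \<times> B (p + e1) (e - e1))"
      and crd: "card (B p e1 \<times> B (p + e1) (e - e1)) \<le> s * s"
      and sub: "B p e1 \<subseteq> mtrees n h e1" "B (p + e1) (e - e1) \<subseteq> mtrees n h (e - e1)" if "e1 \<in> {1..<e}" for e1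
      using that pe B'[of p e1] B'[of "p + e1" "e - e1"] by (auto simp: card_cartesian_product mult_mono)
    show "finite (C p e)" unfolding C_def using fin by auto
    show "C p e \<subseteq> mtrees n (Suc h) e"
    proof
      fix m assume "m \<in> C p e"
      then consider i where "e = 1" "m = Leaf i" "i \<in> {1..n}"
        | e1 l r where "e1 \<in> {1..<e}" "m = Node l r" "l \<in> B p e1" "r \<in> B (p + e1) (e - e1)"
        unfolding C_def by (auto split: if_splits)
      then show "m \<in> mtrees n (Suc h) e"
      proof cases
        case 1
        then show ?thesis by (auto simp: mtrees_def)
      next
        case 2
        then have "l \<in> mtrees n h e1" "r \<in> mtrees n h (e - e1)" using sub by blast+
        then show ?thesis using 2 by (auto simp: mtrees_def)
      qed
    qed
    have "card (\<Union>e1\<in>{1..<e}. (\<lambda>(l, r). Node l r) ` (B p e1 \<times> B (p + e1) (e - e1)))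
        \<le> (\<Sum>e1\<in>{1..<e}. card ((\<lambda>(l, r). Node l r) ` (B p e1 \<times> B (p + e1) (e - e1))))"
      by (intro card_UN_le) auto
    also have "\<dots> \<le> (\<Sum>e1\<in>{1..<e}. s * s)"
    proof (rule sum_mono)
      fix e1 assume e1: "e1 \<in> {1..<e}"
      show "card ((\<lambda>(l, r). Node l r) ` (B p e1 \<times> B (p + e1) (e - e1))) \<le> s * s"
        using card_image_le[OF fin[OF e1]] crd[OF e1] le_trans by blast
    qed
    also have "\<dots> \<le> (d - 1) * (s * s)"
    proof -
      have "e - 1 \<le> d - 1" using pe by simp
      then show ?thesis by simp
    qed
    finally have "card (\<Union>e1\<in>{1..<e}. (\<lambda>(l, r). Node l r) ` (B p e1 \<times> B (p + e1) (e - e1))) \<le> (d - 1) * (s * s)" .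
    moreover have "card (if e = 1 then Leaf ` {1..n} else {}) \<le> n"
      using card_image_le[of "{1..n}" Leaf] by simp
    ultimately show "card (C p e) \<le> c" unfolding C_def c by (intro order_trans[OF card_Un_le] add_mono)
  qed
  define code where "code p m = wt (\<lambda>x. 2 ^ idx x) k p m" for p m
  have lets: "letters k p m \<subseteq> {1..n} \<times> {1..d} \<times> {1..d}"
    if pe: "1 \<le> p" "p + e \<le> d + 1" and m: "m \<in> mtrees n (Suc h) e" for p e m
  proof
    fix x assume x: "x \<in> letters k p m"
    obtain i kk pp where x': "x = (i, kk, pp)" by (cases x)
    have "p \<le> pp \<and> pp < p + leaves m" "k \<le> kk \<and> kk < k + height m \<and> i \<in> tree_vars m"
      using letters_position letters_depth x x' by auto
    then show "x \<in> {1..n} \<times> {1..d} \<times> {1..d}"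
      using m k pe D x' by (auto simp: mtrees_def)
  qed
  have code: "code p m = set_encode (idx ` letters k p m)" "code p m < 2 ^ L"
    if pe: "1 \<le> p" "p + e \<le> d + 1" and m: "m \<in> mtrees n (Suc h) e" for p e m
  proof -
    show *: "code p m = set_encode (idx ` letters k p m)"
      unfolding code_def using lets[OF that] idx(1) by (intro wt_pow2) (auto intro: inj_on_subset)
    show "code p m < 2 ^ L"
      unfolding * using lets[OF that] idx(2) by (intro set_encode_less) auto
  qed
  have code_inj: "m = m'" if pe: "1 \<le> p" "p + e \<le> d + 1" and m: "m \<in> mtrees n (Suc h) e" "m' \<in> mtrees n (Suc h) e"
    and eq: "code p m = code p m'" for p e m m'
  proof -
    have "idx ` letters k p m = idx ` letters k p m'"
      using eq code(1)[OF pe m(1)] code(1)[OF pe m(2)] by (simp add: set_encode_eq)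
    then have "letters k p m = letters k p m'"
      using inj_on_image_eq_iff[OF idx(1)] lets[OF pe m(1)] lets[OF pe m(2)] by blast
    then show ?thesis using m by (intro letters_inj) (auto simp: mtrees_def)
  qed
  define PE where "PE = {(p, e) \<in> {1..d} \<times> {1..d}. p + e \<le> d + 1}"
  \<comment> \<open>Only pairs of distinct candidates are collected. The count
    \<open>c * (c - 1)\<close> instead of \<open>c * c\<close> matters for
    \<open>n = s = d = 1\<close>, where the range of the moduli, a power of 1, leaves no
    room.\<close>
  define PR where "PR = (\<Union>(p, e)\<in>PE. (\<lambda>(m, m'). (code p m, code p m')) ` (SIGMA m:C p e. C p e - {m}))"
  have PEf: "finite PE" "card PE \<le> d * d"
  proof -
    show "finite PE" unfolding PE_def by (rule finite_subset[of _ "{1..d} \<times> {1..d}"]) auto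
    have "card PE \<le> card ({1..d} \<times> {1..d})" unfolding PE_def by (intro card_mono) auto
    then show "card PE \<le> d * d" by simp
  qed
  have PRf: "finite PR"
  proof -
    have "finite (SIGMA m:C p e. C p e - {m})" if "(p, e) \<in> PE" for p e
      using C(1)[of p e] that unfolding PE_def by auto
    then show ?thesis unfolding PR_def using PEf by auto
  qed
  have PRc: "card PR \<le> d * d * (c * (c - 1))"
  proof -
    have "card PR \<le> (\<Sum>pe\<in>PE. card (case pe of (p, e) \<Rightarrow> (\<lambda>(m, m'). (code p m, code p m')) ` (SIGMA m:C p e. C p e - {m})))"
      unfolding PR_def using PEf by (intro card_UN_le) auto
    also have "\<dots> \<le> (\<Sum>pe\<in>PE. c * (c - 1))"
    proof (rule sum_mono)
      fix pe assume pe: "pe \<in> PE"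
      obtain p e where [simp]: "pe = (p, e)" by (cases pe)
      have pe': "1 \<le> p" "p + e \<le> d + 1" using pe by (auto simp: PE_def)
      have f: "finite (SIGMA m:C p e. C p e - {m})" using C(1)[OF pe'] by auto
      have "card (SIGMA m:C p e. C p e - {m}) = card (C p e) * (card (C p e) - 1)"
        using C(1)[OF pe'] by simp
      also have "\<dots> \<le> c * (c - 1)" using C(3)[OF pe'] by (intro mult_mono) auto
      finally show "card (case pe of (p, e) \<Rightarrow> (\<lambda>(m, m'). (code p m, code p m')) ` (SIGMA m:C p e. C p e - {m})) \<le> c * (c - 1)"
        using card_image_le[OF f] le_trans by fastforce
    qed
    also have "\<dots> \<le> d * d * (c * (c - 1))" using PEf by (simp add: mult_right_mono)
    finally show ?thesis .
  qed
  have "a \<noteq> b \<and> a < 2 ^ L \<and> b < 2 ^ L" if ab: "(a, b) \<in> PR" for a b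
  proof -
    obtain p e m m' where x: "(p, e) \<in> PE" "m \<in> C p e" "m' \<in> C p e" "m \<noteq> m'" "a = code p m" "b = code p m'"
      using ab unfolding PR_def by auto
    then have pe: "1 \<le> p" "p + e \<le> d + 1" by (auto simp: PE_def)
    then have m: "m \<in> mtrees n (Suc h) e" "m' \<in> mtrees n (Suc h) e" using x C(2)[OF pe] by auto
    show ?thesis using x code_inj[OF pe m] code(2)[OF pe m(1)] code(2)[OF pe m(2)] by auto
  qed
  moreover have "2 * (card PR * L) \<le> Q"
    using PRc Q(2) by (meson le_trans mult_le_mono1 mult_le_mono2)
  ultimately obtain q where q: "q \<in> {1..Q}" "\<And>a b. (a, b) \<in> PR \<Longrightarrow> a mod q \<noteq> b mod q"
    using ex_separating_modulus[OF PRf, of L Q] Q(1) by blast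
  \<comment> \<open>The weights at level \<open>k + 1\<close> use only the moduli with index above
    \<open>k\<close>, so setting entry \<open>k\<close> does not disturb them.\<close>
  define qs' where "qs' = qs(k := q)"
  have qs': "qs' j \<in> {1..Q}" for j using qs q by (simp add: qs'_def)
  \<comment> \<open>\<open>a\<close> is the new digit and \<open>b\<close> collects the digits of
    the deeper levels. The latter are additive, so up to the factor \<open>Z ^ Suc k\<close> the
    \<open>b\<close> of a \<open>Node\<close> is the sum of the old weights of its subtrees.\<close>
  define a where "a p m = hash_wt idx q k p m" for p m
  define b where "b p m = (\<Sum>j\<in>{Suc k..D}. Z ^ (j - Suc k) * hash_wt idx (qs j) k p m)" for p m
  have "k \<le> D" using k by simp
  have W: "lex_wt idx Z D qs' k p m = Z ^ k * (a p m + Z * b p m)" for p m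
  proof -
    have "lex_wt idx Z D qs' k p m = Z ^ k * a p m + (\<Sum>j\<in>{Suc k..D}. Z ^ j * hash_wt idx (qs' j) k p m)"
      unfolding lex_wt_def using \<open>k \<le> D\<close> by (simp add: sum.atLeast_Suc_atMost qs'_def a_def)
    also have "(\<Sum>j\<in>{Suc k..D}. Z ^ j * hash_wt idx (qs' j) k p m)
       = (\<Sum>j\<in>{Suc k..D}. Z ^ k * Z * (Z ^ (j - Suc k) * hash_wt idx (qs j) k p m))"
    proof (rule sum.cong[OF refl])
      fix j assume j: "j \<in> {Suc k..D}"
      then have "Z ^ j = Z ^ (Suc k + (j - Suc k))" by simp
      also have "\<dots> = Z ^ k * Z * Z ^ (j - Suc k)" by (simp only: power_add power_Suc mult.commute)
      finally show "Z ^ j * hash_wt idx (qs' j) k p m = Z ^ k * Z * (Z ^ (j - Suc k) * hash_wt idx (qs j) k p m)"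
        using j by (simp add: qs'_def)
    qed
    also have "\<dots> = Z ^ k * Z * b p m" by (simp add: b_def sum_distrib_left)
    finally show ?thesis by (simp add: algebra_simps)
  qed
  have bN: "Z ^ Suc k * b p (Node l r) = lex_wt idx Z D qs (Suc k) p l + lex_wt idx Z D qs (Suc k) (p + leaves l) r" for p l r
  proof -
    have "Z ^ Suc k * b p (Node l r) = (\<Sum>j\<in>{Suc k..D}. Z ^ j * hash_wt idx (qs j) k p (Node l r))"
      unfolding b_def sum_distrib_left
    proof (rule sum.cong[OF refl])
      fix j assume "j \<in> {Suc k..D}"
      then have "Z ^ j = Z ^ Suc k * Z ^ (j - Suc k)" by (simp flip: power_add power_Suc)
      then show "Z ^ Suc k * (Z ^ (j - Suc k) * hash_wt idx (qs j) k p (Node l r)) = Z ^ j * hash_wt idx (qs j) k p (Node l r)"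
        by simp
    qed
    also have "\<dots> = lex_wt idx Z D qs (Suc k) p l + lex_wt idx Z D qs (Suc k) (p + leaves l) r"
      by (simp add: lex_wt_def hash_wt_def sum.distrib algebra_simps)
    finally show ?thesis .
  qed
  \<comment> \<open>The new digit never carries into the others, so it can only break ties.\<close>
  have aZ: "a p m < Z" if "m \<in> mtrees n (Suc h) e" "e \<le> d" for p m e
  proof -
    have "a p m < d * Q" unfolding a_def using that q d by (intro hash_wt_less) (auto simp: mtrees_def)
    then show ?thesis using Z by simp
  qed
  have Z0: "0 < Z" using Z by simp
  have "\<exists>B'\<subseteq>C p e. isolates z s S (mtrees n (Suc h) e) (lex_wt idx Z D qs' k p) B'" if pe: "1 \<le> p" "p + e \<le> d + 1" for p e
  proof (rule isolates_greedy[OF tb C(1,2)[OF pe]])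
    have ed: "e \<le> d" using pe by simp
    show "inj_on (lex_wt idx Z D qs' k p) (C p e)"
    proof (rule inj_onI, rule ccontr)
      fix m m' assume m: "m \<in> C p e" "m' \<in> C p e" "lex_wt idx Z D qs' k p m = lex_wt idx Z D qs' k p m'" "m \<noteq> m'"
      have mt: "m \<in> mtrees n (Suc h) e" "m' \<in> mtrees n (Suc h) e" using m C(2)[OF pe] by auto
      have "a p m + Z * b p m = a p m' + Z * b p m'" using m(3) Z0 unfolding W by simp
      \<comment> \<open>The lowest digit alone already tells candidates apart, because
        \<open>q\<close> separates the codes of all of them.\<close>
      then have "(a p m + Z * b p m) mod Z = (a p m' + Z * b p m') mod Z" by simp
      then have "a p m = a p m'" using aZ[OF mt(1) ed] aZ[OF mt(2) ed] by simp
      then have "code p m mod q = code p m' mod q"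
        unfolding a_def hash_wt_def code_def by (metis wt_mod)
      moreover have "(code p m, code p m') \<in> PR"
      proof -
        have "0 < e" using mt(1) leaves_pos[of m] by (simp add: mtrees_def)
        then have "(p, e) \<in> PE" using pe by (auto simp: PE_def)
        then show ?thesis unfolding PR_def using m by force
      qed
      ultimately show False using q by blast
    qed
    fix m f assume m: "m \<in> mtrees n (Suc h) e" "m \<notin> C p e" and f: "f \<in> S"
      and kill: "\<And>c. c \<in> C p e \<Longrightarrow> lex_wt idx Z D qs' k p c < lex_wt idx Z D qs' k p m \<Longrightarrow> f c = z"
    show "f m = z"
    proof (cases m)
      case (Leaf i)
      then show ?thesis using m by (auto simp: mtrees_def C_def)
    next
      case (Node l r)
      have lr: "l \<in> mtrees n h (leaves l)" "r \<in> mtrees n h (leaves r)" "e = leaves l + leaves r"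
        using m Node by (auto simp: mtrees_def)
      have e1: "leaves l \<in> {1..<e}" using lr leaves_pos[of l] leaves_pos[of r] by simp
      have inC: "Node x y \<in> C p e" if "x \<in> B p (leaves l)" "y \<in> B (p + leaves l) (leaves r)" for x y
        unfolding C_def using that e1 lr(3) by force
      have pe1: "p + leaves l \<le> d + 1" "1 \<le> p + leaves l" "p + leaves l + leaves r \<le> d + 1" using pe lr by auto
      show ?thesis unfolding Node
      proof (rule isolates_Node[OF dc B[OF pe(1) pe1(1)] B[OF pe1(2,3)] lr(1,2) _ f])
        show "\<not> (l \<in> B p (leaves l) \<and> r \<in> B (p + leaves l) (leaves r))" using inC m Node by blast
        fix x y assume xy: "x \<in> B p (leaves l)" "y \<in> B (p + leaves l) (leaves r)"
          and less: "lex_wt idx Z D qs (Suc k) p x + lex_wt idx Z D qs (Suc k) (p + leaves l) y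
             < lex_wt idx Z D qs (Suc k) p l + lex_wt idx Z D qs (Suc k) (p + leaves l) r"
        have "leaves x = leaves l" using xy B'(1)[OF pe(1) pe1(1)] by (auto simp: mtrees_def)
        then have "Z ^ Suc k * b p (Node x y) < Z ^ Suc k * b p (Node l r)" unfolding bN using less by simp
        then have "b p (Node x y) < b p (Node l r)" by simp
        \<comment> \<open>A gap of 1 in \<open>b\<close> is worth a full \<open>Z\<close>, more than
          any difference in \<open>a\<close>.\<close>
        then have "Z * (b p (Node x y) + 1) \<le> Z * b p (Node l r)" by (intro mult_left_mono) auto
        moreover have "a p (Node x y) < Z" using aZ[OF _ ed] inC[OF xy] C(2)[OF pe] by blast
        ultimately have "a p (Node x y) + Z * b p (Node x y) < a p (Node l r) + Z * b p (Node l r)" by simp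
        then have "lex_wt idx Z D qs' k p (Node x y) < lex_wt idx Z D qs' k p (Node l r)"
          unfolding W using Z0 by simp
        then show "f (Node x y) = z" using kill[OF inC[OF xy]] Node by simp
      qed
    qed
  qed
  then have "\<forall>p e. \<exists>B'. 1 \<le> p \<longrightarrow> p + e \<le> d + 1 \<longrightarrow> isolates z s S (mtrees n (Suc h) e) (lex_wt idx Z D qs' k p) B'"
    by blast
  then obtain B'' where "\<forall>p e. 1 \<le> p \<longrightarrow> p + e \<le> d + 1 \<longrightarrow>
      isolates z s S (mtrees n (Suc h) e) (lex_wt idx Z D qs' k p) (B'' p e)"
    by metis
  then show ?case using qs' k(3) by metis
qed


section \<open>Linear algebra over a field\<close>

lemma (in abelian_monoid) finsum_group:
  assumes "finite I" "finite J" "h ` I \<subseteq> J" "f \<in> I \<rightarrow> carrier G"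
  shows "(\<Oplus>i\<in>I. f i) = (\<Oplus>j\<in>J. \<Oplus>i\<in>{i\<in>I. h i = j}. f i)"
proof -
  have "(\<Oplus>i\<in>(\<Union>j\<in>J. {i\<in>I. h i = j}). f i) = (\<Oplus>j\<in>J. \<Oplus>i\<in>{i\<in>I. h i = j}. f i)"
    using assms by (intro add.finprod_UN_disjoint) (auto simp: pairwise_def disjnt_def)
  moreover have "(\<Union>j\<in>J. {i\<in>I. h i = j}) = I" using assms by auto
  ultimately show ?thesis by simp
qed

lemma (in abelian_monoid) finsum_swap:
  assumes "finite A" "finite B" "\<And>a b. a \<in> A \<Longrightarrow> b \<in> B \<Longrightarrow> f a b \<in> carrier G"
  shows "(\<Oplus>a\<in>A. \<Oplus>b\<in>B. f a b) = (\<Oplus>b\<in>B. \<Oplus>a\<in>A. f a b)"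
  using assms(1,3)
proof (induction A)
  case empty
  show ?case by simp
next
  case (insert x A)
  have "(\<Oplus>a\<in>insert x A. \<Oplus>b\<in>B. f a b) = (\<Oplus>b\<in>B. f x b) \<oplus> (\<Oplus>a\<in>A. \<Oplus>b\<in>B. f a b)"
    using insert by (intro finsum_insert) (auto intro: finsum_closed)
  also have "\<dots> = (\<Oplus>b\<in>B. f x b) \<oplus> (\<Oplus>b\<in>B. \<Oplus>a\<in>A. f a b)" using insert by simp
  also have "\<dots> = (\<Oplus>b\<in>B. f x b \<oplus> (\<Oplus>a\<in>A. f a b))"
    using insert by (intro finsum_addf[symmetric]) (auto intro: finsum_closed)
  also have "\<dots> = (\<Oplus>b\<in>B. \<Oplus>a\<in>insert x A. f a b)"
    using insert by (intro finsum_cong') (auto intro!: finsum_closed finsum_insert[symmetric])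
  finally show ?case .
qed

section \<open>Univariate polynomials as coefficient lists\<close>

fun horner :: "('a, 'b) ring_scheme \<Rightarrow> 'a list \<Rightarrow> 'a \<Rightarrow> 'a" where
  "horner R [] x = \<zero>\<^bsub>R\<^esub>"
| "horner R (a # as) x = a \<oplus>\<^bsub>R\<^esub> x \<otimes>\<^bsub>R\<^esub> horner R as x"

lemma (in cring) horner_closed [simp]:
  "set cs \<subseteq> carrier R \<Longrightarrow> x \<in> carrier R \<Longrightarrow> horner R cs x \<in> carrier R"
  by (induction cs) auto

lemma (in cring) horner_zeros: "set cs \<subseteq> {\<zero>} \<Longrightarrow> x \<in> carrier R \<Longrightarrow> horner R cs x = \<zero>"
  by (induction cs) auto

lemma (in cring) horner_snoc:
  assumes "set cs \<subseteq> carrier R" "a \<in> carrier R" "x \<in> carrier R"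
  shows "horner R (cs @ [a]) x = horner R cs x \<oplus> a \<otimes> x [^] length cs"
  using assms(1)
proof (induction cs)
  case Nil
  then show ?case using assms by simp
next
  case (Cons b cs)
  have "b \<oplus> x \<otimes> (h \<oplus> a \<otimes> p) = b \<oplus> x \<otimes> h \<oplus> a \<otimes> (p \<otimes> x)"
    if "h \<in> carrier R" "p \<in> carrier R" "b \<in> carrier R" for h p
    using that assms by algebra
  then show ?case using Cons assms by simp
qed

text \<open>Division by \<open>x - r\<close> with remainder. The implication about zeros replaces an
  argument on degrees: if the quotient vanishes, so do all coefficients except the constant
  one.\<close>

lemma (in cring) horner_divide:
  assumes "set (a # as) \<subseteq> carrier R" "r \<in> carrier R"
  shows "\<exists>ds. length ds = length as \<and> set ds \<subseteq> carrier R \<and> (set ds \<subseteq> {\<zero>} \<longrightarrow> set as \<subseteq> {\<zero>}) \<and>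
     (\<forall>x\<in>carrier R. horner R (a # as) x = horner R (a # as) r \<oplus> (x \<ominus> r) \<otimes> horner R ds x)"
  using assms(1)
proof (induction as arbitrary: a)
  case Nil
  then show ?case using assms by (intro exI[of _ "[]"]) auto
next
  case (Cons b bs)
  have bb: "set (b # bs) \<subseteq> carrier R" and a: "a \<in> carrier R" using Cons.prems by auto
  obtain es where es: "length es = length bs" "set es \<subseteq> carrier R" "set es \<subseteq> {\<zero>} \<Longrightarrow> set bs \<subseteq> {\<zero>}"
    "\<And>x. x \<in> carrier R \<Longrightarrow> horner R (b # bs) x = horner R (b # bs) r \<oplus> (x \<ominus> r) \<otimes> horner R es x"
    using Cons.IH[OF bb] by blast
  define h where "h = horner R (b # bs) r"
  have h: "h \<in> carrier R" unfolding h_def using bb assms(2) by (rule horner_closed)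
  show ?case
  \<comment> \<open>Synthetic division: the lowest coefficient of the quotient is the value of the
    tail at \<open>r\<close>.\<close>
  proof (intro exI[of _ "h # es"] conjI impI ballI)
    show "set (h # es) \<subseteq> carrier R" using h es by simp
    show "length (h # es) = length (b # bs)" using es by simp
  next
    assume z: "set (h # es) \<subseteq> {\<zero>}"
    then have bs: "set bs \<subseteq> {\<zero>}" using es(3) by simp
    have "h = b" unfolding h_def using horner_zeros[OF bs assms(2)] bb assms(2) by simp
    then show "set (b # bs) \<subseteq> {\<zero>}" using z bs by auto
  next
    fix x assume x: "x \<in> carrier R"
    have e: "horner R es x \<in> carrier R" using es(2) x by simp
    have "a \<oplus> x \<otimes> (h \<oplus> (x \<ominus> r) \<otimes> horner R es x)
        = a \<oplus> r \<otimes> h \<oplus> (x \<ominus> r) \<otimes> (h \<oplus> x \<otimes> horner R es x)"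
      using a x e h assms(2) by algebra
    then show "horner R (a # b # bs) x = horner R (a # b # bs) r \<oplus> (x \<ominus> r) \<otimes> horner R (h # es) x"
      using es(4)[OF x] es(4)[OF assms(2)] by (simp add: h_def del: horner.simps(2)) (simp add: h_def)
  qed
qed

text \<open>Divide by the last root \<open>x T\<close>: the quotient has one coefficient fewer, and
  it vanishes at the remaining points because a field has no zero divisors.\<close>

lemma (in field) horner_roots:
  assumes "set cs \<subseteq> carrier R" "inj_on x {..<length cs}" "x ` {..<length cs} \<subseteq> carrier R"
    and "\<And>a. a < length cs \<Longrightarrow> horner R cs (x a) = \<zero>"
  shows "set cs \<subseteq> {\<zero>}"
  using assms
proof (induction "length cs" arbitrary: cs)
  case 0
  then show ?case by simp
next
  case (Suc T)
  then obtain c cs' where cs: "cs = c # cs'" by (cases cs) auto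
  define r where "r = x T"
  have T: "length cs' = T" using Suc cs by simp
  have xc: "x a \<in> carrier R" if "a < Suc T" for a using Suc.prems(3) Suc.hyps(2) that by auto
  have r: "r \<in> carrier R" unfolding r_def by (rule xc) simp
  obtain ds where ds: "length ds = T" "set ds \<subseteq> carrier R" "set ds \<subseteq> {\<zero>} \<Longrightarrow> set cs' \<subseteq> {\<zero>}"
    "\<And>x. x \<in> carrier R \<Longrightarrow> horner R cs x = horner R cs r \<oplus> (x \<ominus> r) \<otimes> horner R ds x"
    using horner_divide[of c cs' r] Suc.prems(1) r T unfolding cs by blast
  have h0: "horner R cs (x a) = \<zero>" if "a < Suc T" for a using Suc.prems(4) Suc.hyps(2) that by simp
  have "horner R ds (x a) = \<zero>" if a: "a < T" for a
  proof -
    have xa: "x a \<in> carrier R" using xc a by simp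
    have "x a \<noteq> r"
      using inj_onD[OF Suc.prems(2), of a T] Suc.hyps(2) a by (auto simp: r_def)
    moreover have "x a = (x a \<ominus> r) \<oplus> r" using xa r by algebra
    ultimately have "x a \<ominus> r \<noteq> \<zero>" using r by auto
    moreover have hd: "horner R ds (x a) \<in> carrier R" using ds(2) xa by simp
    have "(x a \<ominus> r) \<otimes> horner R ds (x a) = \<zero>"
      using ds(4)[OF xa] h0[of a] h0[of T] a hd xa r unfolding r_def by simp
    ultimately show ?thesis using integral[of "x a \<ominus> r"] hd xa r by auto
  qed
  then have "set ds \<subseteq> {\<zero>}"
  proof (intro Suc.hyps(1))
    show "T = length ds" "set ds \<subseteq> carrier R" using ds by auto
    show "inj_on x {..<length ds}"
      using Suc.prems(2) by (rule inj_on_subset) (use ds Suc.hyps(2) in auto)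
    show "x ` {..<length ds} \<subseteq> carrier R" using xc ds by auto
  qed (use ds in auto)
  then have cs': "set cs' \<subseteq> {\<zero>}" using ds(3) by blast
  have "c \<oplus> r \<otimes> \<zero> = \<zero>"
    using h0[of T] horner_zeros[OF cs' r] unfolding cs r_def by simp
  then have "c = \<zero>" using Suc.prems(1) r cs by simp
  then show ?case using cs cs' by simp
qed

lemma (in field) univariate_vanishing:
  fixes c :: "nat \<Rightarrow> 'a"
  assumes c: "\<And>i. i < T \<Longrightarrow> c i \<in> carrier R" and x: "inj_on x {..<T}" "x ` {..<T} \<subseteq> carrier R"
    and z: "\<And>a. a < T \<Longrightarrow> (\<Oplus>i\<in>{..<T}. c i \<otimes> x a [^] i) = \<zero>" and i: "i < T"
  shows "c i = \<zero>"
proof -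
  have h: "horner R (map c [0..<t]) y = (\<Oplus>i\<in>{..<t}. c i \<otimes> y [^] i)" if "t \<le> T" "y \<in> carrier R" for t y
    using that(1)
  proof (induction t)
    case 0
    then show ?case by simp
  next
    case (Suc t)
    have cl: "set (map c [0..<t]) \<subseteq> carrier R" "c t \<in> carrier R" using c Suc.prems by auto
    then have "horner R (map c [0..<Suc t]) y = horner R (map c [0..<t]) y \<oplus> c t \<otimes> y [^] t"
      using horner_snoc[OF cl that(2)] by simp
    also have "\<dots> = c t \<otimes> y [^] t \<oplus> (\<Oplus>i\<in>{..<t}. c i \<otimes> y [^] i)"
      using Suc c that(2) by (subst Suc.IH) (auto intro!: a_comm finsum_closed)
    also have "\<dots> = (\<Oplus>i\<in>insert t {..<t}. c i \<otimes> y [^] i)"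
      using c Suc.prems that(2) by (intro finsum_insert[symmetric]) auto
    finally show ?case by (simp add: lessThan_Suc)
  qed
  have "set (map c [0..<T]) \<subseteq> {\<zero>}"
    using c x z h by (intro horner_roots[of _ x]) auto
  then show ?thesis using i by (auto simp: image_subset_iff)
qed

section \<open>Monomials in several variables on grids\<close>

fun pow_prod :: "('a, 'b) ring_scheme \<Rightarrow> (nat \<Rightarrow> 'a) \<Rightarrow> (nat \<Rightarrow> nat) \<Rightarrow> nat \<Rightarrow> 'a" where
  "pow_prod R t w 0 = \<one>\<^bsub>R\<^esub>"
| "pow_prod R t w (Suc j) = pow_prod R t w j \<otimes>\<^bsub>R\<^esub> t (Suc j) [^]\<^bsub>R\<^esub> w (Suc j)"

lemma (in cring) pow_prod_closed [simp]:
  "(\<And>j. t j \<in> carrier R) \<Longrightarrow> pow_prod R t w D \<in> carrier R"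
  by (induction D) auto

lemma (in cring) pow_prod_add:
  assumes "\<And>j. t j \<in> carrier R"
  shows "pow_prod R t (\<lambda>j. w j + w' j) D = pow_prod R t w D \<otimes> pow_prod R t w' D"
proof (induction D)
  case (Suc D)
  have "(a \<otimes> b) \<otimes> (c \<otimes> d) = (a \<otimes> c) \<otimes> (b \<otimes> d)"
    if "a \<in> carrier R" "b \<in> carrier R" "c \<in> carrier R" "d \<in> carrier R" for a b c d
    using that by algebra
  then show ?case using assms Suc by (simp flip: nat_pow_mult)
qed simp

lemma pow_prod_cong:
  "(\<And>j. j \<in> {1..D} \<Longrightarrow> t j = t' j \<and> w j = w' j) \<Longrightarrow> pow_prod R t w D = pow_prod R t' w' D"
  by (induction D) auto

text \<open>A polynomial that vanishes on the grid has zero coefficients, and the coefficient at the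
  exponent vector \<open>\<alpha>\<close> is the sum of all \<open>f m\<close> with that vector. The
  last variable is split off: with the others fixed, \<open>univariate_vanishing\<close> kills each
  of its coefficients.\<close>

lemma (in field) grid_vanishing:
  fixes w :: "'m \<Rightarrow> nat \<Rightarrow> nat" and x :: "nat \<Rightarrow> 'a"
  assumes T: "0 < T" and x: "inj_on x {..<T}" "x ` {..<T} \<subseteq> carrier R"
    and I: "finite I" "f \<in> I \<rightarrow> carrier R" "\<And>m j. m \<in> I \<Longrightarrow> j \<in> {1..D} \<Longrightarrow> w m j < T"
    and z: "\<And>\<tau>. (\<And>j. \<tau> j < T) \<Longrightarrow> (\<Oplus>m\<in>I. f m \<otimes> pow_prod R (\<lambda>j. x (\<tau> j)) (w m) D) = \<zero>"
  shows "(\<Oplus>m\<in>{m\<in>I. \<forall>j\<in>{1..D}. w m j = \<alpha> j}. f m) = \<zero>"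
  using I z
proof (induction D arbitrary: I)
  case 0
  have "(\<Oplus>m\<in>I. f m) = (\<Oplus>m\<in>I. f m \<otimes> pow_prod R (\<lambda>j. x 0) (w m) 0)"
    using 0 by (intro finsum_cong') (auto simp: Pi_def)
  also have "\<dots> = \<zero>" using 0(4)[of "\<lambda>_. 0"] T by simp
  finally show ?case by simp
next
  case (Suc D)
  define J where "J = {m\<in>I. w m (Suc D) = \<alpha> (Suc D)}"
  have xc: "x a \<in> carrier R" if "a < T" for a using x(2) that by auto
  have J: "{m\<in>I. \<forall>j\<in>{1..Suc D}. w m j = \<alpha> j} = {m\<in>J. \<forall>j\<in>{1..D}. w m j = \<alpha> j}"
    by (auto simp: J_def le_Suc_eq)
  show ?case
  proof (cases "\<alpha> (Suc D) < T")
    case False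
    then have "J = {}" using Suc.prems(3)[of _ "Suc D"] by (fastforce simp: J_def)
    then show ?thesis unfolding J by simp
  next
    case True
    show ?thesis unfolding J
    proof (rule Suc.IH)
      show "finite J" "f \<in> J \<rightarrow> carrier R" "\<And>m j. m \<in> J \<Longrightarrow> j \<in> {1..D} \<Longrightarrow> w m j < T"
        using Suc.prems(1-3) by (auto simp: J_def)
      fix \<tau> :: "nat \<Rightarrow> nat" assume \<tau>: "\<And>j. \<tau> j < T"
      define P where "P m = pow_prod R (\<lambda>j. x (\<tau> j)) (w m) D" for m
      have P: "P m \<in> carrier R" for m unfolding P_def using xc \<tau> by simp
      have fc: "f m \<in> carrier R" if "m \<in> I" for m using Suc.prems(2) that by auto
      define c where "c i = (\<Oplus>m\<in>{m\<in>I. w m (Suc D) = i}. f m \<otimes> P m)" for i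
      have cc: "c i \<in> carrier R" for i unfolding c_def using P fc by (intro finsum_closed) auto
      have "(\<Oplus>i\<in>{..<T}. c i \<otimes> x a [^] i) = \<zero>" if a: "a < T" for a
      proof -
        define \<tau>' where "\<tau>' = \<tau>(Suc D := a)"
        have "\<zero> = (\<Oplus>m\<in>I. f m \<otimes> pow_prod R (\<lambda>j. x (\<tau>' j)) (w m) (Suc D))"
          using Suc.prems(4)[of \<tau>'] \<tau> a by (simp add: \<tau>'_def)
        also have "\<dots> = (\<Oplus>m\<in>I. (f m \<otimes> P m) \<otimes> x a [^] w m (Suc D))"
        proof (rule finsum_cong')
          fix m assume m: "m \<in> I"
          have "pow_prod R (\<lambda>j. x (\<tau>' j)) (w m) D = P m"
            unfolding P_def \<tau>'_def by (rule pow_prod_cong) auto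
          then have "pow_prod R (\<lambda>j. x (\<tau>' j)) (w m) (Suc D) = P m \<otimes> x a [^] w m (Suc D)"
            by (simp add: \<tau>'_def)
          then show "f m \<otimes> pow_prod R (\<lambda>j. x (\<tau>' j)) (w m) (Suc D) = (f m \<otimes> P m) \<otimes> x a [^] w m (Suc D)"
            using fc[OF m] P[of m] xc[OF a] by (simp add: m_assoc)
        qed (use fc P xc[OF a] in auto)
        also have "\<dots> = (\<Oplus>i\<in>{..<T}. \<Oplus>m\<in>{m\<in>I. w m (Suc D) = i}. (f m \<otimes> P m) \<otimes> x a [^] w m (Suc D))"
          using Suc.prems(1,3) fc P xc[OF a] by (intro finsum_group) auto
        also have "\<dots> = (\<Oplus>i\<in>{..<T}. c i \<otimes> x a [^] i)"
        proof (rule finsum_cong')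
          fix i
          have "(\<Oplus>m\<in>{m\<in>I. w m (Suc D) = i}. (f m \<otimes> P m) \<otimes> x a [^] w m (Suc D))
             = (\<Oplus>m\<in>{m\<in>I. w m (Suc D) = i}. (f m \<otimes> P m) \<otimes> x a [^] i)"
            using fc P xc[OF a] by (intro finsum_cong') auto
          also have "\<dots> = c i \<otimes> x a [^] i"
            unfolding c_def using fc P xc[OF a] Suc.prems(1) by (intro finsum_ldistr[symmetric]) auto
          finally show "(\<Oplus>m\<in>{m\<in>I. w m (Suc D) = i}. (f m \<otimes> P m) \<otimes> x a [^] w m (Suc D)) = c i \<otimes> x a [^] i" .
        qed (use cc xc[OF a] in auto)
        finally show ?thesis by simp
      qed
      then have "c (\<alpha> (Suc D)) = \<zero>" using univariate_vanishing[OF _ x _ True] cc by blast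
      then show "(\<Oplus>m\<in>J. f m \<otimes> pow_prod R (\<lambda>j. x (\<tau> j)) (w m) D) = \<zero>"
        unfolding c_def J_def P_def .
    qed
  qed
qed

text \<open>Gaussian elimination on coordinate \<open>s\<close>: subtracting \<open>\<mu> a\<close>
  times the pivot \<open>v b\<close> from every other \<open>v a\<close> leaves a system with one
  coordinate and one vector fewer.\<close>

lemma (in field) ex_linear_dependence:
  fixes v :: "'i \<Rightarrow> nat \<Rightarrow> 'a"
  assumes "finite A" "s < card A" "\<And>a i. a \<in> A \<Longrightarrow> i < s \<Longrightarrow> v a i \<in> carrier R"
  shows "\<exists>x. x \<in> A \<rightarrow> carrier R \<and> (\<exists>a\<in>A. x a \<noteq> \<zero>) \<and> (\<forall>i<s. (\<Oplus>a\<in>A. x a \<otimes> v a i) = \<zero>)"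
  using assms
proof (induction s arbitrary: A v)
  case 0
  then show ?case by (intro exI[of _ "\<lambda>_. \<one>"]) (auto simp: card_gt_0_iff)
next
  case (Suc s)
  show ?case
  proof (cases "\<forall>a\<in>A. v a s = \<zero>")
    case True
    obtain x where x: "x \<in> A \<rightarrow> carrier R" "\<exists>a\<in>A. x a \<noteq> \<zero>" "\<forall>i<s. (\<Oplus>a\<in>A. x a \<otimes> v a i) = \<zero>"
      using Suc.IH[of A v] Suc.prems by auto
    have "(\<Oplus>a\<in>A. x a \<otimes> v a s) = (\<Oplus>a\<in>A. \<zero>)"
      using True x(1) by (intro finsum_cong') (auto simp: Pi_def)
    then show ?thesis using x by (auto simp: less_Suc_eq)
  next
    case False
    then obtain b where b: "b \<in> A" "v b s \<noteq> \<zero>" by auto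
    define A' where "A' = A - {b}"
    have A': "finite A'" "s < card A'" "A = insert b A'" "b \<notin> A'"
      using Suc.prems b by (auto simp: A'_def)
    have vc: "v a i \<in> carrier R" if "a \<in> A" "i < Suc s" for a i using Suc.prems that by auto
    define \<mu> where "\<mu> a = v a s \<otimes> inv v b s" for a
    have bu: "inv v b s \<in> carrier R" "inv v b s \<otimes> v b s = \<one>" using b vc[OF b(1)] field_Units by auto
    have \<mu>: "\<mu> a \<in> carrier R" if "a \<in> A" for a unfolding \<mu>_def using that vc bu by auto
    obtain x where x: "x \<in> A' \<rightarrow> carrier R" "\<exists>a\<in>A'. x a \<noteq> \<zero>"
      "\<forall>i<s. (\<Oplus>a\<in>A'. x a \<otimes> (v a i \<ominus> \<mu> a \<otimes> v b i)) = \<zero>"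
      using Suc.IH[of A' "\<lambda>a i. v a i \<ominus> \<mu> a \<otimes> v b i"] A' vc \<mu> b by auto
    define y where "y = (\<Oplus>a\<in>A'. x a \<otimes> \<mu> a)"
    \<comment> \<open>The coefficient of the pivot compensates for all the multiples of
      \<open>v b\<close> that were subtracted.\<close>
    define x' where "x' = x(b := \<ominus> y)"
    have xc: "x a \<in> carrier R" if "a \<in> A'" for a using x(1) that by auto
    have y: "y \<in> carrier R" unfolding y_def using xc \<mu> A' by (intro finsum_closed) auto
    have x': "x' \<in> A \<rightarrow> carrier R" using x(1) y A' by (auto simp: x'_def)
    have "(\<Oplus>a\<in>A. x' a \<otimes> v a i) = \<zero>" if i: "i < Suc s" for i
    proof -
      have vb: "v b i \<in> carrier R" using vc b i by simp
      have "(\<Oplus>a\<in>A'. x a \<otimes> (v a i \<ominus> \<mu> a \<otimes> v b i)) = \<zero>"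
      proof (cases "i < s")
        case True
        then show ?thesis using x(3) by simp
      next
        case False
        then have "i = s" using i by simp
        have "(\<Oplus>a\<in>A'. x a \<otimes> (v a i \<ominus> \<mu> a \<otimes> v b i)) = (\<Oplus>a\<in>A'. \<zero>)"
        proof (rule finsum_cong')
          fix a assume a: "a \<in> A'"
          have "\<mu> a \<otimes> v b s = v a s"
            using vc[of a s] vc[OF b(1), of s] bu a A' unfolding \<mu>_def by (simp add: m_assoc)
          then show "x a \<otimes> (v a i \<ominus> \<mu> a \<otimes> v b i) = \<zero>"
            using \<open>i = s\<close> xc[OF a] vc[of a s] a A' by (simp add: r_neg a_minus_def)
        qed auto
        then show ?thesis by simp
      qed
      moreover have "(\<Oplus>a\<in>A'. x a \<otimes> v a i)
         = (\<Oplus>a\<in>A'. x a \<otimes> (v a i \<ominus> \<mu> a \<otimes> v b i)) \<oplus> (\<Oplus>a\<in>A'. (x a \<otimes> \<mu> a) \<otimes> v b i)"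
      proof -
        have "(\<Oplus>a\<in>A'. x a \<otimes> v a i) = (\<Oplus>a\<in>A'. x a \<otimes> (v a i \<ominus> \<mu> a \<otimes> v b i) \<oplus> (x a \<otimes> \<mu> a) \<otimes> v b i)"
        proof (rule finsum_cong')
          fix a assume a: "a \<in> A'"
          have "x a \<in> carrier R" "v a i \<in> carrier R" "\<mu> a \<in> carrier R" using xc a vc \<mu> A' i by auto
          then show "x a \<otimes> v a i = x a \<otimes> (v a i \<ominus> \<mu> a \<otimes> v b i) \<oplus> (x a \<otimes> \<mu> a) \<otimes> v b i"
            using vb by algebra
        qed (use xc vc \<mu> A' i vb in auto)
        also have "\<dots> = (\<Oplus>a\<in>A'. x a \<otimes> (v a i \<ominus> \<mu> a \<otimes> v b i)) \<oplus> (\<Oplus>a\<in>A'. (x a \<otimes> \<mu> a) \<otimes> v b i)"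
          using xc vc \<mu> A' i vb by (intro finsum_addf) auto
        finally show ?thesis .
      qed
      moreover have "(\<Oplus>a\<in>A'. (x a \<otimes> \<mu> a) \<otimes> v b i) = y \<otimes> v b i"
        unfolding y_def using xc \<mu> A' vb by (intro finsum_ldistr[symmetric]) auto
      ultimately have s: "(\<Oplus>a\<in>A'. x a \<otimes> v a i) = y \<otimes> v b i" using y vb by simp
      have "(\<Oplus>a\<in>A. x' a \<otimes> v a i) = x' b \<otimes> v b i \<oplus> (\<Oplus>a\<in>A'. x' a \<otimes> v a i)"
        unfolding A'(3) using A' x' vc i by (intro finsum_insert) auto
      also have "(\<Oplus>a\<in>A'. x' a \<otimes> v a i) = (\<Oplus>a\<in>A'. x a \<otimes> v a i)"
        using A' xc vc i by (intro finsum_cong') (auto simp: x'_def)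
      finally show ?thesis unfolding s using y vb by (simp add: x'_def l_minus l_neg)
    qed
    moreover have "\<exists>a\<in>A. x' a \<noteq> \<zero>" using x(2) A' by (auto simp: x'_def)
    ultimately show ?thesis using x' by blast
  qed
qed

section \<open>Spans of finitely many functions\<close>

definition lspan :: "('a, 'b) ring_scheme \<Rightarrow> nat \<Rightarrow> (nat \<Rightarrow> 'm \<Rightarrow> 'a) \<Rightarrow> ('m \<Rightarrow> 'a) set" where
  "lspan R N G = {f. \<exists>a. (\<forall>i. a i \<in> carrier R) \<and> (\<forall>m. f m = (\<Oplus>\<^bsub>R\<^esub>i\<in>{..<N}. a i \<otimes>\<^bsub>R\<^esub> G i m))}"

lemma (in field) lspan_gen:
  assumes "\<And>i m. i < N \<Longrightarrow> G i m \<in> carrier R" "i < N"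
  shows "G i \<in> lspan R N G"
proof -
  have "G i m = (\<Oplus>j\<in>{..<N}. (if i = j then \<one> else \<zero>) \<otimes> G j m)" for m
  proof -
    have "(\<Oplus>j\<in>{..<N}. (if i = j then \<one> else \<zero>) \<otimes> G j m) = (\<Oplus>j\<in>{..<N}. if i = j then G j m else \<zero>)"
      using assms by (intro finsum_cong') auto
    then show ?thesis using assms finsum_singleton[of i "{..<N}" "\<lambda>j. G j m"] by auto
  qed
  then show ?thesis unfolding lspan_def by (intro CollectI exI[of _ "\<lambda>j. if i = j then \<one> else \<zero>"]) auto
qed

lemma (in field) lspan_zero:
  assumes "\<And>i m. i < N \<Longrightarrow> G i m \<in> carrier R"
  shows "(\<lambda>_. \<zero>) \<in> lspan R N G"
proof -
  have "(\<Oplus>j\<in>{..<N}. \<zero> \<otimes> G j m) = (\<Oplus>j\<in>{..<N}. \<zero>)" for m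
    using assms by (intro finsum_cong') auto
  then show ?thesis unfolding lspan_def by (intro CollectI exI[of _ "\<lambda>j. \<zero>"]) auto
qed

lemma (in field) lspan_add:
  assumes G: "\<And>i m. i < N \<Longrightarrow> G i m \<in> carrier R" and f: "f \<in> lspan R N G" and g: "g \<in> lspan R N G"
  shows "(\<lambda>m. f m \<oplus> g m) \<in> lspan R N G"
proof -
  obtain a b where a: "\<And>i. a i \<in> carrier R" "\<And>m. f m = (\<Oplus>i\<in>{..<N}. a i \<otimes> G i m)"
    and b: "\<And>i. b i \<in> carrier R" "\<And>m. g m = (\<Oplus>i\<in>{..<N}. b i \<otimes> G i m)"
    using f g unfolding lspan_def by auto
  have "f m \<oplus> g m = (\<Oplus>i\<in>{..<N}. (a i \<oplus> b i) \<otimes> G i m)" for m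
  proof -
    have "f m \<oplus> g m = (\<Oplus>i\<in>{..<N}. a i \<otimes> G i m \<oplus> b i \<otimes> G i m)"
      unfolding a b using a(1) b(1) G by (intro finsum_addf[symmetric]) auto
    also have "\<dots> = (\<Oplus>i\<in>{..<N}. (a i \<oplus> b i) \<otimes> G i m)"
      using a(1) b(1) G by (intro finsum_cong') (auto simp: l_distr)
    finally show ?thesis .
  qed
  then show ?thesis unfolding lspan_def using a(1) b(1) by (intro CollectI exI[of _ "\<lambda>j. a j \<oplus> b j"]) auto
qed

lemma (in field) lspan_smult:
  assumes G: "\<And>i m. i < N \<Longrightarrow> G i m \<in> carrier R" and f: "f \<in> lspan R N G" and c: "c \<in> carrier R"
  shows "(\<lambda>m. c \<otimes> f m) \<in> lspan R N G"
proof -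
  obtain a where a: "\<And>i. a i \<in> carrier R" "\<And>m. f m = (\<Oplus>i\<in>{..<N}. a i \<otimes> G i m)"
    using f unfolding lspan_def by auto
  have "c \<otimes> f m = (\<Oplus>i\<in>{..<N}. (c \<otimes> a i) \<otimes> G i m)" for m
  proof -
    have "c \<otimes> f m = (\<Oplus>i\<in>{..<N}. c \<otimes> (a i \<otimes> G i m))"
      unfolding a using a(1) c G by (intro finsum_rdistr) auto
    also have "\<dots> = (\<Oplus>i\<in>{..<N}. (c \<otimes> a i) \<otimes> G i m)"
      using a(1) c G by (intro finsum_cong') (auto simp: m_assoc)
    finally show ?thesis .
  qed
  then show ?thesis unfolding lspan_def using a(1) c by (intro CollectI exI[of _ "\<lambda>j. c \<otimes> a j"]) auto
qed

lemma (in field) lspan_finsum: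
  assumes G: "\<And>i m. i < N \<Longrightarrow> G i m \<in> carrier R" and "finite J"
    and "\<And>j. j \<in> J \<Longrightarrow> f j \<in> lspan R N G" "\<And>j m. j \<in> J \<Longrightarrow> f j m \<in> carrier R"
    and "\<And>j. j \<in> J \<Longrightarrow> c j \<in> carrier R"
  shows "(\<lambda>m. \<Oplus>j\<in>J. c j \<otimes> f j m) \<in> lspan R N G"
  using assms(2-)
proof (induction J)
  case empty
  then show ?case using lspan_zero[OF G] by simp
next
  case (insert x J)
  have "(\<lambda>m. \<Oplus>j\<in>insert x J. c j \<otimes> f j m) = (\<lambda>m. c x \<otimes> f x m \<oplus> (\<Oplus>j\<in>J. c j \<otimes> f j m))"
    using insert by (intro ext finsum_insert) auto
  then show ?case using insert by (auto intro!: lspan_add lspan_smult G)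
qed

text \<open>More than \<open>N\<close> members of the span are dependent. Evaluated at the lightest
  \<open>b\<close> with a nonzero coefficient, the triangular shape leaves only the term of
  \<open>b\<close> itself, which is not zero.\<close>

lemma (in field) triangular_bound_lspan:
  assumes G: "\<And>i m. i < N \<Longrightarrow> G i m \<in> carrier R"
  shows "triangular_bound \<zero> N (lspan R N G)"
  unfolding triangular_bound_def
proof (intro allI impI, rule ccontr)
  fix B and w :: "mtree \<Rightarrow> nat"
  assume B: "finite B" "inj_on w B" "\<not> card B \<le> N"
    and "\<forall>b\<in>B. \<exists>f\<in>lspan R N G. f b \<noteq> \<zero> \<and> (\<forall>b'\<in>B. w b' < w b \<longrightarrow> f b' = \<zero>)"
  then obtain f where f: "\<And>b. b \<in> B \<Longrightarrow> f b \<in> lspan R N G \<and> f b b \<noteq> \<zero> \<and> (\<forall>b'\<in>B. w b' < w b \<longrightarrow> f b b' = \<zero>)"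
    by metis
  then have "\<forall>b\<in>B. \<exists>a. (\<forall>i. a i \<in> carrier R) \<and> (\<forall>m. f b m = (\<Oplus>i\<in>{..<N}. a i \<otimes> G i m))"
    unfolding lspan_def by blast
  then obtain a where a: "\<And>b i. b \<in> B \<Longrightarrow> a b i \<in> carrier R"
    "\<And>b m. b \<in> B \<Longrightarrow> f b m = (\<Oplus>i\<in>{..<N}. a b i \<otimes> G i m)"
    by metis
  have fc: "f b m \<in> carrier R" if "b \<in> B" for b m
    unfolding a(2)[OF that] using a(1)[OF that] G by (intro finsum_closed) auto
  obtain x where x: "x \<in> B \<rightarrow> carrier R" "\<exists>b\<in>B. x b \<noteq> \<zero>" "\<forall>i<N. (\<Oplus>b\<in>B. x b \<otimes> a b i) = \<zero>"
    using ex_linear_dependence[of B N a] B a by auto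
  have xc: "x b \<in> carrier R" if "b \<in> B" for b using x(1) that by auto
  obtain b0 where b0: "b0 \<in> B \<and> x b0 \<noteq> \<zero>" using x(2) by auto
  obtain b where b: "b \<in> B" "x b \<noteq> \<zero>" "\<And>b'. b' \<in> B \<Longrightarrow> x b' \<noteq> \<zero> \<Longrightarrow> w b \<le> w b'"
    using ex_has_least_nat[of "\<lambda>b. b \<in> B \<and> x b \<noteq> \<zero>" b0 w, OF b0] by blast
  have "(\<Oplus>b'\<in>B. x b' \<otimes> f b' b) = (\<Oplus>b'\<in>B. \<Oplus>i\<in>{..<N}. (x b' \<otimes> a b' i) \<otimes> G i b)"
  proof (rule finsum_cong')
    fix b' assume b': "b' \<in> B"
    have "x b' \<otimes> f b' b = (\<Oplus>i\<in>{..<N}. x b' \<otimes> (a b' i \<otimes> G i b))"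
      unfolding a(2)[OF b'] using a(1)[OF b'] xc[OF b'] G by (intro finsum_rdistr) auto
    also have "\<dots> = (\<Oplus>i\<in>{..<N}. (x b' \<otimes> a b' i) \<otimes> G i b)"
      using a(1)[OF b'] xc[OF b'] G by (intro finsum_cong') (auto simp: m_assoc)
    finally show "x b' \<otimes> f b' b = (\<Oplus>i\<in>{..<N}. (x b' \<otimes> a b' i) \<otimes> G i b)" .
  qed (use a xc G in \<open>auto intro!: finsum_closed\<close>)
  also have "\<dots> = (\<Oplus>i\<in>{..<N}. \<Oplus>b'\<in>B. (x b' \<otimes> a b' i) \<otimes> G i b)"
    using a xc G B by (intro finsum_swap) auto
  also have "\<dots> = (\<Oplus>i\<in>{..<N}. \<zero>)"
  proof (rule finsum_cong')
    fix i assume i: "i \<in> {..<N}"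
    have "(\<Oplus>b'\<in>B. (x b' \<otimes> a b' i) \<otimes> G i b) = (\<Oplus>b'\<in>B. x b' \<otimes> a b' i) \<otimes> G i b"
      using a xc G B i by (intro finsum_ldistr[symmetric]) auto
    then show "(\<Oplus>b'\<in>B. (x b' \<otimes> a b' i) \<otimes> G i b) = \<zero>" using x(3) i G by simp
  qed auto
  finally have "(\<Oplus>b'\<in>B. x b' \<otimes> f b' b) = \<zero>" by simp
  moreover have "(\<Oplus>b'\<in>B. x b' \<otimes> f b' b) = (\<Oplus>b'\<in>B. if b = b' then x b' \<otimes> f b' b else \<zero>)"
  proof (rule finsum_cong')
    fix b' assume b': "b' \<in> B"
    show "x b' \<otimes> f b' b = (if b = b' then x b' \<otimes> f b' b else \<zero>)"
    proof (cases "x b' = \<zero> \<or> b = b'")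
      case True
      then show ?thesis using fc[OF b'] by auto
    next
      case False
      then have "w b < w b'" using b b' B(2) by (metis inj_onD le_neq_implies_less)
      then show ?thesis using f[OF b'] b(1) False xc[OF b'] by simp
    qed
  qed (use xc fc in auto)
  moreover have "\<dots> = x b \<otimes> f b b"
    using xc fc b B finsum_singleton[of b B "\<lambda>b'. x b' \<otimes> f b' b"] by auto
  ultimately show False using b f[OF b(1)] xc[OF b(1)] fc[OF b(1)] integral by metis
qed


section \<open>Evaluation at superdiagonal points\<close>

lemma A_alg_simps [simp]:
  "carrier (A_alg F d) = cubes F d \<times> carrier F"
  "\<zero>\<^bsub>A_alg F d\<^esub> = (cube_zero F d, \<zero>\<^bsub>F\<^esub>)"
  "\<one>\<^bsub>A_alg F d\<^esub> = (cube_zero F d, \<one>\<^bsub>F\<^esub>)"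
  "x \<oplus>\<^bsub>A_alg F d\<^esub> y = (cube_add F d (fst x) (fst y), snd x \<oplus>\<^bsub>F\<^esub> snd y)"
  "x \<otimes>\<^bsub>A_alg F d\<^esub> y = (cube_add F d (cube_mult F d (fst x) (fst y))
      (cube_add F d (cube_scale F d (snd x) (fst y)) (cube_scale F d (snd y) (fst x))), snd x \<otimes>\<^bsub>F\<^esub> snd y)"
  by (auto simp: A_alg_def case_prod_beta)

lemma in_cubes: "x \<in> cubes F d \<Longrightarrow> p \<in> cube_idx d \<Longrightarrow> x p \<in> carrier F"
  by (auto simp: cubes_def)

text \<open>
  With matrices supported on the first superdiagonal, the row index counts the leaves read so far
  and the level is the depth in the tree.
\<close>

definition shift_point ::
  "'a ring \<Rightarrow> nat \<Rightarrow> nat \<Rightarrow> (nat \<times> nat \<times> nat \<Rightarrow> 'a) \<Rightarrow> 'a point" where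
  "shift_point F n d y = (\<lambda>i\<in>{1..n}.
     (\<lambda>(p, p', k)\<in>cube_idx d. if p' = p + 1 then y (i, k, p) else \<zero>\<^bsub>F\<^esub>, \<zero>\<^bsub>F\<^esub>))"

fun tree_val :: "'a ring \<Rightarrow> (nat \<times> nat \<times> nat \<Rightarrow> 'a) \<Rightarrow> nat \<Rightarrow> nat \<Rightarrow> mtree \<Rightarrow> 'a" where
  "tree_val F y k p (Leaf i) = y (i, k, p)"
| "tree_val F y k p (Node l r) = tree_val F y (Suc k) p l \<otimes>\<^bsub>F\<^esub> tree_val F y (Suc k) (p + leaves l) r"

section \<open>The additive structure of the algebra\<close>

context
  fixes F :: "'a ring" (structure)
  assumes F: "field F"
begin

interpretation field F by (rule F)

lemma cubes_closed:
  "cube_zero F d \<in> cubes F d"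
  "x \<in> cubes F d \<Longrightarrow> y \<in> cubes F d \<Longrightarrow> cube_add F d x y \<in> cubes F d"
  "c \<in> carrier F \<Longrightarrow> x \<in> cubes F d \<Longrightarrow> cube_scale F d c x \<in> cubes F d"
  by (auto simp: cubes_def cube_zero_def cube_add_def cube_scale_def)

lemma cube_mult_closed:
  assumes "x \<in> cubes F d" "y \<in> cubes F d"
  shows "cube_mult F d x y \<in> cubes F d"
proof -
  have "(\<Oplus>l\<in>{1..d+1}. x (i, l, k + 1) \<otimes> y (l, j, k + 1)) \<in> carrier F"
    if "(i, j, k) \<in> cube_idx d" "k \<noteq> d" for i j k
    using that assms by (intro finsum_closed) (auto simp: cube_idx_def intro!: m_closed in_cubes[OF assms(1)] in_cubes[OF assms(2)])
  then show ?thesis unfolding cube_mult_def cubes_def by auto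
qed

text \<open>\<open>eval_poly\<close> is a \<open>finsum\<close> in \<open>A_alg\<close>, which is no
  ring; the laws of its addition are what \<open>finsum\<close> relies on.\<close>

lemma abelian_monoid_A_alg: "abelian_monoid (A_alg F d)"
proof
  show "x \<otimes>\<^bsub>add_monoid (A_alg F d)\<^esub> y \<in> carrier (add_monoid (A_alg F d))"
    if "x \<in> carrier (add_monoid (A_alg F d))" "y \<in> carrier (add_monoid (A_alg F d))" for x y
    using that by (auto intro: cubes_closed)
  show "x \<otimes>\<^bsub>add_monoid (A_alg F d)\<^esub> y \<otimes>\<^bsub>add_monoid (A_alg F d)\<^esub> z =
      x \<otimes>\<^bsub>add_monoid (A_alg F d)\<^esub> (y \<otimes>\<^bsub>add_monoid (A_alg F d)\<^esub> z)"
    if "x \<in> carrier (add_monoid (A_alg F d))" "y \<in> carrier (add_monoid (A_alg F d))"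
       "z \<in> carrier (add_monoid (A_alg F d))" for x y z
    using that by (auto simp: cube_add_def in_cubes a_assoc intro!: restrict_ext)
  show "x \<otimes>\<^bsub>add_monoid (A_alg F d)\<^esub> y = y \<otimes>\<^bsub>add_monoid (A_alg F d)\<^esub> x"
    if "x \<in> carrier (add_monoid (A_alg F d))" "y \<in> carrier (add_monoid (A_alg F d))" for x y
    using that by (auto simp: cube_add_def in_cubes a_comm intro!: restrict_ext)
  have e: "cube_add F d (cube_zero F d) a = a" "cube_add F d a (cube_zero F d) = a" if "a \<in> cubes F d" for a
  proof -
    have "a p = undefined" if "p \<notin> cube_idx d" for p
      using \<open>a \<in> cubes F d\<close> that unfolding cubes_def by (rule PiE_arb)
    then show "cube_add F d (cube_zero F d) a = a" "cube_add F d a (cube_zero F d) = a"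
      using that by (auto simp: cube_add_def cube_zero_def restrict_def in_cubes fun_eq_iff)
  qed
  show "\<one>\<^bsub>add_monoid (A_alg F d)\<^esub> \<otimes>\<^bsub>add_monoid (A_alg F d)\<^esub> x = x"
    "x \<otimes>\<^bsub>add_monoid (A_alg F d)\<^esub> \<one>\<^bsub>add_monoid (A_alg F d)\<^esub> = x"
    if "x \<in> carrier (add_monoid (A_alg F d))" for x
    using that e by auto
qed (auto intro: cubes_closed)

lemma A_alg_finsum:
  assumes "finite I" "f \<in> I \<rightarrow> carrier (A_alg F d)"
  shows "p \<in> cube_idx d \<Longrightarrow> fst (finsum (A_alg F d) f I) p = (\<Oplus>i\<in>I. fst (f i) p)"
    and "snd (finsum (A_alg F d) f I) = (\<Oplus>i\<in>I. snd (f i))"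
proof -
  interpret A: abelian_monoid "A_alg F d" by (rule abelian_monoid_A_alg)
  have fc: "fst (f i) \<in> cubes F d" "snd (f i) \<in> carrier F" if "i \<in> I" for i
    using assms(2) that by (auto simp: Pi_def mem_Times_iff)
  show "fst (finsum (A_alg F d) f I) p = (\<Oplus>i\<in>I. fst (f i) p)" if p: "p \<in> cube_idx d"
    using assms fc
  proof (induction I)
    case empty
    then show ?case using p by (simp add: cube_zero_def)
  next
    case (insert x I)
    have "(\<Oplus>i\<in>insert x I. fst (f i) p) = fst (f x) p \<oplus> (\<Oplus>i\<in>I. fst (f i) p)"
      using insert p by (intro finsum_insert) (auto intro: in_cubes)
    moreover have "finsum (A_alg F d) f (insert x I) = f x \<oplus>\<^bsub>A_alg F d\<^esub> finsum (A_alg F d) f I"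
      using insert by (intro A.finsum_insert) auto
    ultimately show ?case using insert p by (simp add: cube_add_def)
  qed
  show "snd (finsum (A_alg F d) f I) = (\<Oplus>i\<in>I. snd (f i))"
    using assms fc
  proof (induction I)
    case empty
    then show ?case by simp
  next
    case (insert x I)
    have "(\<Oplus>i\<in>insert x I. snd (f i)) = snd (f x) \<oplus> (\<Oplus>i\<in>I. snd (f i))"
      using insert by (intro finsum_insert) auto
    moreover have "finsum (A_alg F d) f (insert x I) = f x \<oplus>\<^bsub>A_alg F d\<^esub> finsum (A_alg F d) f I"
      using insert by (intro A.finsum_insert) auto
    ultimately show ?case using insert by simp
  qed
qed

section \<open>Trees and polynomials at superdiagonal points\<close>

context
  fixes y :: "nat \<times> nat \<times> nat \<Rightarrow> 'a" and n d :: nat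
  assumes y: "\<And>x. y x \<in> carrier F"
begin

lemma tree_val_closed: "tree_val F y k p m \<in> carrier F"
  by (induction m arbitrary: k p) (auto simp: y)

lemma shift_point_in_points: "shift_point F n d y \<in> points F n d"
  using y by (auto simp: shift_point_def points_def cubes_def)

lemma eval_tree_closed:
  "tree_vars m \<subseteq> {1..n} \<Longrightarrow> eval_tree F d (shift_point F n d y) m \<in> carrier (A_alg F d)"
proof (induction m)
  case (Leaf i)
  then show ?case using PiE_mem[OF shift_point_in_points[unfolded points_def], of i] by simp
next
  case (Node l r)
  then show ?case by (auto simp: mem_Times_iff intro!: cubes_closed cube_mult_closed)
qed

text \<open>Each leaf advances the row by one, so the index between the two factors of a product
  must be \<open>p + leaves l\<close>. The scalar parts are 0, which removes the two mixed terms of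
  the product. The bound on \<open>k + height m\<close> keeps every leaf at a level at most
  \<open>d\<close>, within the cube.\<close>

lemma eval_tree_shift_point:
  assumes "tree_vars m \<subseteq> {1..n}"
  shows "snd (eval_tree F d (shift_point F n d y) m) = \<zero>"
    and "1 \<le> k \<Longrightarrow> k + height m \<le> d + 1 \<Longrightarrow> p \<in> {1..d+1} \<Longrightarrow> p' \<in> {1..d+1} \<Longrightarrow>
      fst (eval_tree F d (shift_point F n d y) m) (p, p', k) =
        (if p' = p + leaves m then tree_val F y k p m else \<zero>)"
proof -
  have *: "snd (eval_tree F d (shift_point F n d y) m) = \<zero>" if "tree_vars m \<subseteq> {1..n}" for m
    using that by (induction m) (auto simp: shift_point_def)
  then show "snd (eval_tree F d (shift_point F n d y) m) = \<zero>" using assms by simp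
  show "1 \<le> k \<Longrightarrow> k + height m \<le> d + 1 \<Longrightarrow> p \<in> {1..d+1} \<Longrightarrow> p' \<in> {1..d+1} \<Longrightarrow>
      fst (eval_tree F d (shift_point F n d y) m) (p, p', k) =
        (if p' = p + leaves m then tree_val F y k p m else \<zero>)"
    using assms
  proof (induction m arbitrary: k p p')
    case (Leaf i)
    then show ?case by (auto simp: shift_point_def cube_idx_def)
  next
    case (Node l r)
    let ?e = "eval_tree F d (shift_point F n d y)"
    have idx: "(p, p', k) \<in> cube_idx d" "k \<noteq> d"
    proof -
      have "0 < height l" by (simp add: neq0_conv[symmetric])
      then show "(p, p', k) \<in> cube_idx d" "k \<noteq> d" using Node.prems by (auto simp: cube_idx_def)
    qed
    have cl: "fst (?e l) (p, p', k) \<in> carrier F" "fst (?e r) (p, p', k) \<in> carrier F"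
      using Node.prems(5) eval_tree_closed[of l] eval_tree_closed[of r] idx
      by (auto simp: mem_Times_iff intro!: in_cubes)
    have c0: "(if b then tree_val F y k p m else \<zero>) \<in> carrier F" for b k p m using tree_val_closed by simp
    have cub: "fst (?e l) \<in> cubes F d" "fst (?e r) \<in> cubes F d"
      using Node.prems(5) eval_tree_closed[of l] eval_tree_closed[of r] by (auto simp: mem_Times_iff)
    have "fst (?e (Node l r)) (p, p', k) = (\<Oplus>q\<in>{1..d+1}. fst (?e l) (p, q, k + 1) \<otimes> fst (?e r) (q, p', k + 1))"
    proof -
      have "(\<Oplus>q\<in>{1..d+1}. fst (?e l) (p, q, k + 1) \<otimes> fst (?e r) (q, p', k + 1)) \<in> carrier F"
        using idx by (intro finsum_closed) (auto simp: cube_idx_def intro!: m_closed in_cubes[OF cub(1)] in_cubes[OF cub(2)])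
      then show ?thesis
        using idx Node.prems(5) cl * by (simp add: cube_add_def cube_mult_def cube_scale_def)
    qed
    also have "\<dots> = (\<Oplus>q\<in>{1..d+1}. if p + leaves l = q then
        (tree_val F y (k+1) p l \<otimes> (if p' = q + leaves r then tree_val F y (k+1) q r else \<zero>)) else \<zero>)"
    proof (rule finsum_cong')
      fix q assume q: "q \<in> {1..d+1}"
      have "fst (?e l) (p, q, k + 1) = (if q = p + leaves l then tree_val F y (k+1) p l else \<zero>)"
        using Node.prems q by (intro Node.IH(1)) auto
      moreover have "fst (?e r) (q, p', k + 1) = (if p' = q + leaves r then tree_val F y (k+1) q r else \<zero>)"
        using Node.prems q by (intro Node.IH(2)) auto
      ultimately show "fst (?e l) (p, q, k + 1) \<otimes> fst (?e r) (q, p', k + 1) = (if p + leaves l = q then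
        (tree_val F y (k+1) p l \<otimes> (if p' = q + leaves r then tree_val F y (k+1) q r else \<zero>)) else \<zero>)"
        using tree_val_closed by auto
    qed (use c0 tree_val_closed in auto)
    also have "\<dots> = (if p' = p + leaves (Node l r) then tree_val F y k p (Node l r) else \<zero>)"
    proof (cases "p + leaves l \<le> d + 1")
      case True
      then show ?thesis
        using Node.prems c0 tree_val_closed
          finsum_singleton[of "p + leaves l" "{1..d+1}"
            "\<lambda>q. tree_val F y (k+1) p l \<otimes> (if p' = q + leaves r then tree_val F y (k+1) q r else \<zero>)"]
        by (auto simp: add.assoc)
    next
      \<comment> \<open>The left subtree alone already runs past the last row, hence so does the
        whole tree.\<close>
      case False
      have "(\<Oplus>q\<in>{1..d+1}. if p + leaves l = q then
        (tree_val F y (k+1) p l \<otimes> (if p' = q + leaves r then tree_val F y (k+1) q r else \<zero>)) else \<zero>) = (\<Oplus>q\<in>{1..d+1}. \<zero>)"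
        using False by (intro finsum_cong') auto
      then show ?thesis using False Node.prems by auto
    qed
    finally show ?case .
  qed
qed

text \<open>The scalar part sees only the monomial 1, and the distance between row and column
  selects the trees with \<open>e\<close> leaves. The degree bounds the heights, as
  \<open>eval_tree_shift_point\<close> requires.\<close>

lemma eval_poly_shift_point:
  assumes f: "range f \<subseteq> carrier F" "finite (supp F f)" "\<forall>m\<in>supp F f. mono_vars m \<subseteq> {1..n}"
    and deg: "na_degree F f \<le> d"
  shows "snd (eval_poly F d (shift_point F n d y) f) = f None"
    and "1 \<le> e \<Longrightarrow> e \<le> d \<Longrightarrow> fst (eval_poly F d (shift_point F n d y) f) (1, e + 1, 1) =
       (\<Oplus>m\<in>{m. f (Some m) \<noteq> \<zero> \<and> leaves m = e}. f (Some m) \<otimes> tree_val F y 1 1 m)"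
proof -
  let ?h = "shift_point F n d y"
  have fc: "f m \<in> carrier F" for m using f(1) by auto
  have emc: "eval_mono F d ?h m \<in> carrier (A_alg F d)" if "m \<in> supp F f" for m
    using f(3) that eval_tree_closed cubes_closed(1) by (cases m) auto
  have sc: "A_scale F d (f m) (eval_mono F d ?h m) \<in> carrier (A_alg F d)" if "m \<in> supp F f" for m
    using emc[OF that] fc[of m] cubes_closed(3) unfolding A_scale_def by (auto simp: case_prod_beta mem_Times_iff)
  have "snd (eval_poly F d ?h f) = (\<Oplus>m\<in>supp F f. snd (A_scale F d (f m) (eval_mono F d ?h m)))"
    unfolding eval_poly_def using f(2) sc by (intro A_alg_finsum) auto
  also have "\<dots> = (\<Oplus>m\<in>supp F f. if None = m then f m else \<zero>)"
  proof (rule finsum_cong')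
    fix m assume m: "m \<in> supp F f"
    show "snd (A_scale F d (f m) (eval_mono F d ?h m)) = (if None = m then f m else \<zero>)"
    proof (cases m)
      case None
      then show ?thesis using fc by (simp add: A_scale_def)
    next
      case (Some t)
      then show ?thesis using f(3) m fc eval_tree_shift_point(1)[of t]
        by (auto simp: A_scale_def case_prod_beta)
    qed
  qed (use fc in auto)
  also have "\<dots> = f None"
  proof (cases "None \<in> supp F f")
    case True
    then show ?thesis using finsum_singleton[of None "supp F f" f] f(2) fc by auto
  next
    case False
    then have "(\<Oplus>m\<in>supp F f. if None = m then f m else \<zero>) = (\<Oplus>m\<in>supp F f. \<zero>)"
      by (intro finsum_cong') auto
    then show ?thesis using False by (simp add: supp_def)
  qed
  finally show "snd (eval_poly F d ?h f) = f None" .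
  assume e: "1 \<le> e" "e \<le> d"
  define T where "T = {m. f (Some m) \<noteq> \<zero> \<and> leaves m = e}"
  have T: "Some ` T \<subseteq> supp F f" by (auto simp: T_def supp_def)
  have i: "(1, e + 1, 1) \<in> cube_idx d" using e by (auto simp: cube_idx_def)
  define g where "g m = (case m of None \<Rightarrow> \<zero> | Some t \<Rightarrow> if leaves t = e then f m \<otimes> tree_val F y 1 1 t else \<zero>)" for m
  have gc: "g m \<in> carrier F" for m using fc tree_val_closed by (auto simp: g_def split: option.split)
  have "fst (eval_poly F d ?h f) (1, e + 1, 1)
      = (\<Oplus>m\<in>supp F f. fst (A_scale F d (f m) (eval_mono F d ?h m)) (1, e + 1, 1))"
    unfolding eval_poly_def using f(2) sc i by (intro A_alg_finsum) auto
  also have "\<dots> = (\<Oplus>m\<in>supp F f. g m)"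
  proof (rule finsum_cong')
    fix m assume m: "m \<in> supp F f"
    show "fst (A_scale F d (f m) (eval_mono F d ?h m)) (1, e + 1, 1) = g m"
    proof (cases m)
      case None
      then show ?thesis using fc i by (simp add: A_scale_def g_def cube_scale_def cube_zero_def)
    next
      case (Some t)
      have "mono_degree m \<le> d"
        using m deg f(2) unfolding na_degree_def by auto
      then have "1 + height t \<le> d + 1" using height_le_leaves[of t] Some by simp
      then have "fst (eval_tree F d ?h t) (1, e + 1, 1) = (if e + 1 = 1 + leaves t then tree_val F y 1 1 t else \<zero>)"
        using f(3)[rule_format, OF m] Some e by (intro eval_tree_shift_point(2)) auto
      then show ?thesis using Some fc[of m] i
        by (auto simp: A_scale_def case_prod_beta g_def cube_scale_def)
    qed
  qed (use gc in auto)
  also have "\<dots> = (\<Oplus>m\<in>Some ` T. g m)"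
    using f(2) T gc by (intro add.finprod_mono_neutral_cong_right) (auto simp: g_def T_def supp_def split: option.split)
  also have "\<dots> = (\<Oplus>t\<in>T. g (Some t))"
    using gc by (intro finsum_reindex) auto
  also have "\<dots> = (\<Oplus>t\<in>T. f (Some t) \<otimes> tree_val F y 1 1 t)"
    using fc tree_val_closed by (intro finsum_cong') (auto simp: g_def T_def)
  finally show "fst (eval_poly F d ?h f) (1, e + 1, 1) =
       (\<Oplus>m\<in>{m. f (Some m) \<noteq> \<zero> \<and> leaves m = e}. f (Some m) \<otimes> tree_val F y 1 1 m)"
    unfolding T_def .
qed

end

text \<open>A product over the leaves adds up the exponents, separately for each variable.\<close>

lemma tree_val_pow_prod:
  assumes t: "\<And>j. t j \<in> carrier F"
  shows "tree_val F (\<lambda>x. pow_prod F t (\<lambda>j. 2 ^ idx x mod qs j) D) k p m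
     = pow_prod F t (\<lambda>j. hash_wt idx (qs j) k p m) D"
proof (induction m arbitrary: k p)
  case (Leaf i)
  then show ?case by (simp add: hash_wt_def)
next
  case (Node l r)
  then show ?case using t by (simp add: hash_wt_def pow_prod_add)
qed

end


section \<open>Circuits\<close>

lemma na_poly_simps [simp]:
  "\<zero>\<^bsub>na_poly F n\<^esub> = (\<lambda>m. \<zero>\<^bsub>F\<^esub>)"
  "f \<oplus>\<^bsub>na_poly F n\<^esub> g = (\<lambda>m. f m \<oplus>\<^bsub>F\<^esub> g m)"
  "f \<otimes>\<^bsub>na_poly F n\<^esub> g = (\<lambda>m. \<Oplus>\<^bsub>F\<^esub>p\<in>{(m1, m2). mono_mult m1 m2 = m}. f (fst p) \<otimes>\<^bsub>F\<^esub> g (snd p))"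
  by (auto simp: na_poly_def)

lemma mono_mult_eq_Node:
  "{(m1, m2). mono_mult m1 m2 = Some (Node a b)} =
     {(None, Some (Node a b)), (Some (Node a b), None), (Some a, Some b)}"
proof -
  have "mono_mult m1 m2 = Some (Node a b) \<longleftrightarrow>
      (m1, m2) \<in> {(None, Some (Node a b)), (Some (Node a b), None), (Some a, Some b)}" for m1 m2
    by (cases "(m1, m2)" rule: mono_mult.cases) auto
  then show ?thesis by auto
qed

lemma mono_vars_mult: "mono_vars (mono_mult m1 m2) = mono_vars m1 \<union> mono_vars m2"
  by (cases "(m1, m2)" rule: mono_mult.cases) auto

lemma (in field) na_mult_nonzero:
  assumes "range f \<subseteq> carrier R" "range g \<subseteq> carrier R"
    and "(\<Oplus>p\<in>{(m1, m2). mono_mult m1 m2 = m}. f (fst p) \<otimes> g (snd p)) \<noteq> \<zero>"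
  shows "\<exists>m1 m2. mono_mult m1 m2 = m \<and> f m1 \<noteq> \<zero> \<and> g m2 \<noteq> \<zero>"
proof (rule ccontr)
  assume "\<not> ?thesis"
  then have "f (fst p) \<otimes> g (snd p) = \<zero>" if "p \<in> {(m1, m2). mono_mult m1 m2 = m}" for p
    using that assms(1,2) by (cases p) (force simp: image_subset_iff)
  then have "(\<Oplus>p\<in>{(m1, m2). mono_mult m1 m2 = m}. f (fst p) \<otimes> g (snd p)) =
      (\<Oplus>p\<in>{(m1, m2). mono_mult m1 m2 = m}. \<zero>)"
    by (intro finsum_cong') auto
  then show False using assms(3) by simp
qed

lemma (in field) na_mult_closed:
  assumes "range f \<subseteq> carrier R" "range g \<subseteq> carrier R"
  shows "(\<Oplus>p\<in>{(m1, m2). mono_mult m1 m2 = m}. f (fst p) \<otimes> g (snd p)) \<in> carrier R"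
proof -
  have "f m \<in> carrier R" "g m \<in> carrier R" for m using assms by auto
  then show ?thesis by (intro finsum_closed) auto
qed

text \<open>A \<open>Node\<close> factors in three ways, two of them through the monomial 1. Fixing
  a subtree of a product thus obeys a rule like that of Leibniz, with constant terms as
  coefficients.\<close>

lemma (in field) na_mult_Node:
  assumes "range f \<subseteq> carrier R" "range g \<subseteq> carrier R"
  shows "(\<Oplus>p\<in>{(m1, m2). mono_mult m1 m2 = Some (Node a b)}. f (fst p) \<otimes> g (snd p)) =
     f None \<otimes> g (Some (Node a b)) \<oplus> (g None \<otimes> f (Some (Node a b)) \<oplus> f (Some a) \<otimes> g (Some b))"
proof -
  have [simp]: "f m \<in> carrier R" "g m \<in> carrier R" for m using assms by auto
  show ?thesis unfolding mono_mult_eq_Node by (simp add: m_comm)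
qed

section \<open>Values and supports of gates\<close>

definition gate_vals :: "'a ring \<Rightarrow> nat \<Rightarrow> 'a gate list \<Rightarrow> (mono \<Rightarrow> 'a) list" where
  "gate_vals F n gs = foldl (\<lambda>vs g. vs @ [gate_poly F n vs g]) [] gs"

lemma gate_vals_snoc: "gate_vals F n (gs @ [g]) = gate_vals F n gs @ [gate_poly F n (gate_vals F n gs) g]"
  by (simp add: gate_vals_def)

lemma length_gate_vals [simp]: "length (gate_vals F n gs) = length gs"
  by (induction gs rule: rev_induct) (auto simp: gate_vals_snoc, simp add: gate_vals_def)

lemma take_gate_vals: "i \<le> length gs \<Longrightarrow> take i (gate_vals F n gs) = gate_vals F n (take i gs)"
proof (induction gs rule: rev_induct)
  case (snoc g gs)
  then show ?case by (cases "i = Suc (length gs)") (auto simp: gate_vals_snoc)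
qed (simp add: gate_vals_def)

lemma nth_gate_vals:
  assumes "i < length gs"
  shows "gate_vals F n gs ! i = gate_poly F n (take i (gate_vals F n gs)) (gs ! i)"
proof -
  have "gate_vals F n (take (Suc i) gs) = gate_vals F n (take i gs) @ [gate_poly F n (gate_vals F n (take i gs)) (gs ! i)]"
    using assms by (simp add: take_Suc_conv_app_nth gate_vals_snoc)
  then have "take (Suc i) (gate_vals F n gs) ! i = gate_poly F n (take i (gate_vals F n gs)) (gs ! i)"
    using assms by (simp add: take_gate_vals nth_append)
  then show ?thesis using assms by simp
qed

lemma sum_gate_poly:
  "foldr (\<lambda>j f. (vs ! j) \<oplus>\<^bsub>na_poly F n\<^esub> f) js \<zero>\<^bsub>na_poly F n\<^esub> m =
     foldr (\<lambda>j a. (vs ! j) m \<oplus>\<^bsub>F\<^esub> a) js \<zero>\<^bsub>F\<^esub>"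
  by (induction js) auto

context
  fixes F :: "'a ring" (structure) and n :: nat and C :: "'a circuit"
  assumes F: "field F" and wf: "wf_circuit F n C"
begin

interpretation field F by (rule F)

abbreviation (input) "sz \<equiv> length (gates C)"
abbreviation (input) "gval \<equiv> (\<lambda>i. gate_vals F n (gates C) ! i)"

lemma wf_children: "i < sz \<Longrightarrow> j \<in> children (gates C ! i) \<Longrightarrow> j < i"
  using wf unfolding wf_circuit_def by blast

lemma wf_gate: "i < sz \<Longrightarrow> wf_gate F n (gates C ! i)"
  using wf unfolding wf_circuit_def by blast

lemma gate_Var: "i < sz \<Longrightarrow> gates C ! i = Var v \<Longrightarrow> gval i = term_poly F \<one> (Some (Leaf v)) \<and> v \<in> {1..n}"
  using nth_gate_vals[of i "gates C" F n] wf_gate[of i] by simp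

lemma gate_Const: "i < sz \<Longrightarrow> gates C ! i = Const c \<Longrightarrow> gval i = term_poly F c None \<and> c \<in> carrier F"
  using nth_gate_vals[of i "gates C" F n] wf_gate[of i] by simp

lemma gate_Sum:
  assumes "i < sz" "gates C ! i = Sum js"
  shows "gval i m = foldr (\<lambda>j a. gval j m \<oplus> a) js \<zero>"
proof -
  have "gval i m = foldr (\<lambda>j f. (take i (gate_vals F n (gates C)) ! j) \<oplus>\<^bsub>na_poly F n\<^esub> f) js \<zero>\<^bsub>na_poly F n\<^esub> m"
    using assms by (simp add: nth_gate_vals[of i] del: na_poly_simps)
  also have "\<dots> = foldr (\<lambda>j a. (take i (gate_vals F n (gates C)) ! j) m \<oplus> a) js \<zero>"
    by (rule sum_gate_poly)
  also have "\<dots> = foldr (\<lambda>j a. gval j m \<oplus> a) js \<zero>"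
    using wf_children[OF assms(1)] assms(2) by (intro foldr_cong) auto
  finally show ?thesis .
qed

lemma gate_Prod:
  assumes "i < sz" "gates C ! i = Prod l r"
  shows "gval i m = (\<Oplus>p\<in>{(m1, m2). mono_mult m1 m2 = m}. gval l (fst p) \<otimes> gval r (snd p))"
  using assms wf_children[OF assms(1)] by (simp add: nth_gate_vals[of i])

lemma gate_carrier: "i < sz \<Longrightarrow> range (gval i) \<subseteq> carrier F"
proof (induction i rule: less_induct)
  case (less i)
  have IH: "gval j m \<in> carrier F" if "j \<in> children (gates C ! i)" for j m
  proof -
    have "j < i" using wf_children less.prems that by blast
    then show ?thesis using less.IH[of j] less.prems by auto
  qed
  have "gval i m \<in> carrier F" for m
  proof (cases "gates C ! i")
    case (Var v)
    then show ?thesis using gate_Var less.prems by (simp add: term_poly_def)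
  next
    case (Const c)
    then show ?thesis using gate_Const less.prems by (simp add: term_poly_def)
  next
    case (Sum js)
    have "foldr (\<lambda>j a. gval j m \<oplus> a) js' \<zero> \<in> carrier F" if "set js' \<subseteq> set js" for js'
      using that IH Sum by (induction js') auto
    then show ?thesis using gate_Sum[OF less.prems Sum] by simp
  next
    case (Prod l r)
    then show ?thesis using gate_Prod[OF less.prems Prod] IH na_mult_closed[of "gval l" "gval r"] by auto
  qed
  then show ?case by blast
qed

lemma gate_child_nonzero:
  assumes i: "i < sz" "gates C ! i = Sum js" and nz: "gval i m \<noteq> \<zero>"
  shows "\<exists>j\<in>set js. gval j m \<noteq> \<zero>"
proof (rule ccontr)
  assume z: "\<not> ?thesis"
  have "foldr (\<lambda>j a. gval j m \<oplus> a) js' \<zero> = \<zero>" if "set js' \<subseteq> set js" for js'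
    using that z by (induction js') auto
  then show False using gate_Sum[OF i] nz by simp
qed

lemma gate_factors_nonzero:
  assumes i: "i < sz" "gates C ! i = Prod l r" and nz: "gval i m \<noteq> \<zero>"
  shows "\<exists>m1 m2. mono_mult m1 m2 = m \<and> gval l m1 \<noteq> \<zero> \<and> gval r m2 \<noteq> \<zero>"
proof -
  have "l < i" "r < i" using wf_children[OF i(1)] i(2) by auto
  then show ?thesis using gate_Prod[OF i, of m] nz gate_carrier[of l] gate_carrier[of r] i(1)
    by (intro na_mult_nonzero) auto
qed

lemma gate_supp: "i < sz \<Longrightarrow> finite (supp F (gval i)) \<and> (\<forall>m\<in>supp F (gval i). mono_vars m \<subseteq> {1..n})"
proof (induction i rule: less_induct)
  case (less i)
  have IH: "finite (supp F (gval j)) \<and> (\<forall>m\<in>supp F (gval j). mono_vars m \<subseteq> {1..n})"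
    if "j \<in> children (gates C ! i)" for j
    using less.IH[of j] wf_children[OF less.prems that] less.prems by auto
  show ?case
  proof (cases "gates C ! i")
    case (Var v)
    then have "supp F (gval i) \<subseteq> {Some (Leaf v)}" "v \<in> {1..n}"
      using gate_Var less.prems by (auto simp: term_poly_def supp_def)
    then show ?thesis using finite_subset by auto
  next
    case (Const c)
    then have "supp F (gval i) \<subseteq> {None}" using gate_Const less.prems by (auto simp: term_poly_def supp_def)
    then show ?thesis using finite_subset by auto
  next
    case (Sum js)
    then have sub: "supp F (gval i) \<subseteq> (\<Union>j\<in>set js. supp F (gval j))"
      using gate_child_nonzero[OF less.prems Sum] by (auto simp: supp_def)
    have "finite (\<Union>j\<in>set js. supp F (gval j))" using IH Sum by auto
    then have "finite (supp F (gval i))" using sub finite_subset by blast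
    moreover have "mono_vars m \<subseteq> {1..n}" if m: "m \<in> supp F (gval i)" for m
    proof -
      obtain j where "j \<in> set js" "m \<in> supp F (gval j)" using sub m by auto
      then show ?thesis using IH[of j] Sum by simp
    qed
    ultimately show ?thesis by blast
  next
    case (Prod l r)
    have sub: "supp F (gval i) \<subseteq> (\<lambda>(m1, m2). mono_mult m1 m2) ` (supp F (gval l) \<times> supp F (gval r))"
      using gate_factors_nonzero[OF less.prems Prod] by (fastforce simp: supp_def)
    have "finite (supp F (gval l) \<times> supp F (gval r))" using IH Prod by auto
    then have "finite (supp F (gval i))" using sub finite_subset by blast
    moreover have "mono_vars m \<subseteq> {1..n}" if "m \<in> supp F (gval i)" for m
    proof -
      obtain m1 m2 where "m = mono_mult m1 m2" "m1 \<in> supp F (gval l)" "m2 \<in> supp F (gval r)"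
        using sub \<open>m \<in> supp F (gval i)\<close> by auto
      then show ?thesis using IH[of l] IH[of r] Prod by (auto simp: mono_vars_mult)
    qed
    ultimately show ?thesis by blast
  qed
qed

text \<open>Constant terms are left out: the weights isolate trees, and the constant term is read
  off from the scalar part of the value.\<close>

definition gate_span :: "(mtree \<Rightarrow> 'a) set" where
  "gate_span = lspan F sz (\<lambda>i m. gval i (Some m))"

lemma G_closed: "i < sz \<Longrightarrow> gval i m \<in> carrier F"
  using gate_carrier by auto

text \<open>Induction along the gates. At a product, the two trivial factorizations contribute
  multiples of derivatives of the children. The third contributes a multiple of the child that holds
  the free subtree; this child is itself a generator.\<close>

lemma derivative_in_gate_span:
  "i < sz \<Longrightarrow> (\<lambda>u. gval i (Some (Node t u))) \<in> gate_span \<and> (\<lambda>u. gval i (Some (Node u t))) \<in> gate_span"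
proof (induction i rule: less_induct)
  case (less i)
  have IH: "(\<lambda>u. gval j (Some (Node t u))) \<in> gate_span \<and> (\<lambda>u. gval j (Some (Node u t))) \<in> gate_span"
    if "j \<in> children (gates C ! i)" for j
    using less.IH[of j] wf_children[OF less.prems that] less.prems by auto
  note closed = G_closed
  have z: "(\<lambda>u. \<zero>) \<in> gate_span"
    unfolding gate_span_def by (rule lspan_zero) (simp add: closed)
  have a: "(\<lambda>u. f u \<oplus> g u) \<in> gate_span" if "f \<in> gate_span" "g \<in> gate_span" for f g
    using that unfolding gate_span_def by (intro lspan_add) (simp_all add: closed)
  have s: "(\<lambda>u. c \<otimes> f u) \<in> gate_span" if "f \<in> gate_span" "c \<in> carrier F" for f c
    using that unfolding gate_span_def by (intro lspan_smult) (simp_all add: closed)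
  have g: "(\<lambda>u. gval j (Some u)) \<in> gate_span" if "j < sz" for j
    using that lspan_gen[of sz "\<lambda>i m. gval i (Some m)" j] unfolding gate_span_def by (simp add: closed)
  show ?case
  proof (cases "gates C ! i")
    case (Var v)
    then show ?thesis using gate_Var[OF less.prems Var] z by (simp add: term_poly_def)
  next
    case (Const c)
    then show ?thesis using gate_Const[OF less.prems Const] z by (simp add: term_poly_def)
  next
    case (Sum js)
    have "(\<lambda>u. foldr (\<lambda>j a. gval j (Some (Node t u)) \<oplus> a) js' \<zero>) \<in> gate_span \<and>
        (\<lambda>u. foldr (\<lambda>j a. gval j (Some (Node u t)) \<oplus> a) js' \<zero>) \<in> gate_span" if "set js' \<subseteq> set js" for js'
      using that IH Sum by (induction js') (auto intro!: a z)
    then show ?thesis unfolding gate_Sum[OF less.prems Sum] by simp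
  next
    case (Prod l r)
    have lr: "l < sz" "r < sz" using wf_children[OF less.prems] Prod less.prems by fastforce+
    have e: "gval i (Some (Node x y)) = gval l None \<otimes> gval r (Some (Node x y)) \<oplus>
        (gval r None \<otimes> gval l (Some (Node x y)) \<oplus> gval l (Some x) \<otimes> gval r (Some y))" for x y
      unfolding gate_Prod[OF less.prems Prod] using lr gate_carrier by (intro na_mult_Node) auto
    have e': "gval i (Some (Node x y)) = gval l None \<otimes> gval r (Some (Node x y)) \<oplus>
        (gval r None \<otimes> gval l (Some (Node x y)) \<oplus> gval r (Some y) \<otimes> gval l (Some x))" for x y
      unfolding e using lr closed by (simp add: m_comm)
    have "(\<lambda>u. gval i (Some (Node t u))) \<in> gate_span"
      unfolding e using IH Prod lr closed g by (intro a s) auto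
    moreover have "(\<lambda>u. gval i (Some (Node u t))) \<in> gate_span"
      unfolding e' using IH Prod lr closed g by (intro a s) auto
    ultimately show ?thesis by blast
  qed
qed

lemma derivation_closed_gate_span: "derivation_closed gate_span"
  unfolding derivation_closed_def
proof (intro ballI allI conjI)
  fix f t assume "f \<in> gate_span"
  then obtain a where a: "\<And>i. a i \<in> carrier F" "\<And>m. f m = (\<Oplus>i\<in>{..<sz}. a i \<otimes> gval i (Some m))"
    unfolding gate_span_def lspan_def by blast
  note D = derivative_in_gate_span[of _ t]
  show "(\<lambda>u. f (Node t u)) \<in> gate_span" "(\<lambda>u. f (Node u t)) \<in> gate_span"
    unfolding a(2) gate_span_def
    using D[unfolded gate_span_def] by (intro lspan_finsum; simp add: a(1) G_closed)+
qed

lemma triangular_bound_gate_span: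
  assumes "sz \<le> s"
  shows "triangular_bound \<zero> s gate_span"
proof -
  have tb: "triangular_bound \<zero> sz gate_span"
    unfolding gate_span_def by (rule triangular_bound_lspan) (simp add: G_closed)
  show ?thesis unfolding triangular_bound_def
  proof (intro allI impI)
    fix B and w :: "mtree \<Rightarrow> nat"
    assume "finite B" "inj_on w B"
      "\<forall>b\<in>B. \<exists>f\<in>gate_span. f b \<noteq> \<zero> \<and> (\<forall>b'\<in>B. w b' < w b \<longrightarrow> f b' = \<zero>)"
    then have "card B \<le> sz" using tb unfolding triangular_bound_def by blast
    then show "card B \<le> s" using assms by simp
  qed
qed

section \<open>Heights of trees against product depth\<close>

definition gate_path :: "nat \<Rightarrow> nat list \<Rightarrow> bool" where
  "gate_path i p \<longleftrightarrow> p \<noteq> [] \<and> set p \<subseteq> {..<sz} \<and> children (gates C ! hd p) = {} \<and>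
     (\<forall>j. Suc j < length p \<longrightarrow> p ! j \<in> children (gates C ! (p ! Suc j))) \<and> last p = i"

lemma gate_path_snoc:
  assumes "gate_path j p" "j \<in> children (gates C ! i)" "i < sz"
  shows "gate_path i (p @ [i])"
  using assms unfolding gate_path_def
  by (auto simp: nth_append less_Suc_eq last_conv_nth)
     (metis diff_Suc_Suc diff_zero)

text \<open>Walk down from gate \<open>i\<close>, entering at a product the factor with the higher
  subtree. Every step that lowers the height passes a product gate; the final leaf, of height 1,
  accounts for \<open>Suc\<close>.\<close>

lemma tree_path:
  "i < sz \<Longrightarrow> gval i (Some t) \<noteq> \<zero> \<Longrightarrow>
    \<exists>p. gate_path i p \<and> height t \<le> Suc (length (filter (\<lambda>i. is_prod (gates C ! i)) p))"
proof (induction i arbitrary: t rule: less_induct)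
  case (less i)
  have ext: "\<exists>p. gate_path i p \<and>
      height u + (if is_prod (gates C ! i) then 1 else 0) \<le> Suc (length (filter (\<lambda>i. is_prod (gates C ! i)) p))"
    if j: "j \<in> children (gates C ! i)" and nz: "gval j (Some u) \<noteq> \<zero>" for j u
  proof -
    have "j < i" using wf_children less.prems(1) j by blast
    then obtain p where p: "gate_path j p" "height u \<le> Suc (length (filter (\<lambda>i. is_prod (gates C ! i)) p))"
      using less.IH[of j u] less.prems nz by auto
    show ?thesis
      by (rule exI[of _ "p @ [i]"]) (use gate_path_snoc[OF p(1) j less.prems(1)] p(2) in auto)
  qed
  show ?case
  proof (cases "gates C ! i")
    case (Var v)
    then have "t = Leaf v" using gate_Var[OF less.prems(1) Var] less.prems(2)
      by (auto simp: term_poly_def split: if_splits)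
    moreover have "gate_path i [i]" using Var less.prems by (auto simp: gate_path_def)
    ultimately show ?thesis by (intro exI[of _ "[i]"]) auto
  next
    case (Const c)
    then show ?thesis using gate_Const[OF less.prems(1) Const] less.prems(2) by (simp add: term_poly_def)
  next
    case (Sum js)
    then obtain j where "j \<in> set js" "gval j (Some t) \<noteq> \<zero>"
      using gate_child_nonzero[OF less.prems(1) Sum less.prems(2)] by auto
    then show ?thesis using ext[of j t] Sum by simp
  next
    case (Prod l r)
    obtain m1 m2 where m: "mono_mult m1 m2 = Some t" "gval l m1 \<noteq> \<zero>" "gval r m2 \<noteq> \<zero>"
      using gate_factors_nonzero[OF less.prems(1) Prod less.prems(2)] by auto
    obtain j u where "j \<in> {l, r}" "gval j (Some u) \<noteq> \<zero>" "height t \<le> Suc (height u)"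
    proof (cases m1)
      case None
      then show ?thesis using m that[of r t] by auto
    next
      case m1: (Some t1)
      show ?thesis
      proof (cases m2)
        case None
        then show ?thesis using m m1 that[of l t] by auto
      next
        case (Some t2)
        then have "t = Node t1 t2" using m m1 by simp
        then show ?thesis using m m1 Some that[of l t1] that[of r t2] by (cases "height t1 \<le> height t2") auto
      qed
    qed
    then show ?thesis using ext[of j u] Prod le_trans by fastforce
  qed
qed

text \<open>Gate indices increase along a path, so no path is longer than the list of gates.
  Finiteness is what makes the \<open>Max\<close> in \<open>product_depth\<close> an upper
  bound.\<close>

lemma finite_leaf_root_paths: "finite (leaf_root_paths C)"
proof (rule finite_subset)
  show "leaf_root_paths C \<subseteq> {p. set p \<subseteq> {..<sz} \<and> length p \<le> sz}"
  proof
    fix p assume p: "p \<in> leaf_root_paths C"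
    have "sorted_wrt (<) p"
    proof (subst sorted_wrt_iff_nth_Suc_transp)
      show "\<forall>i. Suc i < length p \<longrightarrow> p ! i < p ! Suc i"
      proof (intro allI impI)
        fix i assume i: "Suc i < length p"
        have "set p \<subseteq> {..<sz}" using p by (auto simp: leaf_root_paths_def)
        then have "p ! Suc i < sz" using nth_mem[OF i] by blast
        then show "p ! i < p ! Suc i" using wf_children p i by (auto simp: leaf_root_paths_def)
      qed
    qed simp
    then have "length p = card (set p)" by (simp add: distinct_card strict_sorted_iff)
    also have "\<dots> \<le> card {..<sz}" using p by (intro card_mono) (auto simp: leaf_root_paths_def)
    finally show "p \<in> {p. set p \<subseteq> {..<sz} \<and> length p \<le> sz}" using p by (auto simp: leaf_root_paths_def)
  qed
  show "finite {p. set p \<subseteq> {..<sz} \<and> length p \<le> sz}" by (rule finite_lists_length_le) simp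
qed

lemma circuit_poly_facts:
  shows "range (circuit_poly F n C) \<subseteq> carrier F" "finite (supp F (circuit_poly F n C))"
    "\<forall>m\<in>supp F (circuit_poly F n C). mono_vars m \<subseteq> {1..n}"
    "circuit_poly F n C (Some t) \<noteq> \<zero> \<Longrightarrow> height t \<le> Suc (product_depth C)"
    "(\<lambda>m. circuit_poly F n C (Some m)) \<in> gate_span"
proof -
  have o: "out_gate C < sz" and e: "circuit_poly F n C = gval (out_gate C)"
    using wf by (auto simp: wf_circuit_def circuit_poly_def gate_vals_def)
  show "range (circuit_poly F n C) \<subseteq> carrier F" unfolding e using gate_carrier o by blast
  show "finite (supp F (circuit_poly F n C))" "\<forall>m\<in>supp F (circuit_poly F n C). mono_vars m \<subseteq> {1..n}"
    unfolding e using gate_supp o by blast+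
  show "(\<lambda>m. circuit_poly F n C (Some m)) \<in> gate_span"
    unfolding e gate_span_def using lspan_gen[of sz "\<lambda>i m. gval i (Some m)" "out_gate C"] G_closed o by simp
  assume "circuit_poly F n C (Some t) \<noteq> \<zero>"
  then obtain p where p: "gate_path (out_gate C) p" "height t \<le> Suc (length (filter (\<lambda>i. is_prod (gates C ! i)) p))"
    using tree_path[OF o] e by auto
  have "p \<in> leaf_root_paths C" using p(1) by (auto simp: gate_path_def leaf_root_paths_def)
  then have "length (filter (\<lambda>i. is_prod (gates C ! i)) p) \<le> product_depth C"
    unfolding product_depth_def using finite_leaf_root_paths by (intro Max_ge) auto
  then show "height t \<le> Suc (product_depth C)" using p(2) by simp
qed

end


section \<open>The hitting set\<close>

text \<open>The rank, from 0, of cell \<open>(p, p + 1, k)\<close> of the \<open>i\<close>-th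
  element in the order in which \<open>encode_point\<close> lists the cells, scalars left out. The
  column \<open>p + 1\<close> has rank \<open>p\<close>, so \<open>p\<close> occurs twice. The
  program thus finds the index by counting cells.\<close>

definition letter_idx :: "nat \<Rightarrow> nat \<times> nat \<times> nat \<Rightarrow> nat" where
  "letter_idx d = (\<lambda>(i, k, p). (((i - 1) * (d + 1) + (p - 1)) * (d + 1) + p) * d + (k - 1))"

lemma mult_add_eq_iff:
  fixes a b c c' m :: nat
  assumes "c < m" "c' < m"
  shows "a * m + c = b * m + c' \<longleftrightarrow> a = b \<and> c = c'"
proof
  assume e: "a * m + c = b * m + c'"
  then have "(a * m + c) div m = (b * m + c') div m" by simp
  then have "a = b" using assms by simp
  then show "a = b \<and> c = c'" using e by simp
qed simp

lemma mult_add_less: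
  fixes a b c m :: nat
  assumes "a < b" "c < m"
  shows "a * m + c < b * m"
proof -
  have "a * m + c < Suc a * m" using assms by simp
  also have "\<dots> \<le> b * m" using assms by (intro mult_right_mono) auto
  finally show ?thesis .
qed

lemma letter_idx:
  "inj_on (letter_idx d) ({1..n} \<times> {1..d} \<times> {1..d})"
  "letter_idx d ` ({1..n} \<times> {1..d} \<times> {1..d}) \<subseteq> {..<n * (d + 1) * (d + 1) * d}"
proof -
  show "inj_on (letter_idx d) ({1..n} \<times> {1..d} \<times> {1..d})"
  proof (rule inj_onI)
    fix x y assume xy: "x \<in> {1..n} \<times> {1..d} \<times> {1..d}" "y \<in> {1..n} \<times> {1..d} \<times> {1..d}" "letter_idx d x = letter_idx d y"
    obtain i k p i' k' p' where x: "x = (i, k, p)" "y = (i', k', p')" by (cases x, cases y)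
    have r: "i \<in> {1..n}" "k \<in> {1..d}" "p \<in> {1..d}" "i' \<in> {1..n}" "k' \<in> {1..d}" "p' \<in> {1..d}"
      and e: "letter_idx d (i, k, p) = letter_idx d (i', k', p')"
      using xy x by auto
    have lt: "k - 1 < d" "k' - 1 < d" "p < d + 1" "p' < d + 1" "p - 1 < d + 1" "p' - 1 < d + 1" using r by auto
    have 1: "((i - 1) * (d + 1) + (p - 1)) * (d + 1) + p = ((i' - 1) * (d + 1) + (p' - 1)) * (d + 1) + p' \<and> k - 1 = k' - 1"
      using e mult_add_eq_iff[OF lt(1,2)] unfolding letter_idx_def prod.case by blast
    then have 2: "(i - 1) * (d + 1) + (p - 1) = (i' - 1) * (d + 1) + (p' - 1) \<and> p = p'"
      using mult_add_eq_iff[OF lt(3,4)] by blast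
    then have "i - 1 = i' - 1" using mult_add_eq_iff[OF lt(5,6)] by blast
    then show "x = y" using 1 2 r x by auto
  qed
  show "letter_idx d ` ({1..n} \<times> {1..d} \<times> {1..d}) \<subseteq> {..<n * (d + 1) * (d + 1) * d}"
  proof clarify
    fix i k p assume r: "i \<in> {1..n}" "k \<in> {1..d}" "p \<in> {1..d}"
    have "(i - 1) * (d + 1) + (p - 1) < n * (d + 1)" using r by (intro mult_add_less) auto
    then have "((i - 1) * (d + 1) + (p - 1)) * (d + 1) + p < n * (d + 1) * (d + 1)"
      using r by (intro mult_add_less) auto
    then show "letter_idx d (i, k, p) < n * (d + 1) * (d + 1) * d"
      unfolding letter_idx_def prod.case using r by (intro mult_add_less) auto
  qed
qed

text \<open>
  In base \<open>g\<close>, digits \<open>2j - 2\<close> and \<open>2j - 1\<close> of \<open>M\<close> hold the modulus (minus 1) and the variable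
  assigned to level \<open>j \<ge> 1\<close>.
\<close>

definition modulus_of :: "nat \<Rightarrow> nat \<Rightarrow> nat \<Rightarrow> nat" where
  "modulus_of g M j = M div g ^ (2 * (j - 1)) mod g + 1"

definition elem_of :: "nat \<Rightarrow> nat \<Rightarrow> nat \<Rightarrow> nat" where
  "elem_of g M j = M div g ^ (2 * (j - 1) + 1) mod g"

text \<open>Takes a bare index instead of a letter, because the program evaluates it at every cell
  before deciding whether the cell lies on the superdiagonal.\<close>

definition entry :: "'a ring \<Rightarrow> (nat \<Rightarrow> 'a) \<Rightarrow> nat \<Rightarrow> nat \<Rightarrow> nat \<Rightarrow> nat \<Rightarrow> 'a" where
  "entry F e D g M x = pow_prod F (\<lambda>j. e (elem_of g M j)) (\<lambda>j. 2 ^ x mod modulus_of g M j) D"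

definition hit_point :: "'a ring \<Rightarrow> (nat \<Rightarrow> 'a) \<Rightarrow> nat \<Rightarrow> nat \<Rightarrow> nat \<Rightarrow> nat \<Rightarrow> nat \<Rightarrow> 'a point" where
  "hit_point F e n d D g M = shift_point F n d (\<lambda>x. entry F e D g M (letter_idx d x))"

lemma ex_code:
  assumes "\<And>j. qs j \<in> {1..g}" "\<And>j. \<tau> j < g"
  shows "\<exists>M < g ^ (2 * D). \<forall>j\<in>{1..D}. modulus_of g M j = qs j \<and> elem_of g M j = \<tau> j"
proof -
  define a where "a i = (if even i then qs (i div 2 + 1) - 1 else \<tau> (i div 2 + 1))" for i
  have "a i < g" for i using assms(1)[of "i div 2 + 1"] assms(2) by (auto simp: a_def)
  then obtain M where M: "M < g ^ (2 * D)" "\<And>i. i < 2 * D \<Longrightarrow> M div g ^ i mod g = a i"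
    using ex_digits[of "2 * D" a g] by auto
  have "modulus_of g M j = qs j \<and> elem_of g M j = \<tau> j" if j: "j \<in> {1..D}" for j
  proof (cases j)
    case (Suc i)
    then show ?thesis
      using M(2)[of "2 * i"] M(2)[of "2 * i + 1"] j assms(1)[of j]
      by (simp add: modulus_of_def elem_of_def a_def)
  qed (use j in simp)
  then show ?thesis using M(1) by blast
qed

text \<open>For \<open>u \<ge> 2\<close> the exponents add up: 1 for the factor 2, then 2 for
  \<open>d * d\<close>, 6 for the pairs of candidates and 5 for the range of
  \<open>letter_idx\<close>. For \<open>u = 1\<close> the factor 2 has no room, but there are no
  pairs either.\<close>

lemma size_bounds:
  fixes n s d :: nat
  assumes "1 \<le> n" "1 \<le> s" "1 \<le> d"
  defines "u \<equiv> n * s * d" and "c \<equiv> n + (d - 1) * (s * s)"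
  shows "2 * (d * d * (c * (c - 1)) * (n * (d + 1) * (d + 1) * d)) \<le> u ^ 14"
proof (cases "u = 1")
  case True
  then have "n = 1" "s = 1" "d = 1" by (auto simp: u_def)
  then show ?thesis by (simp add: c_def u_def)
next
  case False
  have u: "2 \<le> u" using False assms(1-3) unfolding u_def by (metis One_nat_def Suc_leI le_neq_implies_less mult_pos_pos numeral_2_eq_2 zero_less_Suc less_le_trans)
  have nu: "n * d \<le> u" "s * d \<le> u" "n \<le> u" "s \<le> u" "d \<le> u" using assms(1-3) by (auto simp: u_def)
  have "(d - 1) * (s * s) \<le> (s * d) * s" by (simp add: algebra_simps)
  also have "\<dots> \<le> u * u" using nu by (intro mult_mono) auto
  finally have "c \<le> u + u * u" unfolding c_def using nu by simp
  also have "\<dots> \<le> 2 * (u * u)" by simp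
  also have "\<dots> \<le> u * (u * u)" using u by (rule mult_right_mono) simp
  finally have c: "c \<le> u ^ 3" by (simp add: power3_eq_cube)
  have d1: "d + 1 \<le> u ^ 2"
  proof -
    have "d + 1 \<le> u + u" using nu u by simp
    also have "\<dots> = 2 * u" by simp
    also have "\<dots> \<le> u * u" using u by (rule mult_right_mono) simp
    finally show ?thesis by (simp add: power2_eq_square)
  qed
  have "n * (d + 1) * (d + 1) * d = (n * d) * ((d + 1) * (d + 1))" by (simp only: ac_simps)
  also have "\<dots> \<le> u * (u ^ 2 * u ^ 2)" using nu d1 by (intro mult_mono) auto
  finally have L: "n * (d + 1) * (d + 1) * d \<le> u * (u ^ 2 * u ^ 2)" .
  have "2 * (d * d * (c * (c - 1)) * (n * (d + 1) * (d + 1) * d))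
      \<le> u * (u * u * (u ^ 3 * u ^ 3) * (u * (u ^ 2 * u ^ 2)))"
  proof -
    have "c - 1 \<le> u ^ 3" using c by simp
    then show ?thesis
      by (rule mult_le_mono[OF u mult_le_mono[OF mult_le_mono[OF mult_le_mono[OF nu(5,5)] mult_le_mono[OF c]] L]])
  qed
  also have "\<dots> = u ^ 14" by (simp add: power_numeral_reduce)
  finally show ?thesis .
qed

theorem hit_points_hit:
  fixes F :: "'a ring" (structure) and n s d \<Delta> M :: nat
  assumes F: "field F" and n: "1 \<le> n" and s: "1 \<le> s" and d: "1 \<le> d"
    and sup: "field_supply F ((n * s * d) ^ 20) e"
  defines "g \<equiv> (n * s * d) ^ 20" and "D \<equiv> min (\<Delta> + 1) d"
  shows "hits F n s d \<Delta> (hit_point F e n d D g ` {..<g ^ (2 * D)})"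
    and "hit_point F e n d D g M \<in> points F n d"
proof -
  interpret field F by (rule F)
  define u where "u = n * s * d"
  have u: "1 \<le> u" using n s d by (simp add: u_def)
  \<comment> \<open>14 is the exponent from \<open>size_bounds\<close>. The exponents of the
    variables stay below \<open>d * Q \<le> u ^ 15\<close>, so both they and the moduli fit under
    \<open>g\<close>.\<close>
  define Q where "Q = u ^ 14"
  define L where "L = n * (d + 1) * (d + 1) * d"
  have pw: "u ^ a \<le> u ^ b" if "a \<le> b" for a b using that u by (intro power_increasing) auto
  have Q: "1 \<le> Q" "Q \<le> g" "d * Q \<le> g"
  proof -
    show "1 \<le> Q" using u by (simp add: Q_def)
    show "Q \<le> g" unfolding Q_def g_def u_def[symmetric] by (rule pw) simp
    have "d * Q \<le> u * u ^ 14" unfolding Q_def using n s by (intro mult_right_mono) (auto simp: u_def)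
    also have "\<dots> = u ^ 15" by (simp flip: power_Suc)
    also have "\<dots> \<le> g" unfolding g_def u_def[symmetric] by (rule pw) simp
    finally show "d * Q \<le> g" .
  qed
  have g: "0 < g" using Q by simp
  have ec: "e i \<in> carrier F" if "i < g" for i using sup that by (auto simp: field_supply_def g_def)
  have einj: "inj_on e {..<g}" "e ` {..<g} \<subseteq> carrier F" using sup by (auto simp: field_supply_def g_def)
  have elem: "elem_of g M j < g" for M j using g by (simp add: elem_of_def)
  have tc: "e (elem_of g M j) \<in> carrier F" for M j using ec elem by blast
  have entc: "entry F e D g M x \<in> carrier F" for M x unfolding entry_def using tc by simp
  show "hit_point F e n d D g M \<in> points F n d" for M
    unfolding hit_point_def using entc by (intro shift_point_in_points[OF F])
  have D: "1 \<le> D" "D \<le> d" using d by (auto simp: D_def)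
  show "hits F n s d \<Delta> (hit_point F e n d D g ` {..<g ^ (2 * D)})"
    unfolding hits_def
  proof (intro allI impI, elim conjE)
    fix \<Psi> :: "'a circuit"
    assume wf: "wf_circuit F n \<Psi>" and sz: "circuit_size \<Psi> \<le> s" and pd: "product_depth \<Psi> \<le> \<Delta>"
      and nz: "circuit_poly F n \<Psi> \<noteq> \<zero>\<^bsub>na_poly F n\<^esub>" and dg: "na_degree F (circuit_poly F n \<Psi>) \<le> d"
    define f where "f = circuit_poly F n \<Psi>"
    note facts = circuit_poly_facts[OF F wf, folded f_def]
    have fc: "f m \<in> carrier F" for m using facts(1) by auto
    note evals = eval_poly_shift_point[OF F _ facts(1-3) dg[folded f_def]]
    have evN: "snd (eval_poly F d (hit_point F e n d D g M) f) = f None" for M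
      unfolding hit_point_def by (rule evals(1)) (rule entc)
    show "\<exists>h\<in>hit_point F e n d D g ` {..<g ^ (2 * D)}. eval_poly F d h (circuit_poly F n \<Psi>) \<noteq> \<zero>\<^bsub>A_alg F d\<^esub>"
      unfolding f_def[symmetric]
    proof (rule ccontr)
      assume neg: "\<not> (\<exists>h\<in>hit_point F e n d D g ` {..<g ^ (2 * D)}. eval_poly F d h f \<noteq> \<zero>\<^bsub>A_alg F d\<^esub>)"
      have ev0: "eval_poly F d (hit_point F e n d D g M) f = (cube_zero F d, \<zero>)" if "M < g ^ (2 * D)" for M
        using neg that by auto
      have "f None = \<zero>" using ev0[of 0] evN[of 0] g by simp
      moreover obtain m0 where "f m0 \<noteq> \<zero>" using nz by (auto simp: f_def fun_eq_iff)
      ultimately obtain t0 where t0: "f (Some t0) \<noteq> \<zero>" by (cases m0) auto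
      define c where "c = leaves t0"
      have lv: "leaves m \<le> d" if "f (Some m) \<noteq> \<zero>" for m
      proof -
        have "mono_degree (Some m) \<le> na_degree F f"
          unfolding na_degree_def using facts(2) that by (intro Max_ge) (auto simp: supp_def intro!: image_eqI)
        then show ?thesis using dg by (simp add: f_def)
      qed
      have c: "1 \<le> c" "c \<le> d" using lv[OF t0] leaves_pos[of t0] by (auto simp: c_def)
      define T where "T = {m. f (Some m) \<noteq> \<zero> \<and> leaves m = c}"
      \<comment> \<open>The two bounds in \<open>D\<close>: the circuit limits the height to
        \<open>\<Delta> + 1\<close>, and the number of leaves limits it to \<open>d\<close>.\<close>
      have T: "T \<subseteq> mtrees n D c"
      proof
        fix m assume m: "m \<in> T"
        then have "height m \<le> D"
          using facts(4)[of m] pd height_le_leaves[of m] c by (simp add: T_def D_def)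
        moreover have "tree_vars m \<subseteq> {1..n}" using facts(3) m by (force simp: T_def supp_def)
        ultimately show "m \<in> mtrees n D c" using m by (simp add: mtrees_def T_def)
      qed
      have "Some ` T \<subseteq> supp F f" by (auto simp: T_def supp_def)
      then have Tf: "finite T" using facts(2) by (metis finite_imageD finite_subset inj_Some)
      let ?S = "gate_span F n \<Psi>"
      obtain qs B where qs: "\<And>j. qs j \<in> {1..Q}"
        and B: "\<And>p a. 1 \<le> p \<Longrightarrow> p + a \<le> d + 1 \<Longrightarrow>
           isolates \<zero> s ?S (mtrees n D a) (lex_wt (letter_idx d) (d * Q + 1) D qs 1 p) (B p a)"
      proof -
        have "\<exists>qs B. (\<forall>j. qs j \<in> {1..Q}) \<and> (\<forall>p a. 1 \<le> p \<longrightarrow> p + a \<le> d + 1 \<longrightarrow>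
           isolates \<zero> s ?S (mtrees n D a) (lex_wt (letter_idx d) (d * Q + 1) D qs (D + 1 - D) p) (B p a))"
        proof (rule ex_isolating_levels[OF _ _ D(2) d letter_idx refl Q(1)])
          show "triangular_bound \<zero> s ?S"
            using triangular_bound_gate_span[OF F wf] sz by (simp add: circuit_size_def)
          show "derivation_closed ?S" by (rule derivation_closed_gate_span[OF F wf])
          show "2 * (d * d * ((n + (d - 1) * (s * s)) * (n + (d - 1) * (s * s) - 1)) * (n * (d + 1) * (d + 1) * d)) \<le> Q"
            unfolding Q_def u_def by (rule size_bounds[OF n s d])
        qed auto
        then obtain qs B where 1: "\<forall>j. qs j \<in> {1..Q}" and 2: "\<forall>p a. 1 \<le> p \<longrightarrow> p + a \<le> d + 1 \<longrightarrow>
           isolates \<zero> s ?S (mtrees n D a) (lex_wt (letter_idx d) (d * Q + 1) D qs (D + 1 - D) p) (B p a)"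
          by blast
        have e: "D + 1 - D = 1" by simp
        show ?thesis using 1 2[unfolded e] by (intro that[of qs B]) blast+
      qed
      define w where "w = lex_wt (letter_idx d) (d * Q + 1) D qs 1 1"
      have iso: "isolates \<zero> s ?S (mtrees n D c) w (B 1 c)" unfolding w_def using B[of 1 c] c by simp
      define hw where "hw m j = hash_wt (letter_idx d) (qs j) 1 1 m" for m j
      have dom: "f (Some m) = \<zero>" if "m \<in> mtrees n D c" "m \<notin> B 1 c" "\<And>b. b \<in> B 1 c \<Longrightarrow> w b < w m \<Longrightarrow> f (Some b) = \<zero>" for m
      proof -
        have "\<forall>f\<in>?S. (\<forall>b\<in>B 1 c. w b < w m \<longrightarrow> f b = \<zero>) \<longrightarrow> f m = \<zero>"
          using iso that(1,2) unfolding isolates_def by blast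
        from bspec[OF this facts(5)] that(3) show ?thesis by simp
      qed
      have "\<exists>b. b \<in> B 1 c \<and> f (Some b) \<noteq> \<zero>"
      proof (rule ccontr)
        assume none: "\<not> ?thesis"
        have "t0 \<in> T" using t0 by (simp add: T_def c_def)
        then show False using dom[of t0] none t0 T by blast
      qed
      then obtain b1 where b1: "b1 \<in> B 1 c \<and> f (Some b1) \<noteq> \<zero>" by blast
      \<comment> \<open>The lightest isolated tree occurring in \<open>f\<close>. A tree of
        \<open>T\<close> with the same exponents has the same weight: inside \<open>B 1 c\<close> it
        must be \<open>b\<close>, and outside it \<open>f\<close> would vanish there, since all
        lighter isolated trees have coefficient 0.\<close>
      obtain b where b: "b \<in> B 1 c" "f (Some b) \<noteq> \<zero>"
        "\<And>b'. b' \<in> B 1 c \<Longrightarrow> f (Some b') \<noteq> \<zero> \<Longrightarrow> w b \<le> w b'"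
        using ex_has_least_nat[of "\<lambda>b. b \<in> B 1 c \<and> f (Some b) \<noteq> \<zero>" b1 w, OF b1] by blast
      have bT: "b \<in> T" using b iso by (auto simp: isolates_def mtrees_def T_def)
      have "{m\<in>T. \<forall>j\<in>{1..D}. hw m j = hw b j} = {b}"
      proof (intro equalityI subsetI)
        fix m assume m: "m \<in> {m\<in>T. \<forall>j\<in>{1..D}. hw m j = hw b j}"
        then have wm: "w m = w b" unfolding w_def lex_wt_def hw_def by simp
        have "m \<in> B 1 c"
        proof (rule ccontr)
          assume "m \<notin> B 1 c"
          then have "f (Some m) = \<zero>"
          proof (rule dom[rotated])
            show "m \<in> mtrees n D c" using T m by auto
            show "f (Some b') = \<zero>" if "b' \<in> B 1 c" "w b' < w m" for b' using b(3)[OF that(1)] that(2) wm by auto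
          qed
          then show False using m by (simp add: T_def)
        qed
        then show "m \<in> {b}" using wm b(1) iso by (auto simp: isolates_def inj_on_def)
      qed (use bT in auto)
      moreover have "(\<Oplus>m\<in>{m\<in>T. \<forall>j\<in>{1..D}. hw m j = hw b j}. f (Some m)) = \<zero>"
      proof (rule grid_vanishing[OF g einj Tf, where w = hw and \<alpha> = "hw b" and D = D and f = "\<lambda>m. f (Some m)"])
        show "(\<lambda>m. f (Some m)) \<in> T \<rightarrow> carrier F" using fc by auto
        show "hw m j < g" if "m \<in> T" for m j
        proof -
          have "hw m j < d * Q"
            unfolding hw_def using that qs[of j] c d by (intro hash_wt_less) (auto simp: T_def)
          then show ?thesis using Q by simp
        qed
        fix \<tau> :: "nat \<Rightarrow> nat" assume \<tau>: "\<And>j. \<tau> j < g"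
        have "qs j \<in> {1..g}" for j using qs[of j] Q by simp
        \<comment> \<open>The code whose digits spell the moduli belonging to this circuit and the
          grid point \<open>\<tau>\<close>.\<close>
        then obtain M where M: "M < g ^ (2 * D)" "\<And>j. j \<in> {1..D} \<Longrightarrow> modulus_of g M j = qs j \<and> elem_of g M j = \<tau> j"
          using ex_code[of qs g \<tau> D] \<tau> by blast
        have "(1, c + 1, 1) \<in> cube_idx d" using c by (auto simp: cube_idx_def)
        then have "\<zero> = fst (eval_poly F d (hit_point F e n d D g M) f) (1, c + 1, 1)"
          using ev0[OF M(1)] by (simp add: cube_zero_def)
        also have "\<dots> = (\<Oplus>m\<in>T. f (Some m) \<otimes> tree_val F (\<lambda>x. entry F e D g M (letter_idx d x)) 1 1 m)"
          unfolding hit_point_def T_def by (rule evals(2)[OF _ c]) (rule entc)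
        also have "\<dots> = (\<Oplus>m\<in>T. f (Some m) \<otimes> pow_prod F (\<lambda>j. e (\<tau> j)) (hw m) D)"
        proof (rule finsum_cong')
          fix m assume "m \<in> T"
          have "tree_val F (\<lambda>x. entry F e D g M (letter_idx d x)) 1 1 m
             = pow_prod F (\<lambda>j. e (elem_of g M j)) (\<lambda>j. hash_wt (letter_idx d) (modulus_of g M j) 1 1 m) D"
            unfolding entry_def by (rule tree_val_pow_prod[OF F tc])
          also have "\<dots> = pow_prod F (\<lambda>j. e (\<tau> j)) (hw m) D"
            using M(2) by (intro pow_prod_cong) (auto simp: hw_def)
          finally show "f (Some m) \<otimes> tree_val F (\<lambda>x. entry F e D g M (letter_idx d x)) 1 1 m =
              f (Some m) \<otimes> pow_prod F (\<lambda>j. e (\<tau> j)) (hw m) D" by simp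
        qed (use fc ec \<tau> in auto)
        finally show "(\<Oplus>m\<in>T. f (Some m) \<otimes> pow_prod F (\<lambda>j. e (\<tau> j)) (hw m) D) = \<zero>" by simp
      qed
      ultimately show False using b(2) fc by simp
    qed
  qed
qed


section \<open>The program\<close>

definition wp :: "'a ring \<Rightarrow> (nat \<Rightarrow> 'a) \<Rightarrow> com \<Rightarrow> (nat \<Rightarrow> 'a state \<Rightarrow> bool) \<Rightarrow> 'a state \<Rightarrow> bool" where
  "wp F e c Q \<sigma> \<longleftrightarrow> (\<exists>t \<tau>. exec F e c \<sigma> t \<tau> \<and> Q t \<tau>)"

lemma wp_Instr: "Q 1 (step F e i \<sigma>) \<Longrightarrow> wp F e (Instr i) Q \<sigma>"
  unfolding wp_def using exec_Instr by metis

lemma wp_Seq: "wp F e c1 (\<lambda>t1. wp F e c2 (\<lambda>t2. Q (t1 + t2))) \<sigma> \<Longrightarrow> wp F e (Seq c1 c2) Q \<sigma>"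
  unfolding wp_def using exec_Seq by metis

lemma wp_IfZero:
  "(nmem \<sigma> i = 0 \<Longrightarrow> wp F e c1 (\<lambda>t. Q (t + 1)) \<sigma>) \<Longrightarrow> (nmem \<sigma> i \<noteq> 0 \<Longrightarrow> wp F e c2 (\<lambda>t. Q (t + 1)) \<sigma>) \<Longrightarrow>
    wp F e (IfZero i c1 c2) Q \<sigma>"
  unfolding wp_def using exec_IfTrue exec_IfFalse by metis

lemma wp_mono: "wp F e c P \<sigma> \<Longrightarrow> (\<And>t \<tau>. P t \<tau> \<Longrightarrow> Q t \<tau>) \<Longrightarrow> wp F e c Q \<sigma>"
  unfolding wp_def by blast

text \<open>The index of the invariant is the number of rounds still to come; it yields termination
  and the time bound at once.\<close>

lemma wp_While:
  assumes "I N \<sigma>"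
    and body: "\<And>k \<sigma>. I (Suc k) \<sigma> \<Longrightarrow> nmem \<sigma> r \<noteq> 0 \<and> wp F e c (\<lambda>t \<tau>. t \<le> T \<and> I k \<tau>) \<sigma>"
    and exit: "\<And>\<sigma>. I 0 \<sigma> \<Longrightarrow> nmem \<sigma> r = 0"
    and Q: "\<And>t \<tau>. t \<le> N * (T + 1) + 1 \<Longrightarrow> I 0 \<tau> \<Longrightarrow> Q t \<tau>"
  shows "wp F e (WhileNonZero r c) Q \<sigma>"
proof -
  have "\<exists>t \<tau>. exec F e (WhileNonZero r c) \<sigma> t \<tau> \<and> t \<le> N * (T + 1) + 1 \<and> I 0 \<tau>"
    using assms(1)
  proof (induction N arbitrary: \<sigma>)
    case 0
    then show ?case using exec_WhileEnd[of \<sigma> r F e c] exit by fastforce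
  next
    case (Suc N)
    obtain t1 \<sigma>' where 1: "exec F e c \<sigma> t1 \<sigma>'" "t1 \<le> T" "I N \<sigma>'" "nmem \<sigma> r \<noteq> 0"
      using body[OF Suc.prems] unfolding wp_def by blast
    obtain t2 \<tau> where 2: "exec F e (WhileNonZero r c) \<sigma>' t2 \<tau>" "t2 \<le> N * (T + 1) + 1" "I 0 \<tau>"
      using Suc.IH[OF 1(3)] by blast
    have "exec F e (WhileNonZero r c) \<sigma> (t1 + t2 + 1) \<tau>" by (rule exec_WhileStep[OF 1(4,1) 2(1)])
    moreover have "t1 + t2 + 1 \<le> Suc N * (T + 1) + 1" using 1 2 by simp
    ultimately show ?case using 2(3) by blast
  qed
  then show ?thesis using Q unfolding wp_def by blast
qed

section \<open>Multiplication, division and counting loops\<close>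

text \<open>
  Registers: 0 to 3 the input, 4 and 5 the constants 1 and 0, 7 \<open>g\<close>, 9 \<open>D\<close>, 11 the number of points,
  12 \<open>d + 1\<close>; the counters of the nested loops over the point, \<open>i\<close>, \<open>p\<close>, \<open>p'\<close>, \<open>k\<close> are 14 to 18, and 19 is
  the index of the current entry. Registers from 20 on are scratch. Field register 2 stays 0.
\<close>

definition prog_mul :: "nat \<Rightarrow> nat \<Rightarrow> nat \<Rightarrow> nat \<Rightarrow> com" where
  "prog_mul c a b x = Seq (Instr (NAdd x a 5)) (Seq (Instr (NConst c 0))
     (WhileNonZero x (Seq (Instr (NAdd c c b)) (Instr (NSub x x 4)))))"

lemma wp_mul:
  assumes c: "nmem \<sigma> 4 = 1" "nmem \<sigma> 5 = 0" "x \<notin> {4, 5, a, b, c}" "c \<notin> {4, 5, b}"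
    and Q: "\<And>t. t \<le> 3 * nmem \<sigma> a + 3 \<Longrightarrow> Q t (\<sigma>\<lparr>nmem := (nmem \<sigma>)(x := 0, c := nmem \<sigma> a * nmem \<sigma> b)\<rparr>)"
  shows "wp F e (prog_mul c a b x) Q \<sigma>"
proof -
  let ?A = "nmem \<sigma> a" and ?B = "nmem \<sigma> b"
  define I where "I k \<tau> \<longleftrightarrow> k \<le> ?A \<and> \<tau> = \<sigma>\<lparr>nmem := (nmem \<sigma>)(x := k, c := (?A - k) * ?B)\<rparr>" for k and \<tau> :: "'a state"
  have "wp F e (WhileNonZero x (Seq (Instr (NAdd c c b)) (Instr (NSub x x 4)))) (\<lambda>t. Q (t + 2)) (\<sigma>\<lparr>nmem := (nmem \<sigma>)(x := ?A, c := 0)\<rparr>)"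
  proof (rule wp_While[where I = I and N = ?A and T = 2])
    show "I ?A (\<sigma>\<lparr>nmem := (nmem \<sigma>)(x := ?A, c := 0)\<rparr>)" by (simp add: I_def)
    fix k and \<tau> :: "'a state" assume I: "I (Suc k) \<tau>"
    have "(?A - Suc k) * ?B + ?B = (?A - k) * ?B"
      using I by (simp add: I_def Suc_diff_Suc[symmetric] flip: mult_Suc add.commute)
    then have "I k (\<tau>\<lparr>nmem := (nmem \<tau>)(c := nmem \<tau> c + nmem \<tau> b, x := nmem \<tau> x - 1)\<rparr>)"
      using I c by (auto simp: I_def fun_eq_iff)
    then show "nmem \<tau> x \<noteq> 0 \<and> wp F e (Seq (Instr (NAdd c c b)) (Instr (NSub x x 4))) (\<lambda>t \<tau>. t \<le> 2 \<and> I k \<tau>) \<tau>"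
      using I c by (auto intro!: wp_Seq wp_Instr simp: I_def)
  next
    show "nmem \<tau> x = 0" if "I 0 \<tau>" for \<tau> using that c by (simp add: I_def)
    show "Q (t + 2) \<tau>" if "t \<le> ?A * (2 + 1) + 1" "I 0 \<tau>" for t \<tau>
    proof -
      have "\<tau> = \<sigma>\<lparr>nmem := (nmem \<sigma>)(x := 0, c := ?A * ?B)\<rparr>" using that by (simp add: I_def)
      then show ?thesis using Q[of "t + 2"] that by simp
    qed
  qed
  then show ?thesis unfolding prog_mul_def using c
    by (intro wp_Seq wp_Instr) (simp add: add.commute)
qed

text \<open>With truncated subtraction, \<open>w\<close> holds \<open>x + 1 - g\<close>, which is
  nonzero exactly when \<open>g \<le> x\<close>.\<close>

definition prog_divmod :: "nat \<Rightarrow> nat \<Rightarrow> nat \<Rightarrow> nat \<Rightarrow> com" where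
  "prog_divmod x g y w = Seq (Instr (NConst y 0)) (Seq (Instr (NAdd w x 4)) (Seq (Instr (NSub w w g))
     (WhileNonZero w (Seq (Instr (NSub x x g)) (Seq (Instr (NAdd y y 4)) (Seq (Instr (NAdd w x 4)) (Instr (NSub w w g))))))))"

lemma wp_divmod:
  assumes c: "nmem \<sigma> 4 = 1" "4 \<notin> {x, g, y, w}" "distinct [x, g, y, w]" "0 < nmem \<sigma> g"
    and Q: "\<And>t. t \<le> 5 * nmem \<sigma> x + 4 \<Longrightarrow>
      Q t (\<sigma>\<lparr>nmem := (nmem \<sigma>)(x := nmem \<sigma> x mod nmem \<sigma> g, y := nmem \<sigma> x div nmem \<sigma> g, w := 0)\<rparr>)"
  shows "wp F e (prog_divmod x g y w) Q \<sigma>"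
proof -
  let ?X = "nmem \<sigma> x" and ?G = "nmem \<sigma> g"
  let ?c = "Seq (Instr (NSub x x g)) (Seq (Instr (NAdd y y 4)) (Seq (Instr (NAdd w x 4)) (Instr (NSub w w g))))"
  define I where "I k \<tau> \<longleftrightarrow> k \<le> ?X div ?G \<and>
     \<tau> = \<sigma>\<lparr>nmem := (nmem \<sigma>)(x := ?X mod ?G + k * ?G, y := ?X div ?G - k, w := ?X mod ?G + k * ?G + 1 - ?G)\<rparr>"
    for k and \<tau> :: "'a state"
  have "wp F e (WhileNonZero w ?c) (\<lambda>t. Q (1 + (1 + (1 + t)))) (\<sigma>\<lparr>nmem := (nmem \<sigma>)(y := 0, w := ?X + 1 - ?G)\<rparr>)"
  proof (rule wp_While[where I = I and N = "?X div ?G" and T = 4])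
    show "I (?X div ?G) (\<sigma>\<lparr>nmem := (nmem \<sigma>)(y := 0, w := ?X + 1 - ?G)\<rparr>)"
    proof -
      have "?X mod ?G + ?X div ?G * ?G = ?X" by (rule mod_div_mult_eq)
      then show ?thesis unfolding I_def by (auto simp: fun_eq_iff intro!: state.equality)
    qed
    fix k and \<tau> :: "'a state" assume I: "I (Suc k) \<tau>"
    have "Suc k \<le> ?X div ?G" using I by (simp add: I_def)
    then have "Suc (?X div ?G - Suc k) = ?X div ?G - k" by simp
    then have "I k (\<tau>\<lparr>nmem := (nmem \<tau>)(x := nmem \<tau> x - nmem \<tau> g, y := nmem \<tau> y + 1, w := nmem \<tau> x - nmem \<tau> g + 1 - nmem \<tau> g)\<rparr>)"
      using I c by (auto simp: I_def fun_eq_iff)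
    then show "nmem \<tau> w \<noteq> 0 \<and> wp F e ?c (\<lambda>t \<tau>. t \<le> 4 \<and> I k \<tau>) \<tau>"
      using I c by (auto intro!: wp_Seq wp_Instr simp: I_def)
  next
    show "nmem \<tau> w = 0" if "I 0 \<tau>" for \<tau> using that c by (auto simp: I_def Suc_le_eq)
    show "Q (1 + (1 + (1 + t))) \<tau>" if "t \<le> ?X div ?G * (4 + 1) + 1" "I 0 \<tau>" for t \<tau>
    proof -
      have "?X mod ?G + 1 - ?G = 0" using c by (simp add: Suc_le_eq)
      then have "\<tau> = \<sigma>\<lparr>nmem := (nmem \<sigma>)(x := ?X mod ?G, y := ?X div ?G, w := 0)\<rparr>" using that by (simp add: I_def)
      moreover have "1 + (1 + (1 + t)) \<le> 5 * ?X + 4"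
      proof -
        have "1 + (1 + (1 + t)) \<le> ?X div ?G * 5 + 4" using that(1) by simp
        also have "\<dots> \<le> ?X * 5 + 4" by (intro add_right_mono mult_le_mono1 div_le_dividend)
        finally show ?thesis by (simp add: mult.commute)
      qed
      ultimately show ?thesis using Q[of "1 + (1 + (1 + t))"] by simp
    qed
  qed
  then show ?thesis unfolding prog_divmod_def using c
    by (intro wp_Seq wp_Instr) simp
qed

text \<open>The frame of a piece of program: registers below \<open>L\<close> and the constant zero
  in field register 2 survive. Outer loops have the lower counters, so frames nest.\<close>

definition agree :: "nat \<Rightarrow> 'a state \<Rightarrow> 'a state \<Rightarrow> bool" where
  "agree L \<sigma> \<tau> \<longleftrightarrow> (\<forall>r<L. nmem \<tau> r = nmem \<sigma> r) \<and> fmem \<tau> 2 = fmem \<sigma> 2"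

lemma agree_refl [simp]: "agree L \<sigma> \<sigma>" by (simp add: agree_def)
lemma agree_trans: "agree L \<sigma> \<tau> \<Longrightarrow> agree L' \<tau> \<upsilon> \<Longrightarrow> L \<le> L' \<Longrightarrow> agree L \<sigma> \<upsilon>" by (simp add: agree_def)
lemma agreeD: "agree L \<sigma> \<tau> \<Longrightarrow> r < L \<Longrightarrow> nmem \<tau> r = nmem \<sigma> r" by (simp add: agree_def)

definition prog_for :: "nat \<Rightarrow> nat \<Rightarrow> com \<Rightarrow> com" where
  "prog_for r b c = Seq (Instr (NAdd r b 5)) (WhileNonZero r (Seq c (Instr (NSub r r 4))))"

text \<open>The counter runs downwards from the number of iterations to 1.\<close>

lemma wp_for:
  assumes c: "nmem \<sigma> 4 = 1" "nmem \<sigma> 5 = 0" "5 < r"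
    and J0: "\<And>v. J 0 (\<sigma>\<lparr>nmem := (nmem \<sigma>)(r := v)\<rparr>)"
    and J: "\<And>k \<tau> v. J k \<tau> \<Longrightarrow> J k (\<tau>\<lparr>nmem := (nmem \<tau>)(r := v)\<rparr>)"
    and body: "\<And>k \<tau>. k < nmem \<sigma> b \<Longrightarrow> agree r \<sigma> \<tau> \<Longrightarrow> nmem \<tau> r = nmem \<sigma> b - k \<Longrightarrow> J k \<tau> \<Longrightarrow>
       wp F e body (\<lambda>t \<upsilon>. t \<le> T \<and> agree (Suc r) \<tau> \<upsilon> \<and> J (Suc k) \<upsilon> \<and> out \<upsilon> = out \<tau> @ f k) \<tau>"
    and Q: "\<And>t \<tau>. t \<le> nmem \<sigma> b * (T + 2) + 2 \<Longrightarrow> agree r \<sigma> \<tau> \<Longrightarrow> J (nmem \<sigma> b) \<tau> \<Longrightarrow>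
       out \<tau> = out \<sigma> @ concat (map f [0..<nmem \<sigma> b]) \<Longrightarrow> Q t \<tau>"
  shows "wp F e (prog_for r b body) Q \<sigma>"
proof -
  let ?N = "nmem \<sigma> b"
  define I where "I m \<tau> \<longleftrightarrow> m \<le> ?N \<and> nmem \<tau> r = m \<and> agree r \<sigma> \<tau> \<and> J (?N - m) \<tau> \<and>
     out \<tau> = out \<sigma> @ concat (map f [0..<?N - m])" for m \<tau>
  have "wp F e (WhileNonZero r (Seq body (Instr (NSub r r 4)))) (\<lambda>t. Q (t + 1)) (\<sigma>\<lparr>nmem := (nmem \<sigma>)(r := ?N)\<rparr>)"
  proof (rule wp_While[where I = I and N = ?N and T = "T + 1"])
    show "I ?N (\<sigma>\<lparr>nmem := (nmem \<sigma>)(r := ?N)\<rparr>)" using J0 by (auto simp: I_def agree_def)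
    fix k \<tau> assume I: "I (Suc k) \<tau>"
    have k: "?N - Suc k < ?N" "?N - (?N - Suc k) = Suc k" "Suc (?N - Suc k) = ?N - k" using I by (auto simp: I_def)
    have "wp F e body (\<lambda>t \<upsilon>. t \<le> T \<and> agree (Suc r) \<tau> \<upsilon> \<and> J (?N - k) \<upsilon> \<and> out \<upsilon> = out \<tau> @ f (?N - Suc k)) \<tau>"
      using body[OF k(1), of \<tau>] I k by (simp add: I_def)
    then have "wp F e body (\<lambda>t. wp F e (Instr (NSub r r 4)) (\<lambda>t2 \<tau>. t + t2 \<le> T + 1 \<and> I k \<tau>)) \<tau>"
    proof (rule wp_mono)
      fix t \<upsilon> assume u: "t \<le> T \<and> agree (Suc r) \<tau> \<upsilon> \<and> J (?N - k) \<upsilon> \<and> out \<upsilon> = out \<tau> @ f (?N - Suc k)"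
      have "nmem \<upsilon> r = Suc k" "nmem \<upsilon> 4 = 1" using u I c by (auto simp: I_def agree_def)
      moreover have "[0..<?N - k] = [0..<?N - Suc k] @ [?N - Suc k]" unfolding k(3)[symmetric] by simp
      ultimately have "I k (step F e (NSub r r 4) \<upsilon>)"
        using u I J by (auto simp: I_def agree_def)
      then show "wp F e (Instr (NSub r r 4)) (\<lambda>t2 \<tau>. t + t2 \<le> T + 1 \<and> I k \<tau>) \<upsilon>"
        using u by (intro wp_Instr) simp
    qed
    then show "nmem \<tau> r \<noteq> 0 \<and> wp F e (Seq body (Instr (NSub r r 4))) (\<lambda>t \<tau>. t \<le> T + 1 \<and> I k \<tau>) \<tau>"
      using I by (auto intro!: wp_Seq simp: I_def)
  next
    show "nmem \<tau> r = 0" if "I 0 \<tau>" for \<tau> using that by (simp add: I_def)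
    show "Q (t + 1) \<tau>" if "t \<le> ?N * (T + 1 + 1) + 1" "I 0 \<tau>" for t \<tau>
      using that by (intro Q) (auto simp: I_def)
  qed
  then show ?thesis unfolding prog_for_def using c by (intro wp_Seq wp_Instr) (simp add: add.commute)
qed

text \<open>Reducing after every doubling keeps register 25 below \<open>2 * q\<close>, so a
  division by repeated subtraction takes time linear in \<open>q\<close>; the number
  \<open>2 ^ idx\<close> itself is never formed.\<close>

lemma wp_pow2_mod:
  assumes c: "nmem \<sigma> 4 = 1" "0 < nmem \<sigma> 24" "nmem \<sigma> 25 = 1 mod nmem \<sigma> 24"
    and Q: "\<And>t y. t \<le> nmem \<sigma> 26 * (10 * nmem \<sigma> 24 + 10) + 1 \<Longrightarrow>
      Q t (\<sigma>\<lparr>nmem := (nmem \<sigma>)(26 := 0, 25 := 2 ^ nmem \<sigma> 26 mod nmem \<sigma> 24, 23 := y, 27 := 0)\<rparr>)"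
    and w: "nmem \<sigma> 27 = 0"
  shows "wp F e (WhileNonZero 26 (Seq (Instr (NAdd 25 25 25)) (Seq (prog_divmod 25 24 23 27) (Instr (NSub 26 26 4))))) Q \<sigma>"
proof -
  let ?N = "nmem \<sigma> 26" and ?q = "nmem \<sigma> 24"
  define I where "I k \<tau> \<longleftrightarrow> k \<le> ?N \<and> (\<exists>y. \<tau> = \<sigma>\<lparr>nmem := (nmem \<sigma>)(26 := k, 25 := 2 ^ (?N - k) mod ?q, 23 := y, 27 := 0)\<rparr>)"
    for k and \<tau> :: "'a state"
  show ?thesis
  proof (rule wp_While[where I = I and N = ?N and T = "10 * ?q + 9"])
    show "I ?N \<sigma>" unfolding I_def using c w by (intro conjI exI[of _ "nmem \<sigma> 23"]) (auto simp: fun_eq_iff intro!: state.equality)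
    fix k and \<tau> :: "'a state" assume "I (Suc k) \<tau>"
    then obtain y where k: "Suc k \<le> ?N"
      and \<tau>: "\<tau> = \<sigma>\<lparr>nmem := (nmem \<sigma>)(26 := Suc k, 25 := 2 ^ (?N - Suc k) mod ?q, 23 := y, 27 := 0)\<rparr>"
      by (auto simp: I_def)
    let ?p = "2 ^ (?N - Suc k) mod ?q"
    have "?N - k = Suc (?N - Suc k)" using k by simp
    then have p: "(?p + ?p) mod ?q = 2 ^ (?N - k) mod ?q" by (simp add: mod_add_eq mult_2)
    have pq: "?p < ?q" using c by simp
    have "wp F e (Seq (Instr (NAdd 25 25 25)) (Seq (prog_divmod 25 24 23 27) (Instr (NSub 26 26 4))))
       (\<lambda>t \<tau>. t \<le> 10 * ?q + 9 \<and> I k \<tau>) \<tau>"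
    proof (intro wp_Seq wp_Instr wp_divmod)
      fix t assume t: "t \<le> 5 * nmem (step F e (NAdd 25 25 25) \<tau>) 25 + 4"
      let ?\<tau> = "step F e (NAdd 25 25 25) \<tau>"
      let ?u = "step F e (NSub 26 26 4) (?\<tau>\<lparr>nmem := (nmem ?\<tau>)(25 := nmem ?\<tau> 25 mod nmem ?\<tau> 24, 23 := nmem ?\<tau> 25 div nmem ?\<tau> 24, 27 := 0)\<rparr>)"
      have "?u = \<sigma>\<lparr>nmem := (nmem \<sigma>)(26 := k, 25 := 2 ^ (?N - k) mod ?q, 23 := (?p + ?p) div ?q, 27 := 0)\<rparr>"
        using \<tau> c p by (auto simp: fun_eq_iff intro!: state.equality)
      then have "I k ?u" using k unfolding I_def by auto
      moreover have "1 + (t + 1) \<le> 10 * ?q + 9" using t pq \<tau> by simp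
      ultimately show "1 + (t + 1) \<le> 10 * ?q + 9 \<and> I k ?u" by blast
    qed (use \<tau> c in auto)
    then show "nmem \<tau> 26 \<noteq> 0 \<and> wp F e (Seq (Instr (NAdd 25 25 25)) (Seq (prog_divmod 25 24 23 27) (Instr (NSub 26 26 4))))
       (\<lambda>t \<tau>. t \<le> 10 * ?q + 9 \<and> I k \<tau>) \<tau>" using \<tau> by simp
  next
    show "nmem \<tau> 26 = 0" if "I 0 \<tau>" for \<tau> using that by (auto simp: I_def)
    show "Q t \<tau>" if t: "t \<le> ?N * (10 * ?q + 9 + 1) + 1" and I: "I 0 \<tau>" for t \<tau>
    proof -
      have "t \<le> ?N * (10 * ?q + 10) + 1" using t by (simp add: algebra_simps)
      from Q[OF this] I show ?thesis by (auto simp: I_def)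
    qed
  qed
qed

lemma wp_elem_pow:
  assumes F: "field F" and c: "nmem \<sigma> 4 = 1" "fmem \<sigma> 0 \<in> carrier F" "fmem \<sigma> 1 \<in> carrier F"
    and Q: "\<And>t. t \<le> 3 * nmem \<sigma> 25 + 1 \<Longrightarrow>
      Q t (\<sigma>\<lparr>nmem := (nmem \<sigma>)(25 := 0), fmem := (fmem \<sigma>)(0 := fmem \<sigma> 0 \<otimes>\<^bsub>F\<^esub> fmem \<sigma> 1 [^]\<^bsub>F\<^esub> nmem \<sigma> 25)\<rparr>)"
  shows "wp F e (WhileNonZero 25 (Seq (Instr (FMul 0 0 1)) (Instr (NSub 25 25 4)))) Q \<sigma>"
proof -
  interpret field F by (rule F)
  let ?N = "nmem \<sigma> 25" and ?a = "fmem \<sigma> 0" and ?y = "fmem \<sigma> 1"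
  define I where "I k \<tau> \<longleftrightarrow> k \<le> ?N \<and>
      \<tau> = \<sigma>\<lparr>nmem := (nmem \<sigma>)(25 := k), fmem := (fmem \<sigma>)(0 := ?a \<otimes>\<^bsub>F\<^esub> ?y [^]\<^bsub>F\<^esub> (?N - k))\<rparr>"
    for k and \<tau> :: "'a state"
  show ?thesis
  proof (rule wp_While[where I = I and N = ?N and T = 2])
    show "I ?N \<sigma>" unfolding I_def using c by (auto simp: fun_eq_iff intro!: state.equality)
    fix k and \<tau> :: "'a state" assume I: "I (Suc k) \<tau>"
    then have "Suc k \<le> ?N" by (simp add: I_def)
    then have "?N - k = Suc (?N - Suc k)" by simp
    then have "?a \<otimes>\<^bsub>F\<^esub> ?y [^]\<^bsub>F\<^esub> (?N - k) = ?a \<otimes>\<^bsub>F\<^esub> ?y [^]\<^bsub>F\<^esub> (?N - Suc k) \<otimes>\<^bsub>F\<^esub> ?y"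
      using c by (simp add: m_assoc)
    then have "I k (step F e (NSub 25 25 4) (step F e (FMul 0 0 1) \<tau>))"
      using I c by (auto simp: I_def fun_eq_iff intro!: state.equality)
    then show "nmem \<tau> 25 \<noteq> 0 \<and> wp F e (Seq (Instr (FMul 0 0 1)) (Instr (NSub 25 25 4))) (\<lambda>t \<tau>. t \<le> 2 \<and> I k \<tau>) \<tau>"
      using I by (auto intro!: wp_Seq wp_Instr simp: I_def)
  next
    show "nmem \<tau> 25 = 0" if "I 0 \<tau>" for \<tau> using that by (auto simp: I_def)
    show "Q t \<tau>" if "t \<le> ?N * (2 + 1) + 1" "I 0 \<tau>" for t \<tau>
      using that Q by (auto simp: I_def)
  qed
qed

text \<open>The power of 2 starts from \<open>1 mod q\<close>, which is 0 for
  \<open>q = 1\<close>.\<close>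

definition prog_pow :: com where
  "prog_pow = Seq (Instr (NConst 25 1)) (Seq (prog_divmod 25 24 23 27) (Seq (Instr (NAdd 26 19 5))
     (Seq (WhileNonZero 26 (Seq (Instr (NAdd 25 25 25)) (Seq (prog_divmod 25 24 23 27) (Instr (NSub 26 26 4)))))
       (WhileNonZero 25 (Seq (Instr (FMul 0 0 1)) (Instr (NSub 25 25 4)))))))"

lemma wp_pow:
  assumes F: "field F"
    and c: "nmem \<sigma> 4 = 1" "nmem \<sigma> 5 = 0" "nmem \<sigma> 19 = i" "nmem \<sigma> 24 = q" "0 < q"
    and f: "fmem \<sigma> 0 \<in> carrier F" "fmem \<sigma> 1 \<in> carrier F"
    and K: "q \<le> K" "i \<le> K"
    and Q: "\<And>t y. t \<le> 40 * (K * K) \<Longrightarrow> Q t (\<sigma>\<lparr>nmem := (nmem \<sigma>)(23 := y, 25 := 0, 26 := 0, 27 := 0),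
      fmem := (fmem \<sigma>)(0 := fmem \<sigma> 0 \<otimes>\<^bsub>F\<^esub> fmem \<sigma> 1 [^]\<^bsub>F\<^esub> (2 ^ i mod q))\<rparr>)"
  shows "wp F e prog_pow Q \<sigma>"
proof -
  have K1: "K \<le> K * K" "1 \<le> K" using K c by auto
  have iq: "i * (10 * q + 10) \<le> K * (10 * K + 10)" using K by (intro mult_mono) auto
  have time: "1 + (t1 + (1 + (t2 + t3))) \<le> 40 * (K * K)"
    if "t1 \<le> 5 * 1 + 4" "t2 \<le> i * (10 * q + 10) + 1" "t3 \<le> 3 * (2 ^ i mod q) + 1" for t1 t2 t3
  proof -
    have "2 ^ i mod q < q" using c by simp
    then have "t3 \<le> 3 * K + 1" using K that(3) by linarith
    moreover have "t2 \<le> 10 * (K * K) + 10 * K + 1" using that(2) iq by (simp add: algebra_simps)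
    ultimately show ?thesis using that(1) K1 by linarith
  qed
  show ?thesis
    unfolding prog_pow_def
    apply (rule wp_Seq, rule wp_Instr, simp add: c del: One_nat_def)
    apply (rule wp_Seq)
    apply (rule wp_divmod; (simp add: c del: One_nat_def)?)
    apply (rule wp_Seq, rule wp_Instr, simp add: c del: One_nat_def)
    apply (rule wp_Seq)
    apply (rule wp_pow2_mod; (simp add: c del: One_nat_def)?)
    apply (rule wp_elem_pow[OF F]; (simp add: c f del: One_nat_def)?)
    subgoal for t1 t2 y t3
      using Q[OF time[of t1 t2 t3], of y] c
      by (simp add: fun_upd_twist ac_simps)
    done
qed

text \<open>Consumes two base-\<open>g\<close> digits of register 21, lowest first: the modulus
  minus 1, then the index of the field element. The remaining digits stay in 21 for the next
  level.\<close>

definition prog_level :: com where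
  "prog_level =
     Seq (prog_divmod 21 7 23 27) (Seq (Instr (NAdd 24 21 4)) (Seq (Instr (NAdd 21 23 5))
     (Seq (prog_divmod 21 7 23 27) (Seq (Instr (FElem 1 21)) (Seq (Instr (NAdd 21 23 5)) prog_pow)))))"

lemma wp_level:
  assumes F: "field F"
    and c: "nmem \<sigma> 4 = 1" "nmem \<sigma> 5 = 0" "nmem \<sigma> 7 = g" "nmem \<sigma> 19 = i" "nmem \<sigma> 21 = x" "0 < g"
    and f: "fmem \<sigma> 0 \<in> carrier F" "\<And>i. i < g \<Longrightarrow> e i \<in> carrier F"
    and K: "x \<le> K" "g \<le> K" "i \<le> K"
    and Q: "\<And>t \<tau>. t \<le> 70 * (K * K) \<Longrightarrow> agree 21 \<sigma> \<tau> \<Longrightarrow>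
     nmem \<tau> 21 = x div g div g \<Longrightarrow> out \<tau> = out \<sigma> \<Longrightarrow>
     fmem \<tau> 0 = fmem \<sigma> 0 \<otimes>\<^bsub>F\<^esub> e (x div g mod g) [^]\<^bsub>F\<^esub> (2 ^ i mod (x mod g + 1)) \<Longrightarrow> Q t \<tau>"
  shows "wp F e prog_level Q \<sigma>"
proof -
  have "x mod g < g" using c by simp
  then have sm: "Suc (x mod g) \<le> K" using K(2) by linarith
  show ?thesis
  unfolding prog_level_def
  apply (rule wp_Seq)
  apply (rule wp_divmod; (simp add: c)?)
  apply (rule wp_Seq, rule wp_Instr, simp add: c)
  apply (rule wp_Seq, rule wp_Instr, simp add: c)
  apply (rule wp_Seq)
  apply (rule wp_divmod; (simp add: c)?)
  apply (rule wp_Seq, rule wp_Instr, simp add: c)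
  apply (rule wp_Seq, rule wp_Instr, simp add: c)
  apply (rule wp_pow[OF F, where i = i and q = "x mod g + 1" and K = K]; (simp add: c f K sm)?)
  apply (rule Q; (simp add: c agree_def)?)
  subgoal for t1 t2 t3
  proof -
    assume t: "t1 \<le> 5 * x + 4" "t2 \<le> 5 * (x div g) + 4" "t3 \<le> 40 * (K * K)"
    have "x div g \<le> K" using K(1) div_le_dividend le_trans by blast
    then have "t2 \<le> 5 * K + 4" by (intro le_trans[OF t(2)]) simp
    moreover have "K \<le> K * K" "1 \<le> K * K" using K c by auto
    ultimately show ?thesis using t(1,3) K by linarith
  qed
  done
qed

text \<open>The counters run down, so a cell is on the superdiagonal exactly when the row counter
  exceeds the column counter by 1; two truncated subtractions test this. Register 14 holds the code
  plus 1.\<close>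

definition prog_entry :: com where
  "prog_entry = Seq (Instr (FOne 0)) (Seq (Instr (NSub 21 14 4)) (Seq (prog_for 20 9 prog_level)
     (Seq (Instr (NSub 22 16 17))
     (Seq (IfZero 22 (Instr (Out 2)) (Seq (Instr (NSub 22 22 4)) (IfZero 22 (Instr (Out 0)) (Instr (Out 2)))))
       (Instr (NAdd 19 19 4))))))"

definition prog_cells :: com where "prog_cells = prog_for 18 2 prog_entry"
definition prog_rows :: com where "prog_rows = prog_for 17 12 prog_cells"
definition prog_elem :: com where "prog_elem = Seq (prog_for 16 12 prog_rows) (Instr (Out 2))"
definition prog_point :: com where "prog_point = Seq (Instr (NConst 19 0)) (prog_for 15 0 prog_elem)"

section \<open>The nested loops over the coordinates of a point\<close>

context
  fixes F :: "'a ring" (structure) and e :: "nat \<Rightarrow> 'a" and n d D g :: nat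
begin

definition env :: "'a state \<Rightarrow> bool" where
  "env \<sigma> \<longleftrightarrow> nmem \<sigma> 0 = n \<and> nmem \<sigma> 2 = d \<and> nmem \<sigma> 4 = 1 \<and> nmem \<sigma> 5 = 0 \<and> nmem \<sigma> 7 = g \<and> nmem \<sigma> 9 = D \<and>
     nmem \<sigma> 12 = d + 1 \<and> fmem \<sigma> 2 = \<zero>"

lemma env_agree: "env \<sigma> \<Longrightarrow> agree L \<sigma> \<tau> \<Longrightarrow> 13 \<le> L \<Longrightarrow> env \<tau>"
  by (simp add: env_def agree_def)

definition out_entry :: "nat \<Rightarrow> nat \<Rightarrow> nat \<Rightarrow> nat \<Rightarrow> 'a" where
  "out_entry m a b i = (if a = b + 1 then entry F e D g (m - 1) i else \<zero>)"

definition out_cells :: "nat \<Rightarrow> nat \<Rightarrow> nat \<Rightarrow> nat \<Rightarrow> 'a list" where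
  "out_cells m a b i = concat (map (\<lambda>k. [out_entry m a b (i + k)]) [0..<d])"

definition out_rows :: "nat \<Rightarrow> nat \<Rightarrow> nat \<Rightarrow> 'a list" where
  "out_rows m a i = concat (map (\<lambda>k. out_cells m a (d + 1 - k) (i + k * d)) [0..<d + 1])"

definition out_elem :: "nat \<Rightarrow> nat \<Rightarrow> 'a list" where
  "out_elem m i = concat (map (\<lambda>k. out_rows m (d + 1 - k) (i + k * ((d + 1) * d))) [0..<d + 1]) @ [\<zero>]"

definition out_point :: "nat \<Rightarrow> 'a list" where
  "out_point m = concat (map (\<lambda>k. out_elem m (k * ((d + 1) * ((d + 1) * d)))) [0..<n])"

context
  fixes K :: nat
  assumes F: "field F" and g: "0 < g" and e: "\<And>i. i < g \<Longrightarrow> e i \<in> carrier F"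
    and K: "n \<le> K" "d + 1 \<le> K" "D \<le> K" "g \<le> K" "n * ((d + 1) * ((d + 1) * d)) \<le> K"
begin

interpretation field F by (rule F)

lemma K1: "1 \<le> K" using g K by simp

text \<open>Each loop of at most \<open>K\<close> rounds raises the exponent of \<open>K\<close> by
  1 and the constant by 4. The larger jumps between the constants of the nested loops pay for the
  instructions around them.\<close>

lemma loop_time:
  assumes "N \<le> K" "t \<le> N * (c * K ^ j + 2) + 2"
  shows "t \<le> (c + 4) * K ^ Suc j"
proof -
  have "K * 1 \<le> K * K ^ j" using K1 by (intro mult_le_mono2) simp
  moreover have "1 \<le> K * K ^ j" using K1 by simp
  moreover have "N * (c * K ^ j + 2) \<le> K * (c * K ^ j + 2)" using assms by (intro mult_right_mono) auto
  then have "t \<le> c * (K * K ^ j) + 2 * K + 2" using assms(2) by (simp add: algebra_simps)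
  moreover have "(c + 4) * K ^ Suc j = c * (K * K ^ j) + 4 * (K * K ^ j)" by (simp add: algebra_simps)
  ultimately show ?thesis by linarith
qed

lemma wp_entry:
  assumes \<sigma>: "env \<sigma>" "nmem \<sigma> 14 = m" "m \<le> K" "nmem \<sigma> 19 = i" "i \<le> K"
    and Q: "\<And>t \<tau>. t \<le> 90 * K ^ 3 \<Longrightarrow> agree 19 \<sigma> \<tau> \<Longrightarrow> nmem \<tau> 19 = i + 1 \<Longrightarrow>
      out \<tau> = out \<sigma> @ [out_entry m (nmem \<sigma> 16) (nmem \<sigma> 17) i] \<Longrightarrow> Q t \<tau>"
  shows "wp F e prog_entry Q \<sigma>"
proof -
  note c = \<sigma>[unfolded env_def]
  let ?M = "m - 1"
  define \<sigma>1 where "\<sigma>1 = step F e (NSub 21 14 4) (step F e (FOne 0) \<sigma>)"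
  have \<sigma>1: "agree 21 \<sigma> \<sigma>1" "nmem \<sigma>1 21 = ?M" "fmem \<sigma>1 0 = \<one>" "out \<sigma>1 = out \<sigma>"
    using c by (auto simp: \<sigma>1_def agree_def)
  have c1: "nmem \<sigma>1 4 = 1" "nmem \<sigma>1 5 = 0" "nmem \<sigma>1 7 = g" "nmem \<sigma>1 9 = D" "nmem \<sigma>1 19 = i"
    using c \<sigma>1(1) by (auto simp: agree_def)
  define y where "y k = pow_prod F (\<lambda>j. e (elem_of g ?M j)) (\<lambda>j. 2 ^ i mod modulus_of g ?M j) k" for k
  have yc: "y k \<in> carrier F" for k
    unfolding y_def using e g by (intro pow_prod_closed) (simp add: elem_of_def)
  define J where "J k \<tau> \<longleftrightarrow> nmem \<tau> 21 = ?M div g ^ (2 * k) \<and> fmem \<tau> 0 = y k" for k and \<tau> :: "'a state"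
  have "wp F e (prog_for 20 9 prog_level) (\<lambda>t \<tau>. t \<le> 74 * K ^ 3 \<and> agree 20 \<sigma>1 \<tau> \<and> J D \<tau> \<and> out \<tau> = out \<sigma>) \<sigma>1"
  proof (rule wp_for[where J = J and f = "\<lambda>_. []" and T = "70 * K ^ 2"])
    show "J 0 (\<sigma>1\<lparr>nmem := (nmem \<sigma>1)(20 := v)\<rparr>)" for v using \<sigma>1 by (simp add: J_def y_def)
    show "J k (\<tau>\<lparr>nmem := (nmem \<tau>)(20 := v)\<rparr>)" if "J k \<tau>" for k \<tau> v using that by (simp add: J_def)
    fix k \<tau> assume a: "agree 20 \<sigma>1 \<tau>" and J: "J k \<tau>"
    have \<tau>: "nmem \<tau> 4 = 1" "nmem \<tau> 5 = 0" "nmem \<tau> 7 = g" "nmem \<tau> 19 = i"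
      using a c1 by (auto simp: agree_def)
    show "wp F e prog_level (\<lambda>t \<upsilon>. t \<le> 70 * K ^ 2 \<and> agree (Suc 20) \<tau> \<upsilon> \<and> J (Suc k) \<upsilon> \<and> out \<upsilon> = out \<tau> @ []) \<tau>"
    proof (rule wp_level[OF F \<tau>(1-4), where K = K and x = "?M div g ^ (2 * k)"])
      show "nmem \<tau> 21 = ?M div g ^ (2 * k)" "fmem \<tau> 0 \<in> carrier F" using J yc by (auto simp: J_def)
      have "?M div g ^ (2 * k) \<le> ?M" by simp
      then show "?M div g ^ (2 * k) \<le> K" using \<sigma>(3) by linarith
      fix t and \<upsilon> :: "'a state" assume t: "t \<le> 70 * (K * K)" "agree 21 \<tau> \<upsilon>" "nmem \<upsilon> 21 = ?M div g ^ (2 * k) div g div g" "out \<upsilon> = out \<tau>"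
        "fmem \<upsilon> 0 = fmem \<tau> 0 \<otimes> e (?M div g ^ (2 * k) div g mod g) [^] (2 ^ i mod (?M div g ^ (2 * k) mod g + 1))"
      have "?M div g ^ (2 * k) div g = ?M div g ^ (2 * k + 1)" "?M div g ^ (2 * k) div g div g = ?M div g ^ (2 * Suc k)"
        by (simp_all add: div_mult2_eq[symmetric] mult.commute mult.left_commute)
      then have "J (Suc k) \<upsilon>" using t J by (simp add: J_def y_def modulus_of_def elem_of_def)
      then show "t \<le> 70 * K ^ 2 \<and> agree (Suc 20) \<tau> \<upsilon> \<and> J (Suc k) \<upsilon> \<and> out \<upsilon> = out \<tau> @ []"
        using t by (simp add: power2_eq_square)
    qed (use g e K \<sigma> in auto)
  next
    fix t and \<tau> :: "'a state"
    assume t: "t \<le> nmem \<sigma>1 9 * (70 * K ^ 2 + 2) + 2" and a: "agree 20 \<sigma>1 \<tau>" and J: "J (nmem \<sigma>1 9) \<tau>"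
      and o: "out \<tau> = out \<sigma>1 @ concat (map (\<lambda>_. []) [0..<nmem \<sigma>1 9])"
    have "t \<le> (70 + 4) * K ^ Suc 2" using t K(3) unfolding c1(4) by (intro loop_time[of D])
    then have "t \<le> 74 * K ^ 3" by simp
    moreover have "out \<tau> = out \<sigma>" using o \<sigma>1(4) by (simp add: concat_eq_Nil_conv)
    ultimately show "t \<le> 74 * K ^ 3 \<and> agree 20 \<sigma>1 \<tau> \<and> J D \<tau> \<and> out \<tau> = out \<sigma>"
      using a J unfolding c1(4) by blast
  qed (use c1 in auto)
  then have "wp F e (prog_for 20 9 prog_level) (\<lambda>t. wp F e (Seq (Instr (NSub 22 16 17))
     (Seq (IfZero 22 (Instr (Out 2)) (Seq (Instr (NSub 22 22 4)) (IfZero 22 (Instr (Out 0)) (Instr (Out 2)))))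
       (Instr (NAdd 19 19 4)))) (\<lambda>t'. Q (1 + (1 + (t + t'))))) \<sigma>1"
  proof (rule wp_mono)
    fix t \<tau> assume t: "t \<le> 74 * K ^ 3 \<and> agree 20 \<sigma>1 \<tau> \<and> J D \<tau> \<and> out \<tau> = out \<sigma>"
    have ag: "agree 20 \<sigma> \<tau>" using agree_trans[of 20 \<sigma> \<sigma>1 20 \<tau>] \<sigma>1(1) t by (auto simp: agree_def)
    then have \<tau>: "nmem \<tau> 4 = 1" "nmem \<tau> 16 = nmem \<sigma> 16" "nmem \<tau> 17 = nmem \<sigma> 17" "nmem \<tau> 19 = i" "fmem \<tau> 2 = \<zero>"
      using c by (auto simp: agree_def)
    have f0: "fmem \<tau> 0 = entry F e D g ?M i" using t by (simp add: J_def y_def entry_def)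
    have K3: "1 \<le> K ^ 3" using K1 by simp
    show "wp F e (Seq (Instr (NSub 22 16 17))
     (Seq (IfZero 22 (Instr (Out 2)) (Seq (Instr (NSub 22 22 4)) (IfZero 22 (Instr (Out 0)) (Instr (Out 2)))))
       (Instr (NAdd 19 19 4)))) (\<lambda>t'. Q (1 + (1 + (t + t')))) \<tau>"
      apply (intro wp_Seq wp_Instr wp_IfZero)
      subgoal using t K3 ag \<tau> by (intro Q) (auto simp: agree_def out_entry_def)
      subgoal using t K3 ag \<tau> f0 by (intro Q) (auto simp: agree_def out_entry_def)
      subgoal using t K3 ag \<tau> by (intro Q) (auto simp: agree_def out_entry_def)
      done
  qed
  then show ?thesis unfolding prog_entry_def
    by (intro wp_Seq wp_Instr) (simp add: \<sigma>1_def)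
qed

lemma wp_cells:
  assumes \<sigma>: "env \<sigma>" "nmem \<sigma> 14 = m" "m \<le> K" "nmem \<sigma> 19 = i" "i + d \<le> K"
    and Q: "\<And>t \<tau>. t \<le> 94 * K ^ 4 \<Longrightarrow> agree 18 \<sigma> \<tau> \<Longrightarrow> nmem \<tau> 19 = i + d \<Longrightarrow>
      out \<tau> = out \<sigma> @ out_cells m (nmem \<sigma> 16) (nmem \<sigma> 17) i \<Longrightarrow> Q t \<tau>"
  shows "wp F e prog_cells Q \<sigma>"
  unfolding prog_cells_def
proof (rule wp_for[where J = "\<lambda>k \<tau>. nmem \<tau> 19 = i + k" and T = "90 * K ^ 3"
      and f = "\<lambda>k. [out_entry m (nmem \<sigma> 16) (nmem \<sigma> 17) (i + k)]"])
  have d: "nmem \<sigma> 2 = d" using \<sigma> by (simp add: env_def)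
  fix k and \<tau> :: "'a state" assume k: "k < nmem \<sigma> 2" and a: "agree 18 \<sigma> \<tau>" and i: "nmem \<tau> 19 = i + k"
  show "wp F e prog_entry (\<lambda>t \<upsilon>. t \<le> 90 * K ^ 3 \<and> agree (Suc 18) \<tau> \<upsilon> \<and> nmem \<upsilon> 19 = i + Suc k \<and>
     out \<upsilon> = out \<tau> @ [out_entry m (nmem \<sigma> 16) (nmem \<sigma> 17) (i + k)]) \<tau>"
    using k a i d \<sigma> agreeD[OF a, of 14] agreeD[OF a, of 16] agreeD[OF a, of 17]
    by (intro wp_entry[where m = m and i = "i + k"] env_agree[OF \<sigma>(1) a]) auto
next
  fix t \<tau> assume "t \<le> nmem \<sigma> 2 * (90 * K ^ 3 + 2) + 2" "agree 18 \<sigma> \<tau>" "nmem \<tau> 19 = i + nmem \<sigma> 2"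
    "out \<tau> = out \<sigma> @ concat (map (\<lambda>k. [out_entry m (nmem \<sigma> 16) (nmem \<sigma> 17) (i + k)]) [0..<nmem \<sigma> 2])"
  moreover have "nmem \<sigma> 2 = d" using \<sigma>(1) by (simp add: env_def)
  ultimately show "Q t \<tau>"
    using loop_time[of d t 90 3] K(2) by (intro Q) (simp_all add: out_cells_def)
qed (use \<sigma> in \<open>auto simp: env_def\<close>)

lemma wp_rows:
  assumes \<sigma>: "env \<sigma>" "nmem \<sigma> 14 = m" "m \<le> K" "nmem \<sigma> 19 = i" "i + (d + 1) * d \<le> K"
    and Q: "\<And>t \<tau>. t \<le> 98 * K ^ 5 \<Longrightarrow> agree 17 \<sigma> \<tau> \<Longrightarrow> nmem \<tau> 19 = i + (d + 1) * d \<Longrightarrow>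
      out \<tau> = out \<sigma> @ out_rows m (nmem \<sigma> 16) i \<Longrightarrow> Q t \<tau>"
  shows "wp F e prog_rows Q \<sigma>"
  unfolding prog_rows_def
proof (rule wp_for[where J = "\<lambda>k \<tau>. nmem \<tau> 19 = i + k * d" and T = "94 * K ^ 4"
      and f = "\<lambda>k. out_cells m (nmem \<sigma> 16) (d + 1 - k) (i + k * d)"])
  have d: "nmem \<sigma> 12 = d + 1" using \<sigma> by (simp add: env_def)
  fix k and \<tau> :: "'a state"
  assume k: "k < nmem \<sigma> 12" and a: "agree 17 \<sigma> \<tau>" and r: "nmem \<tau> 17 = nmem \<sigma> 12 - k" and i: "nmem \<tau> 19 = i + k * d"
  have "Suc k * d \<le> (d + 1) * d" using k d by (intro mult_le_mono1) simp
  then have b: "i + k * d + d \<le> K" using \<sigma>(5) unfolding mult_Suc by linarith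
  show "wp F e prog_cells (\<lambda>t \<upsilon>. t \<le> 94 * K ^ 4 \<and> agree (Suc 17) \<tau> \<upsilon> \<and> nmem \<upsilon> 19 = i + Suc k * d \<and>
     out \<upsilon> = out \<tau> @ out_cells m (nmem \<sigma> 16) (d + 1 - k) (i + k * d)) \<tau>"
    using r i d \<sigma> b agreeD[OF a, of 14] agreeD[OF a, of 16]
    by (intro wp_cells[where m = m and i = "i + k * d"] env_agree[OF \<sigma>(1) a]) auto
next
  fix t \<tau> assume "t \<le> nmem \<sigma> 12 * (94 * K ^ 4 + 2) + 2" "agree 17 \<sigma> \<tau>" "nmem \<tau> 19 = i + nmem \<sigma> 12 * d"
    "out \<tau> = out \<sigma> @ concat (map (\<lambda>k. out_cells m (nmem \<sigma> 16) (d + 1 - k) (i + k * d)) [0..<nmem \<sigma> 12])"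
  moreover have "nmem \<sigma> 12 = d + 1" using \<sigma>(1) by (simp add: env_def)
  ultimately show "Q t \<tau>"
    using loop_time[of "d + 1" t 94 4] K(2) by (intro Q) (simp_all add: out_rows_def del: upt_Suc)
qed (use \<sigma> in \<open>auto simp: env_def\<close>)

lemma wp_elem:
  assumes \<sigma>: "env \<sigma>" "nmem \<sigma> 14 = m" "m \<le> K" "nmem \<sigma> 19 = i" "i + (d + 1) * ((d + 1) * d) \<le> K"
    and Q: "\<And>t \<tau>. t \<le> 103 * K ^ 6 \<Longrightarrow> agree 16 \<sigma> \<tau> \<Longrightarrow> nmem \<tau> 19 = i + (d + 1) * ((d + 1) * d) \<Longrightarrow>
      out \<tau> = out \<sigma> @ out_elem m i \<Longrightarrow> Q t \<tau>"
  shows "wp F e prog_elem Q \<sigma>"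
  unfolding prog_elem_def
proof (rule wp_Seq, rule wp_for[where J = "\<lambda>k \<tau>. nmem \<tau> 19 = i + k * ((d + 1) * d)" and T = "98 * K ^ 5"
      and f = "\<lambda>k. out_rows m (d + 1 - k) (i + k * ((d + 1) * d))"])
  have d: "nmem \<sigma> 12 = d + 1" using \<sigma> by (simp add: env_def)
  fix k and \<tau> :: "'a state"
  assume k: "k < nmem \<sigma> 12" and a: "agree 16 \<sigma> \<tau>" and r: "nmem \<tau> 16 = nmem \<sigma> 12 - k" and i: "nmem \<tau> 19 = i + k * ((d + 1) * d)"
  have "Suc k * ((d + 1) * d) \<le> (d + 1) * ((d + 1) * d)" using k d by (intro mult_le_mono1) simp
  then have b: "i + k * ((d + 1) * d) + (d + 1) * d \<le> K" using \<sigma>(5) unfolding mult_Suc by linarith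
  show "wp F e prog_rows (\<lambda>t \<upsilon>. t \<le> 98 * K ^ 5 \<and> agree (Suc 16) \<tau> \<upsilon> \<and> nmem \<upsilon> 19 = i + Suc k * ((d + 1) * d) \<and>
     out \<upsilon> = out \<tau> @ out_rows m (d + 1 - k) (i + k * ((d + 1) * d))) \<tau>"
    using r i d \<sigma> b agreeD[OF a, of 14]
    by (intro wp_rows[where m = m and i = "i + k * ((d + 1) * d)"] env_agree[OF \<sigma>(1) a]) auto
next
  fix t \<tau> assume t: "t \<le> nmem \<sigma> 12 * (98 * K ^ 5 + 2) + 2" and a: "agree 16 \<sigma> \<tau>" and i: "nmem \<tau> 19 = i + nmem \<sigma> 12 * ((d + 1) * d)"
    and o: "out \<tau> = out \<sigma> @ concat (map (\<lambda>k. out_rows m (d + 1 - k) (i + k * ((d + 1) * d))) [0..<nmem \<sigma> 12])"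
  have d: "nmem \<sigma> 12 = d + 1" using \<sigma> by (simp add: env_def)
  have z: "fmem \<tau> 2 = \<zero>" using a \<sigma>(1) by (simp add: env_def agree_def)
  have "t \<le> 102 * K ^ 6"
    using t d loop_time[of "d + 1" t 98 5] K(2) by simp
  moreover have "1 \<le> K ^ 6" using K1 by simp
  ultimately show "wp F e (Instr (Out 2)) (\<lambda>t2. Q (t + t2)) \<tau>"
    using a i o z d by (intro wp_Instr Q) (auto simp: out_elem_def agree_def simp del: upt_Suc)
qed (use \<sigma> in \<open>auto simp: env_def\<close>)

lemma wp_point:
  assumes \<sigma>: "env \<sigma>" "nmem \<sigma> 14 = m" "m \<le> K"
    and Q: "\<And>t \<tau>. t \<le> 108 * K ^ 7 \<Longrightarrow> agree 15 \<sigma> \<tau> \<Longrightarrow> out \<tau> = out \<sigma> @ out_point m \<Longrightarrow> Q t \<tau>"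
  shows "wp F e prog_point Q \<sigma>"
  unfolding prog_point_def
proof (rule wp_Seq, rule wp_Instr,
    rule wp_for[where J = "\<lambda>k \<tau>. nmem \<tau> 19 = k * ((d + 1) * ((d + 1) * d))" and T = "103 * K ^ 6"
      and f = "\<lambda>k. out_elem m (k * ((d + 1) * ((d + 1) * d)))"])
  let ?\<sigma> = "step F e (NConst 19 0) \<sigma>"
  have \<sigma>': "env ?\<sigma>" "nmem ?\<sigma> 14 = m" "nmem ?\<sigma> 0 = n" using \<sigma> by (auto simp: env_def)
  fix k and \<tau> :: "'a state"
  assume k: "k < nmem ?\<sigma> 0" and a: "agree 15 ?\<sigma> \<tau>" and i: "nmem \<tau> 19 = k * ((d + 1) * ((d + 1) * d))"
  have "Suc k * ((d + 1) * ((d + 1) * d)) \<le> n * ((d + 1) * ((d + 1) * d))" using k \<sigma>' by (intro mult_le_mono1) simp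
  then have b: "k * ((d + 1) * ((d + 1) * d)) + (d + 1) * ((d + 1) * d) \<le> K" using K(5) unfolding mult_Suc by linarith
  show "wp F e prog_elem (\<lambda>t \<upsilon>. t \<le> 103 * K ^ 6 \<and> agree (Suc 15) \<tau> \<upsilon> \<and> nmem \<upsilon> 19 = Suc k * ((d + 1) * ((d + 1) * d)) \<and>
     out \<upsilon> = out \<tau> @ out_elem m (k * ((d + 1) * ((d + 1) * d)))) \<tau>"
    using i \<sigma>' \<sigma>(3) b agreeD[OF a, of 14]
    by (intro wp_elem[where m = m and i = "k * ((d + 1) * ((d + 1) * d))"] env_agree[OF \<sigma>'(1) a]) auto
next
  let ?\<sigma> = "step F e (NConst 19 0) \<sigma>"
  fix t \<tau> assume t: "t \<le> nmem ?\<sigma> 0 * (103 * K ^ 6 + 2) + 2" and a: "agree 15 ?\<sigma> \<tau>"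
    and o: "out \<tau> = out ?\<sigma> @ concat (map (\<lambda>k. out_elem m (k * ((d + 1) * ((d + 1) * d)))) [0..<nmem ?\<sigma> 0])"
  have n: "nmem ?\<sigma> 0 = n" using \<sigma> by (simp add: env_def)
  have "t \<le> 107 * K ^ 7"
    using t n loop_time[of n t 103 6] K(1) by simp
  moreover have "1 \<le> K ^ 7" using K1 by simp
  moreover have "agree 15 \<sigma> \<tau>" using a by (auto simp: agree_def)
  ultimately show "Q (1 + t) \<tau>"
    using o n by (intro Q) (auto simp: out_point_def)
qed (use \<sigma> in \<open>auto simp: env_def\<close>)

end

end

section \<open>Computing the parameters\<close>

definition prog_power :: "nat \<Rightarrow> nat \<Rightarrow> com" where
  "prog_power p b = WhileNonZero 8 (Seq (prog_mul p p b 21) (Instr (NSub 8 8 4)))"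

lemma wp_power:
  assumes c: "nmem \<sigma> 4 = 1" "nmem \<sigma> 5 = 0" "nmem \<sigma> 21 = 0" "nmem \<sigma> p = 1" "nmem \<sigma> b = B" "nmem \<sigma> 8 = N" "1 \<le> B"
    and r: "p \<notin> {4, 5, 8, 21, b}" "b \<notin> {8, 21}"
    and Q: "\<And>t. t \<le> N * (3 * B ^ N + 5) + 1 \<Longrightarrow> Q t (\<sigma>\<lparr>nmem := (nmem \<sigma>)(8 := 0, p := B ^ N)\<rparr>)"
  shows "wp F e (prog_power p b) Q \<sigma>"
proof -
  define I where "I k \<tau> \<longleftrightarrow> k \<le> N \<and> \<tau> = \<sigma>\<lparr>nmem := (nmem \<sigma>)(8 := k, p := B ^ (N - k))\<rparr>" for k and \<tau> :: "'a state"
  show ?thesis unfolding prog_power_def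
  proof (rule wp_While[where I = I and N = N and T = "3 * B ^ N + 4"])
    show "I N \<sigma>" unfolding I_def using c r by (auto simp: fun_eq_iff intro!: state.equality)
    fix k and \<tau> :: "'a state" assume I: "I (Suc k) \<tau>"
    then have k: "Suc k \<le> N" by (simp add: I_def)
    then have e: "N - k = Suc (N - Suc k)" by simp
    have le: "B ^ (N - Suc k) \<le> B ^ N" using c(7) by (intro power_increasing) auto
    have \<tau>: "nmem \<tau> 4 = 1" "nmem \<tau> 5 = 0" "nmem \<tau> p = B ^ (N - Suc k)" "nmem \<tau> b = B"
      using I c r by (auto simp: I_def)
    have "wp F e (Seq (prog_mul p p b 21) (Instr (NSub 8 8 4))) (\<lambda>t \<tau>. t \<le> 3 * B ^ N + 4 \<and> I k \<tau>) \<tau>"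
    proof (intro wp_Seq wp_mul wp_Instr)
      fix t assume t: "t \<le> 3 * nmem \<tau> p + 3"
      have "I k (step F e (NSub 8 8 4) (\<tau>\<lparr>nmem := (nmem \<tau>)(21 := 0, p := nmem \<tau> p * nmem \<tau> b)\<rparr>))"
        using I c r e \<tau> k by (auto simp: I_def fun_eq_iff mult.commute intro!: state.equality)
      then show "t + 1 \<le> 3 * B ^ N + 4 \<and>
          I k (step F e (NSub 8 8 4) (\<tau>\<lparr>nmem := (nmem \<tau>)(21 := 0, p := nmem \<tau> p * nmem \<tau> b)\<rparr>))"
        using t \<tau> le by simp
    qed (use \<tau> r in auto)
    then show "nmem \<tau> 8 \<noteq> 0 \<and> wp F e (Seq (prog_mul p p b 21) (Instr (NSub 8 8 4))) (\<lambda>t \<tau>. t \<le> 3 * B ^ N + 4 \<and> I k \<tau>) \<tau>"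
      using I r by (simp add: I_def)
  next
    show "nmem \<tau> 8 = 0" if "I 0 \<tau>" for \<tau> using that r by (simp add: I_def)
    show "Q t \<tau>" if t: "t \<le> N * (3 * B ^ N + 4 + 1) + 1" and I: "I 0 \<tau>" for t \<tau>
    proof -
      have "t \<le> N * (3 * B ^ N + 5) + 1" using t by (simp add: algebra_simps)
      from Q[OF this] I show ?thesis by (simp add: I_def)
    qed
  qed
qed

definition prog_setup :: com where
  "prog_setup = Seq (Instr (NConst 4 1)) (Seq (prog_mul 6 0 1 21) (Seq (prog_mul 6 6 2 21)
     (Seq (Instr (NConst 7 1)) (Seq (Instr (NConst 8 20)) (Seq (prog_power 7 6)
     (Seq (Instr (NAdd 9 3 4)) (Seq (Instr (NSub 10 9 2)) (Seq (Instr (NSub 9 9 10))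
     (Seq (Instr (NConst 11 1)) (Seq (Instr (NAdd 8 9 9)) (Seq (prog_power 11 7)
       (Instr (NAdd 12 2 4)))))))))))))"

definition prog_main :: com where
  "prog_main = Seq prog_setup (prog_for 14 11 prog_point)"

lemma wp_setup:
  fixes n s d \<Delta> :: nat
  assumes "1 \<le> n * s * d"
  defines "g \<equiv> (n * s * d) ^ 20" and "D \<equiv> min (\<Delta> + 1) d"
  assumes Q: "\<And>t \<tau>. t \<le> 3 * n + 3 * (n * s) + 20 * (3 * g + 5) + 2 * D * (3 * g ^ (2 * D) + 5) + 20 \<Longrightarrow>
      env F n d D g \<tau> \<Longrightarrow> nmem \<tau> 11 = g ^ (2 * D) \<Longrightarrow> out \<tau> = [] \<Longrightarrow> Q t \<tau>"
  shows "wp F e prog_setup Q (init_state F [n, s, d, \<Delta>])"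
proof -
  have init: "nmem (init_state F [n, s, d, \<Delta>]) 0 = n" "nmem (init_state F [n, s, d, \<Delta>]) (Suc 0) = s"
    "nmem (init_state F [n, s, d, \<Delta>]) 2 = d" "nmem (init_state F [n, s, d, \<Delta>]) 3 = \<Delta>"
    "nmem (init_state F [n, s, d, \<Delta>]) 5 = 0" "nmem (init_state F [n, s, d, \<Delta>]) 21 = 0"
    "fmem (init_state F [n, s, d, \<Delta>]) 2 = \<zero>\<^bsub>F\<^esub>" "out (init_state F [n, s, d, \<Delta>]) = []"
    by (simp_all add: init_state_def numeral_2_eq_2 numeral_3_eq_3)
  define \<sigma> where "\<sigma> = init_state F [n, s, d, \<Delta>]"
  note init = init[folded \<sigma>_def]
  \<comment> \<open>With truncated subtraction, this expression is the minimum of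
    \<open>\<Delta> + 1\<close> and \<open>d\<close>.\<close>
  have D: "Suc \<Delta> - (Suc \<Delta> - d) = D" by (auto simp: D_def)
  define u where "u = n * s * d"
  have u: "n * s * d = u" "Suc 0 \<le> u" using assms(1) by (auto simp: u_def)
  have gu: "u ^ 20 = g" "Suc 0 \<le> g" using u by (auto simp: g_def u_def)
  note e = init D u gu
  show ?thesis
    unfolding prog_setup_def \<sigma>_def[symmetric]
    apply (rule wp_Seq, rule wp_Instr, simp add: e)
    apply (rule wp_Seq)
    apply (rule wp_mul; (simp add: e)?)
    apply (rule wp_Seq)
    apply (rule wp_mul; (simp add: e)?)
    apply (rule wp_Seq, rule wp_Instr, simp add: e)
    apply (rule wp_Seq, rule wp_Instr, simp add: e)
    apply (rule wp_Seq)
    apply (rule wp_power[where B = u and N = 20]; (simp add: e)?)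
    apply (rule wp_Seq, rule wp_Instr, simp add: e)
    apply (rule wp_Seq, rule wp_Instr, simp add: e)
    apply (rule wp_Seq, rule wp_Instr, simp add: e)
    apply (rule wp_Seq, rule wp_Instr, simp add: e)
    apply (rule wp_Seq, rule wp_Instr, simp add: e)
    apply (rule wp_Seq)
    apply (rule wp_power[where B = g and N = "2 * D"]; (simp add: e)?)
    apply (rule wp_Instr)
    apply (rule Q; (simp add: e env_def mult_2)?)
    done
qed

section \<open>The output against the required encoding\<close>

lemma encode_elem_eq:
  "encode_elem d x = concat (map (\<lambda>p. concat (map (\<lambda>q. map (\<lambda>k. fst x (Suc p, Suc q, Suc k)) [0..<d]) [0..<d + 1]))
     [0..<d + 1]) @ [snd x]"
proof -
  have "[1..<d + 2] = map Suc [0..<d + 1]" "[1..<d + 1] = map Suc [0..<d]"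
    by (simp_all add: map_Suc_upt del: upt_Suc)
  then show ?thesis
    unfolding encode_elem_def by (simp add: product_concat_map map_concat comp_def del: upt_Suc)
qed

text \<open>The counters \<open>d + 1 - p\<close> and \<open>d + 1 - q\<close> differ by 1 exactly
  when \<open>q = p + 1\<close>, and in those cells the running count of cells equals
  \<open>letter_idx\<close>.\<close>

lemma out_point_eq_encode:
  "out_point F e n d D g m = encode_point n d (hit_point F e n d D g (m - 1))"
proof -
  have "out_elem F e d D g m (i * ((d + 1) * ((d + 1) * d))) = encode_elem d (hit_point F e n d D g (m - 1) (Suc i))"
    if i: "i < n" for i
  proof -
    have cell: "out_entry F e D g m (d + 1 - p) (d + 1 - q) (i * ((d + 1) * ((d + 1) * d)) + p * ((d + 1) * d) + q * d + k) =
      fst (hit_point F e n d D g (m - 1) (Suc i)) (Suc p, Suc q, Suc k)"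
      if "p < d + 1" "q < d + 1" "k < d" for p q k
    proof -
      have "(Suc p, Suc q, Suc k) \<in> cube_idx d" using that by (auto simp: cube_idx_def)
      moreover have "d + 1 - p = d + 1 - q + 1 \<longleftrightarrow> q = p + 1" using that by auto
      moreover have "letter_idx d (Suc i, Suc k, Suc p) = i * ((d + 1) * ((d + 1) * d)) + p * ((d + 1) * d) + (p + 1) * d + k"
        by (simp add: letter_idx_def algebra_simps)
      ultimately show ?thesis
        using i unfolding out_entry_def hit_point_def shift_point_def by auto
    qed
    have "snd (hit_point F e n d D g (m - 1) (Suc i)) = \<zero>\<^bsub>F\<^esub>"
      using i unfolding hit_point_def shift_point_def by simp
    moreover have "out_cells F e d D g m (d + 1 - p) (d + 1 - q) (i * ((d + 1) * ((d + 1) * d)) + p * ((d + 1) * d) + q * d) =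
        map (\<lambda>k. fst (hit_point F e n d D g (m - 1) (Suc i)) (Suc p, Suc q, Suc k)) [0..<d]"
      if "p < d + 1" "q < d + 1" for p q
    proof -
      have "map (\<lambda>k. out_entry F e D g m (d + 1 - p) (d + 1 - q) (i * ((d + 1) * ((d + 1) * d)) + p * ((d + 1) * d) + q * d + k)) [0..<d] =
        map (\<lambda>k. fst (hit_point F e n d D g (m - 1) (Suc i)) (Suc p, Suc q, Suc k)) [0..<d]"
        using cell[OF that] by (intro map_cong) auto
      then show ?thesis unfolding out_cells_def by (simp only: concat_map_singleton)
    qed
    then have "out_rows F e d D g m (d + 1 - p) (i * ((d + 1) * ((d + 1) * d)) + p * ((d + 1) * d)) =
        concat (map (\<lambda>q. map (\<lambda>k. fst (hit_point F e n d D g (m - 1) (Suc i)) (Suc p, Suc q, Suc k)) [0..<d]) [0..<d + 1])"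
      if "p < d + 1" for p
      using that unfolding out_rows_def by (intro arg_cong[where f = concat] map_cong) auto
    ultimately show ?thesis
      unfolding out_elem_def encode_elem_eq by (intro arg_cong2[where f = append] arg_cong[where f = concat] map_cong) auto
  qed
  then have "out_point F e n d D g m = concat (map (\<lambda>i. encode_elem d (hit_point F e n d D g (m - 1) (Suc i))) [0..<n])"
    unfolding out_point_def by (intro arg_cong[where f = concat] map_cong) auto
  also have "\<dots> = encode_point n d (hit_point F e n d D g (m - 1))"
    unfolding encode_point_def by (simp add: map_Suc_upt[symmetric] comp_def del: upt_Suc map_Suc_upt)
  finally show ?thesis .
qed

theorem prog_main_computes:
  fixes n s d \<Delta> :: nat
  assumes F: "field F" and n: "1 \<le> n" and s: "1 \<le> s" and d: "1 \<le> d"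
    and e: "\<And>i. i < (n * s * d) ^ 20 \<Longrightarrow> e i \<in> carrier F"
  defines "g \<equiv> (n * s * d) ^ 20" and "D \<equiv> min (\<Delta> + 1) d"
  shows "computes_within F e prog_main [n, s, d, \<Delta>] n d (hit_point F e n d D g ` {..<g ^ (2 * D)})
           (412 * (4 * g ^ (2 * D)) ^ 8)"
proof -
  define u where "u = n * s * d"
  define G where "G = g ^ (2 * D)"
  \<comment> \<open>The factor 4 comes from \<open>d + 1 \<le> 2 * d\<close>, applied twice in the
    number of cells.\<close>
  define K where "K = 4 * G"
  have u: "1 \<le> u" using n s d by (simp add: u_def)
  have nu: "n * d \<le> u" "n * s \<le> u" "n \<le> u" "d \<le> u" using n s d by (auto simp: u_def)
  have D: "1 \<le> D" "D \<le> d" using d by (auto simp: D_def)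
  have g1: "1 \<le> g" using u by (simp add: g_def u_def)
  have gG: "g \<le> G" unfolding G_def using D g1 by (intro self_le_power) auto
  have "u ^ 3 \<le> u ^ 20" "u ^ 1 \<le> u ^ 20" using u by (intro power_increasing; simp)+
  then have u3: "u ^ 3 \<le> G" "u \<le> G" using gG by (auto simp: g_def u_def)
  have "n * ((d + 1) * ((d + 1) * d)) \<le> n * ((2 * d) * ((2 * d) * d))" using d by (intro mult_le_mono) auto
  also have "\<dots> = 4 * ((n * d) * (d * d))" by simp
  also have "\<dots> \<le> 4 * (u * (u * u))" using nu by (intro mult_le_mono) auto
  also have "\<dots> \<le> K" using u3 by (simp add: K_def power3_eq_cube)
  finally have K5: "n * ((d + 1) * ((d + 1) * d)) \<le> K" .
  have K: "n \<le> K" "d + 1 \<le> K" "D \<le> K" "g \<le> K" "n * s \<le> K"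
    using nu u3 gG D d unfolding K_def by linarith+
  have K1: "1 \<le> K" using K n by simp
  have GK: "G \<le> K" by (simp add: K_def)
  have "wp F e prog_main (\<lambda>t \<tau>. t \<le> 412 * K ^ 8 \<and>
      out \<tau> = concat (map (\<lambda>k. out_point F e n d D g (G - k)) [0..<G])) (init_state F [n, s, d, \<Delta>])"
    unfolding prog_main_def
  proof (rule wp_Seq, rule wp_setup)
    show "1 \<le> n * s * d" using u by (simp add: u_def)
    fix t1 and \<sigma> :: "'a state"
    assume t1: "t1 \<le> 3 * n + 3 * (n * s) + 20 * (3 * (n * s * d) ^ 20 + 5) +
        2 * min (\<Delta> + 1) d * (3 * ((n * s * d) ^ 20) ^ (2 * min (\<Delta> + 1) d) + 5) + 20"
      and env: "env F n d (min (\<Delta> + 1) d) ((n * s * d) ^ 20) \<sigma>"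
      and G11: "nmem \<sigma> 11 = ((n * s * d) ^ 20) ^ (2 * min (\<Delta> + 1) d)" and o: "out \<sigma> = []"
    note fold = g_def[symmetric] D_def[symmetric] G_def[symmetric]
    have env: "env F n d D g \<sigma>" and G11: "nmem \<sigma> 11 = G"
      using env G11 unfolding fold by auto
    have t1: "t1 \<le> 300 * K ^ 2"
    proof -
      define P where "P = 2 * D * (3 * G + 5)"
      have "P \<le> 2 * K * (3 * K + 5)" unfolding P_def using K GK by (intro mult_le_mono) auto
      also have "\<dots> = 6 * (K * K) + 10 * K" by (simp add: algebra_simps)
      finally have "P \<le> 6 * (K * K) + 10 * K" .
      moreover have "t1 \<le> 3 * n + 3 * (n * s) + (60 * g + 100) + P + 20"
        using t1 unfolding fold P_def by simp
      moreover have "K \<le> K * K" using K1 by simp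
      ultimately have "t1 \<le> 300 * (K * K)" using K(1,4,5) K1 by linarith
      then show ?thesis by (simp add: power2_eq_square)
    qed
    show "wp F e (prog_for 14 11 prog_point) (\<lambda>t2 \<tau>. t1 + t2 \<le> 412 * K ^ 8 \<and>
      out \<tau> = concat (map (\<lambda>k. out_point F e n d D g (G - k)) [0..<G])) \<sigma>"
    proof (rule wp_for[where J = "\<lambda>_ _. True" and T = "108 * K ^ 7" and f = "\<lambda>k. out_point F e n d D g (G - k)"])
      fix k and \<tau> :: "'a state"
      assume a: "agree 14 \<sigma> \<tau>" and r: "nmem \<tau> 14 = nmem \<sigma> 11 - k"
      show "wp F e prog_point (\<lambda>t \<upsilon>. t \<le> 108 * K ^ 7 \<and> agree (Suc 14) \<tau> \<upsilon> \<and> True \<and>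
          out \<upsilon> = out \<tau> @ out_point F e n d D g (G - k)) \<tau>"
      proof (rule wp_point[OF F _ _ K(1-4) K5])
        show "env F n d D g \<tau>" by (rule env_agree[OF env a]) simp
        show "nmem \<tau> 14 = G - k" using r G11 by simp
        show "G - k \<le> K" using GK by simp
      qed (use g1 n s d e in \<open>auto simp: g_def\<close>)
    next
      fix t2 and \<tau> :: "'a state"
      assume t2: "t2 \<le> nmem \<sigma> 11 * (108 * K ^ 7 + 2) + 2"
        and o2: "out \<tau> = out \<sigma> @ concat (map (\<lambda>k. out_point F e n d D g (G - k)) [0..<nmem \<sigma> 11])"
      \<comment> \<open>The loop contributes 112 and the setup 300, together 412.\<close>
      have "t2 \<le> (108 + 4) * K ^ Suc 7"
        by (rule loop_time[OF F _ _ K(1-4) K5 GK]) (use t2 G11 g1 n s d e in \<open>auto simp: g_def\<close>)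
      moreover have "K ^ 2 \<le> K ^ 8" using K1 by (intro power_increasing) auto
      ultimately have "t1 + t2 \<le> 412 * K ^ 8" using t1 by simp
      then show "t1 + t2 \<le> 412 * K ^ 8 \<and> out \<tau> = concat (map (\<lambda>k. out_point F e n d D g (G - k)) [0..<G])"
        using o o2 G11 by simp
    qed (use env in \<open>auto simp: env_def\<close>)
  qed
  then obtain t \<tau> where t: "exec F e prog_main (init_state F [n, s, d, \<Delta>]) t \<tau>" "t \<le> 412 * K ^ 8"
      "out \<tau> = concat (map (\<lambda>k. out_point F e n d D g (G - k)) [0..<G])"
    unfolding wp_def by blast
  \<comment> \<open>The outer counter runs down as well, so the points appear by decreasing
    code.\<close>
  let ?hs = "map (\<lambda>k. hit_point F e n d D g (G - k - 1)) [0..<G]"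
  have "set ?hs = hit_point F e n d D g ` {..<G}"
  proof -
    have "set ?hs = hit_point F e n d D g ` (\<lambda>k. G - k - 1) ` {..<G}"
      by (simp add: image_image lessThan_atLeast0)
    also have "(\<lambda>k. G - k - 1) ` {..<G} = {..<G}"
    proof (intro equalityI subsetI)
      fix x assume "x \<in> {..<G}"
      then show "x \<in> (\<lambda>k. G - k - 1) ` {..<G}" by (intro image_eqI[of _ _ "G - x - 1"]) auto
    qed auto
    finally show ?thesis .
  qed
  moreover have "out \<tau> = concat (map (encode_point n d) ?hs)"
    unfolding t(3) by (simp add: out_point_eq_encode comp_def)
  ultimately show ?thesis
    unfolding computes_within_def G_def[symmetric] K_def[symmetric] using t(1,2) by blast
qed

theorem mainTheorem5:
  shows "\<exists>(P :: com) (c :: nat).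
    \<forall>(F :: 'a ring) (e :: nat \<Rightarrow> 'a) (n :: nat) (s :: nat) (d :: nat) (\<Delta> :: nat).
      field F \<longrightarrow> 1 \<le> n \<longrightarrow> 1 \<le> s \<longrightarrow> 1 \<le> d \<longrightarrow> 1 \<le> \<Delta> \<longrightarrow>
      field_supply F (c * (n * s * d) ^ c) e \<longrightarrow>
      (\<exists>H. H \<subseteq> points F n d \<and>
           finite H \<and> card H \<le> (n * s * d) ^ (c * \<Delta>) \<and>
           hits F n s d \<Delta> H \<and>
           computes_within F e P [n, s, d, \<Delta>] n d H (c * (n * s * d) ^ (c * \<Delta>)))"
proof (rule exI[of _ prog_main], rule exI[of _ "412 * 4 ^ 8"], intro allI impI)
  fix F :: "'a ring" and e :: "nat \<Rightarrow> 'a" and n s d \<Delta> :: nat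
  \<comment> \<open>As a factor it is what remains of \<open>412 * (4 * g ^ (2 * D)) ^ 8\<close>
    besides a power of \<open>u\<close>. As an exponent it far exceeds what is required, since
    \<open>320 * D \<le> 640 * \<Delta>\<close>.\<close>
  let ?c = "412 * 4 ^ 8 :: nat"
  assume F: "field F" and n: "1 \<le> n" and s: "1 \<le> s" and d: "1 \<le> d" and \<Delta>: "1 \<le> \<Delta>"
    and sup: "field_supply F (?c * (n * s * d) ^ ?c) e"
  define u where "u = n * s * d"
  define D where "D = min (\<Delta> + 1) d"
  define g where "g = u ^ 20"
  define H where "H = hit_point F e n d D g ` {..<g ^ (2 * D)}"
  have u: "1 \<le> u" using n s d by (simp add: u_def)
  have pw: "u ^ a \<le> u ^ b" if "a \<le> b" for a b using that u by (intro power_increasing) auto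
  have "u ^ 20 \<le> 1 * u ^ ?c" unfolding mult_1 by (rule pw) simp
  also have "\<dots> \<le> ?c * u ^ ?c" by (intro mult_right_mono) simp_all
  finally have le: "u ^ 20 \<le> ?c * u ^ ?c" .
  then have "{..<u ^ 20} \<subseteq> {..<?c * u ^ ?c}" by (simp only: lessThan_subset_iff)
  then have sup': "field_supply F (u ^ 20) e"
    using sup unfolding field_supply_def u_def[symmetric] by (meson image_mono inj_on_subset subset_trans)
  then have ec: "e i \<in> carrier F" if "i < u ^ 20" for i using that by (auto simp: field_supply_def)
  \<comment> \<open>Here \<open>1 \<le> \<Delta>\<close> absorbs the additional level of the leaves
    into the exponent.\<close>
  have D: "D \<le> 2 * \<Delta>" using \<Delta> by (simp add: D_def)
  have G: "g ^ (2 * D) = u ^ (40 * D)" by (simp add: g_def flip: power_mult)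
  note hit = hit_points_hit[OF F n s d sup'[unfolded u_def], where \<Delta> = \<Delta>, folded u_def, folded g_def D_def]
  have "card H \<le> u ^ (40 * D)"
    unfolding H_def G using card_image_le[of "{..<u ^ (40 * D)}" "hit_point F e n d D g"] by simp
  also have "\<dots> \<le> u ^ (?c * \<Delta>)" using D by (intro pw) simp
  finally have card: "card H \<le> u ^ (?c * \<Delta>)" .
  have "412 * (4 * g ^ (2 * D)) ^ 8 = ?c * u ^ (320 * D)"
    unfolding G by (simp add: power_mult_distrib flip: power_mult)
  also have "\<dots> \<le> ?c * u ^ (?c * \<Delta>)" using D by (intro mult_left_mono pw) simp_all
  finally have time: "412 * (4 * g ^ (2 * D)) ^ 8 \<le> ?c * u ^ (?c * \<Delta>)" .
  have "computes_within F e prog_main [n, s, d, \<Delta>] n d H (412 * (4 * g ^ (2 * D)) ^ 8)"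
    using prog_main_computes[OF F n s d ec[unfolded u_def], where \<Delta> = \<Delta>, folded u_def, folded g_def D_def]
    unfolding H_def by simp
  then have comp: "computes_within F e prog_main [n, s, d, \<Delta>] n d H (?c * u ^ (?c * \<Delta>))"
    using time le_trans unfolding computes_within_def by blast
  show "\<exists>H. H \<subseteq> points F n d \<and> finite H \<and> card H \<le> (n * s * d) ^ (?c * \<Delta>) \<and> hits F n s d \<Delta> H \<and>
     computes_within F e prog_main [n, s, d, \<Delta>] n d H (?c * (n * s * d) ^ (?c * \<Delta>))"
    unfolding u_def[symmetric]
  proof (intro exI[of _ H] conjI)
    show "H \<subseteq> points F n d" using hit(2) by (auto simp: H_def)
    show "finite H" by (simp add: H_def)
    show "hits F n s d \<Delta> H" using hit(1) by (simp add: H_def)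
  qed (rule card comp)+
qed

end
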